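(* Every cofinal subframe logic $L\supseteq\mathsf{K4.3}$ has the quasi-polysize bisimilar model property with size bound $\boldsymbol k(\varphi_1,\varphi_2)$: for any formulas $\varphi_1,\varphi_2$ without a Craig interpolant in $L$, with $\delta=\mathit{sig}(\varphi_1)\cup\mathit{sig}(\varphi_2)$ and $\sigma=\mathit{sig}(\varphi_1)\cap\mathit{sig}(\varphi_2)$, there exist rooted $\delta$-models $\mathfrak N_1,x_1$ and $\mathfrak N_2,x_2$, each the ordered sum of finitely many simple $\delta$-models based on atomic frames, such that $\mathfrak N_1,x_1\models\varphi_1$, $\mathfrak N_2,x_2\models\neg\varphi_2$, both are based on frames for $L$, $\mathfrak N_1,x_1\sim_\sigma\mathfrak N_2,x_2$, and $\|\mathfrak N_i\|\le\boldsymbol k(\varphi_1,\varphi_2)$ for $i=1,2$.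
   Context: Modal formulas over $p_0,p_1,\dots$ with $\top,\bot,\neg,\wedge,\Diamond$; $\Box=\neg\Diamond\neg$; $\mathit{sig}(\varphi)$ = variables; $|\varphi|$ = number of subformulas of $\varphi$ and their negations; $\boldsymbol k(\varphi_1,\varphi_2)=3+3\max(|\varphi_1|,|\varphi_2|)$. $\mathsf{K4.3}=\mathsf{K}\oplus(\Box p_0\to\Box\Box p_0)\oplus(\Box(\Box^+p_0\to p_1)\vee\Box(\Box^+p_1\to p_0))$, $\Box^+\varphi=\varphi\wedge\Box\varphi$. Craig interpolant in $L$ as usual (formula in common variables implied by $\varphi_1$ and implying $\varphi_2$ in $L$). A cofinal subframe logic $L\supseteq\mathsf{K4.3}$ is one axiomatisable over $\mathsf{K4.3}$ by Zakharyaschev canonical formulas $\alpha(\mathfrak G,\emptyset,\bot)$; equivalently its frames are closed under taking cofinal subframes ($W'\subseteq W$ with induced $R$ and $\mathcal P'\subseteq\mathcal P$, such that whenever $x\in W'$ and $xRy$, either $y\in W'$ or $yRz$ for some $z\in W'$). General frames, $\delta$-models, frames for $L$, rooted models, $\sigma$-bisimulations and $\sim_\sigma$ are standard. Ordered sum $\lhd$: disjoint union, points of earlier summands see all points of later ones, internal sets = unions of internal sets of summands, valuations = unions. $\mathfrak C(k,\bullet)$ ($0<k<\omega$): points $a_0,\dots,a_{k-1},b_0,b_1,\dots$, $xRy$ iff $x=a_i$, or $x=b_n,y=b_m$ with $m<n$; internal sets generated by $X_i=\{a_i\}\cup\{b_n\mid n\equiv i\pmod k\}$ and all $\{b_n\}$;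 $\mathfrak C(k,\circ)$: same but each $b_n$ reflexive. A simple $\delta$-model is based on a finite Kripke frame or on $\mathfrak C(k,\ast)$ with each $\mathfrak v(p)$ a union of some $X_i$. Atomic frames: $m^<$ (chain of $m$ irreflexive points), $\circ\lhd m^<$, reflexive $k$-point cluster, $\mathfrak C(k,\bullet)$, $\mathfrak C(k,\circ)$, $0<m<\omega$, $0<k\le2^{|\delta|}$, of sizes $m$, $m+1$, $k$, $k$, $k$ respectively; the size $\|\mathfrak N\|$ of an ordered sum of simple models on atomic frames is the sum of the sizes of those frames. *)

theory Defs
  imports Main
begin

section \<open>Modal formulas\<close>

datatype fm = Top | Bot | Var nat | Neg fm | And fm fm | Dia fm

definition Or :: "fm \<Rightarrow> fm \<Rightarrow> fm" where
  "Or \<phi> \<psi> = Neg (And (Neg \<phi>) (Neg \<psi>))"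

definition Imp :: "fm \<Rightarrow> fm \<Rightarrow> fm" where
  "Imp \<phi> \<psi> = Neg (And \<phi> (Neg \<psi>))"

definition Iff :: "fm \<Rightarrow> fm \<Rightarrow> fm" where
  "Iff \<phi> \<psi> = And (Imp \<phi> \<psi>) (Imp \<psi> \<phi>)"

definition Box :: "fm \<Rightarrow> fm" where
  "Box \<phi> = Neg (Dia (Neg \<phi>))"

definition Boxp :: "fm \<Rightarrow> fm" where
  "Boxp \<phi> = And \<phi> (Box \<phi>)"

definition BigAnd :: "fm list \<Rightarrow> fm" where
  "BigAnd \<phi>s = foldr And \<phi>s Top"

fun sig :: "fm \<Rightarrow> nat set" where
  "sig Top = {}"
| "sig Bot = {}"
| "sig (Var p) = {p}"
| "sig (Neg \<phi>) = sig \<phi>"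
| "sig (And \<phi> \<psi>) = sig \<phi> \<union> sig \<psi>"
| "sig (Dia \<phi>) = sig \<phi>"

fun subfms :: "fm \<Rightarrow> fm set" where
  "subfms Top = {Top}"
| "subfms Bot = {Bot}"
| "subfms (Var p) = {Var p}"
| "subfms (Neg \<phi>) = insert (Neg \<phi>) (subfms \<phi>)"
| "subfms (And \<phi> \<psi>) = insert (And \<phi> \<psi>) (subfms \<phi> \<union> subfms \<psi>)"
| "subfms (Dia \<phi>) = insert (Dia \<phi>) (subfms \<phi>)"

definition fm_size :: "fm \<Rightarrow> nat" where
  "fm_size \<phi> = card (subfms \<phi> \<union> Neg ` subfms \<phi>)"

definition kbound :: "fm \<Rightarrow> fm \<Rightarrow> nat" where
  "kbound \<phi>\<^sub>1 \<phi>\<^sub>2 = 3 + 3 * max (fm_size \<phi>\<^sub>1) (fm_size \<phi>\<^sub>2)"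

fun subst :: "(nat \<Rightarrow> fm) \<Rightarrow> fm \<Rightarrow> fm" where
  "subst s Top = Top"
| "subst s Bot = Bot"
| "subst s (Var p) = s p"
| "subst s (Neg \<phi>) = Neg (subst s \<phi>)"
| "subst s (And \<phi> \<psi>) = And (subst s \<phi>) (subst s \<psi>)"
| "subst s (Dia \<phi>) = Dia (subst s \<phi>)"


section \<open>Normal modal logics\<close>

text \<open>Classical evaluation in which variables and formulas of the form
  \<^term>\<open>Dia \<phi>\<close> are treated as propositional atoms.\<close>

fun peval :: "(fm \<Rightarrow> bool) \<Rightarrow> fm \<Rightarrow> bool" where
  "peval a Top = True"
| "peval a Bot = False"
| "peval a (Var p) = a (Var p)"
| "peval a (Neg \<phi>) = (\<not> peval a \<phi>)"
| "peval a (And \<phi> \<psi>) = (peval a \<phi> \<and> peval a \<psi>)"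
| "peval a (Dia \<phi>) = a (Dia \<phi>)"

definition tautology :: "fm \<Rightarrow> bool" where
  "tautology \<phi> \<longleftrightarrow> (\<forall>a. peval a \<phi>)"

text \<open>\<open>normal_cl \<Gamma>\<close> is the least normal modal logic containing \<open>\<Gamma>\<close>. As the diamond is
  the primitive modality, the axiom \<open>Dual\<close> is needed next to \<open>K\<close>: the latter speaks only
  about diamonds in front of a negation.\<close>

inductive_set normal_cl :: "fm set \<Rightarrow> fm set" for \<Gamma> :: "fm set" where
  Ax: "\<phi> \<in> \<Gamma> \<Longrightarrow> \<phi> \<in> normal_cl \<Gamma>"
| Taut: "tautology \<phi> \<Longrightarrow> \<phi> \<in> normal_cl \<Gamma>"
| K: "Imp (Box (Imp (Var 0) (Var 1))) (Imp (Box (Var 0)) (Box (Var 1))) \<in> normal_cl \<Gamma>"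
| Dual: "Iff (Dia (Var 0)) (Neg (Box (Neg (Var 0)))) \<in> normal_cl \<Gamma>"
| MP: "\<lbrakk>Imp \<phi> \<psi> \<in> normal_cl \<Gamma>; \<phi> \<in> normal_cl \<Gamma>\<rbrakk> \<Longrightarrow> \<psi> \<in> normal_cl \<Gamma>"
| Nec: "\<phi> \<in> normal_cl \<Gamma> \<Longrightarrow> Box \<phi> \<in> normal_cl \<Gamma>"
| Subst: "\<phi> \<in> normal_cl \<Gamma> \<Longrightarrow> subst s \<phi> \<in> normal_cl \<Gamma>"

definition oplus :: "fm set \<Rightarrow> fm set \<Rightarrow> fm set"  (infixl \<open>\<oplus>\<close> 65) where
  "L \<oplus> \<Gamma> = normal_cl (L \<union> \<Gamma>)"

definition logic_K :: "fm set" where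
  "logic_K = normal_cl {}"

definition logic_K43 :: "fm set" where
  "logic_K43 =
     logic_K \<oplus> {Imp (Box (Var 0)) (Box (Box (Var 0)))}
             \<oplus> {Or (Box (Imp (Boxp (Var 0)) (Var 1))) (Box (Imp (Boxp (Var 1)) (Var 0)))}"

definition craig_interpolant :: "fm set \<Rightarrow> fm \<Rightarrow> fm \<Rightarrow> fm \<Rightarrow> bool" where
  "craig_interpolant L \<phi>\<^sub>1 \<phi>\<^sub>2 \<iota> \<longleftrightarrow>
     sig \<iota> \<subseteq> sig \<phi>\<^sub>1 \<inter> sig \<phi>\<^sub>2 \<and> Imp \<phi>\<^sub>1 \<iota> \<in> L \<and> Imp \<iota> \<phi>\<^sub>2 \<in> L"


section \<open>Cofinal subframe logics\<close>

text \<open>A finite rooted transitive Kripke frame, presented with points \<open>0, \<dots>, n\<close> and root \<open>0\<close>.\<close>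

definition finite_rooted_frame :: "nat \<Rightarrow> (nat \<times> nat) set \<Rightarrow> bool" where
  "finite_rooted_frame n R \<longleftrightarrow>
     R \<subseteq> {..n} \<times> {..n} \<and> trans R \<and> (\<forall>i\<in>{1..n}. (0, i) \<in> R)"

text \<open>Zakharyaschev's canonical formula \<open>\<alpha>(G, D, \<bottom>)\<close> for the frame \<open>G\<close> given by \<open>n\<close> and
  \<open>R\<close> has premises \<open>\<phi>\<^sub>i\<^sub>j\<close> for \<open>(i, j) \<in> R\<close>, \<open>\<phi>\<^sub>i\<close> for each point \<open>i\<close>, \<open>\<phi>\<^sub>d\<close> for each
  closed domain \<open>d \<in> D\<close>, and \<open>\<phi>\<^sub>\<bottom>\<close>, and its conclusion is the variable of the root. Here
  \<open>D = {}\<close>, so that no \<open>\<phi>\<^sub>d\<close> occurs. The variable of a point is to be refuted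
  exactly at the points that a cofinal subreduction to \<open>G\<close> sends to it.\<close>

definition can_rel :: "nat \<Rightarrow> nat \<Rightarrow> fm" where
  "can_rel i j = Boxp (Imp (Box (Var j)) (Var i))"

definition can_pt :: "nat \<Rightarrow> (nat \<times> nat) set \<Rightarrow> nat \<Rightarrow> fm" where
  "can_pt n R i =
     Boxp (Imp
       (Imp
         (And (BigAnd [Box (Var k). k \<leftarrow> [0..<Suc n], (i, k) \<notin> R])
              (BigAnd [Var j. j \<leftarrow> [0..<Suc n], j \<noteq> i]))
         (Var i))
       (Var i))"

definition can_cof :: "nat \<Rightarrow> fm" where
  "can_cof n = Boxp (Imp (BigAnd [Boxp (Var i). i \<leftarrow> [0..<Suc n]]) Bot)"

definition canonical_fm :: "nat \<Rightarrow> (nat \<times> nat) set \<Rightarrow> fm" where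
  "canonical_fm n R =
     Imp
       (And (BigAnd [can_rel i j. i \<leftarrow> [0..<Suc n], j \<leftarrow> [0..<Suc n], (i, j) \<in> R])
         (And (BigAnd [can_pt n R i. i \<leftarrow> [0..<Suc n]])
           (can_cof n)))
       (Var 0)"

definition cofinal_subframe_logic :: "fm set \<Rightarrow> bool" where
  "cofinal_subframe_logic L \<longleftrightarrow>
     (\<exists>\<G>. (\<forall>(n, R)\<in>\<G>. finite_rooted_frame n R) \<and>
          L = logic_K43 \<oplus> {canonical_fm n R |n R. (n, R) \<in> \<G>})"


section \<open>General frames and models\<close>

record 'a gframe =
  worlds :: "'a set"
  acc :: "('a \<times> 'a) set"
  internal :: "'a set set"

definition dia_set :: "'a set \<Rightarrow> ('a \<times> 'a) set \<Rightarrow> 'a set \<Rightarrow> 'a set" where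
  "dia_set W R X = {x\<in>W. \<exists>y\<in>X. (x, y) \<in> R}"

definition general_frame :: "'a gframe \<Rightarrow> bool" where
  "general_frame F \<longleftrightarrow>
     worlds F \<noteq> {} \<and> acc F \<subseteq> worlds F \<times> worlds F \<and>
     internal F \<subseteq> Pow (worlds F) \<and> {} \<in> internal F \<and>
     (\<forall>X\<in>internal F. worlds F - X \<in> internal F) \<and>
     (\<forall>X\<in>internal F. \<forall>Y\<in>internal F. X \<inter> Y \<in> internal F) \<and>
     (\<forall>X\<in>internal F. dia_set (worlds F) (acc F) X \<in> internal F)"

text \<open>A model is a frame with a valuation. The valuation is total on variables, but in a
  \<open>\<delta>\<close>-model only its values on \<open>\<delta>\<close> matter.\<close>

type_synonym 'a model = "'a gframe \<times> (nat \<Rightarrow> 'a set)"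

definition delta_model :: "nat set \<Rightarrow> 'a model \<Rightarrow> bool" where
  "delta_model \<delta> M \<longleftrightarrow> general_frame (fst M) \<and> (\<forall>p\<in>\<delta>. snd M p \<in> internal (fst M))"

fun sat :: "'a model \<Rightarrow> 'a \<Rightarrow> fm \<Rightarrow> bool" where
  "sat M x Top = True"
| "sat M x Bot = False"
| "sat M x (Var p) = (x \<in> snd M p)"
| "sat M x (Neg \<phi>) = (\<not> sat M x \<phi>)"
| "sat M x (And \<phi> \<psi>) = (sat M x \<phi> \<and> sat M x \<psi>)"
| "sat M x (Dia \<phi>) = (\<exists>y. (x, y) \<in> acc (fst M) \<and> sat M y \<phi>)"

definition valid_in :: "'a gframe \<Rightarrow> fm \<Rightarrow> bool" where
  "valid_in F \<phi> \<longleftrightarrow>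
     (\<forall>v. (\<forall>p. v p \<in> internal F) \<longrightarrow> (\<forall>x\<in>worlds F. sat (F, v) x \<phi>))"

definition frame_for :: "fm set \<Rightarrow> 'a gframe \<Rightarrow> bool" where
  "frame_for L F \<longleftrightarrow> general_frame F \<and> (\<forall>\<phi>\<in>L. valid_in F \<phi>)"

definition is_root :: "'a gframe \<Rightarrow> 'a \<Rightarrow> bool" where
  "is_root F x \<longleftrightarrow> x \<in> worlds F \<and> (\<forall>y\<in>worlds F. (x, y) \<in> (acc F)\<^sup>*)"

definition bisimulation ::
  "nat set \<Rightarrow> 'a model \<Rightarrow> 'b model \<Rightarrow> ('a \<times> 'b) set \<Rightarrow> bool" where
  "bisimulation \<sigma> M N \<beta> \<longleftrightarrow>
     \<beta> \<subseteq> worlds (fst M) \<times> worlds (fst N) \<and>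
     (\<forall>(x, y)\<in>\<beta>.
        (\<forall>p\<in>\<sigma>. x \<in> snd M p \<longleftrightarrow> y \<in> snd N p) \<and>
        (\<forall>x'. (x, x') \<in> acc (fst M) \<longrightarrow> (\<exists>y'. (y, y') \<in> acc (fst N) \<and> (x', y') \<in> \<beta>)) \<and>
        (\<forall>y'. (y, y') \<in> acc (fst N) \<longrightarrow> (\<exists>x'. (x, x') \<in> acc (fst M) \<and> (x', y') \<in> \<beta>)))"

definition bisimilar ::
  "nat set \<Rightarrow> 'a model \<Rightarrow> 'a \<Rightarrow> 'b model \<Rightarrow> 'b \<Rightarrow> bool" where
  "bisimilar \<sigma> M x N y \<longleftrightarrow> (\<exists>\<beta>. bisimulation \<sigma> M N \<beta> \<and> (x, y) \<in> \<beta>)"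


section \<open>Ordered sums\<close>

text \<open>Point \<open>x\<close> of the \<open>i\<close>-th summand becomes \<open>(i, x)\<close>.\<close>

definition ordered_sum_frame :: "'a gframe list \<Rightarrow> (nat \<times> 'a) gframe" where
  "ordered_sum_frame Fs = \<lparr>
     worlds = {(i, x). i < length Fs \<and> x \<in> worlds (Fs ! i)},
     acc = {((i, x), (j, y)).
              i < length Fs \<and> j < length Fs \<and> x \<in> worlds (Fs ! i) \<and> y \<in> worlds (Fs ! j) \<and>
              (i < j \<or> i = j \<and> (x, y) \<in> acc (Fs ! i))},
     internal = {(\<Union>i<length Fs. Pair i ` Y i) |Y. \<forall>i<length Fs. Y i \<in> internal (Fs ! i)} \<rparr>"

definition ordered_sum :: "'a model list \<Rightarrow> (nat \<times> 'a) model" where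
  "ordered_sum Ms =
     (ordered_sum_frame (map fst Ms), \<lambda>p. \<Union>i<length Ms. Pair i ` snd (Ms ! i) p)"


section \<open>Atomic frames and simple models\<close>

text \<open>\<open>A i\<close> and \<open>B n\<close> are the points \<open>a\<^sub>i\<close> and \<open>b\<^sub>n\<close> of the frames \<open>\<CC>(k, \<bullet>)\<close> and
  \<open>\<CC>(k, \<circ>)\<close>; the finite atomic frames use only points of the form \<open>A i\<close>.\<close>

datatype point = A nat | B nat

inductive_set generated_sets ::
  "'a set \<Rightarrow> ('a \<times> 'a) set \<Rightarrow> 'a set set \<Rightarrow> 'a set set"
  for W :: "'a set" and R :: "('a \<times> 'a) set" and G :: "'a set set" where
  gen: "X \<in> G \<Longrightarrow> X \<in> generated_sets W R G"
| empty: "{} \<in> generated_sets W R G"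
| compl: "X \<in> generated_sets W R G \<Longrightarrow> W - X \<in> generated_sets W R G"
| inter: "\<lbrakk>X \<in> generated_sets W R G; Y \<in> generated_sets W R G\<rbrakk>
            \<Longrightarrow> X \<inter> Y \<in> generated_sets W R G"
| dia: "X \<in> generated_sets W R G \<Longrightarrow> dia_set W R X \<in> generated_sets W R G"

definition CC_worlds :: "nat \<Rightarrow> point set" where
  "CC_worlds k = A ` {..<k} \<union> range B"

text \<open>The flag \<open>r\<close> tells whether the points \<open>b\<^sub>n\<close> are reflexive.\<close>

definition CC_acc :: "nat \<Rightarrow> bool \<Rightarrow> (point \<times> point) set" where
  "CC_acc k r =
     (A ` {..<k}) \<times> CC_worlds k \<union> {(B n, B m) |n m. m < n \<or> r \<and> m = n}"

definition CC_X :: "nat \<Rightarrow> nat \<Rightarrow> point set" where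
  "CC_X k i = insert (A i) {B n |n. n mod k = i mod k}"

definition CC :: "nat \<Rightarrow> bool \<Rightarrow> point gframe" where
  "CC k r = \<lparr>
     worlds = CC_worlds k,
     acc = CC_acc k r,
     internal = generated_sets (CC_worlds k) (CC_acc k r)
                  (CC_X k ` {..<k} \<union> range (\<lambda>n. {B n})) \<rparr>"

definition kripke_frame :: "'a set \<Rightarrow> ('a \<times> 'a) set \<Rightarrow> 'a gframe" where
  "kripke_frame W R = \<lparr> worlds = W, acc = R, internal = Pow W \<rparr>"

definition simple_model :: "nat set \<Rightarrow> point model \<Rightarrow> bool" where
  "simple_model \<delta> M \<longleftrightarrow>
     delta_model \<delta> M \<and>
     ((\<exists>W R. finite W \<and> fst M = kripke_frame W R) \<or>
      (\<exists>k>0. \<exists>r. fst M = CC k r \<and>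
         (\<forall>p\<in>\<delta>. \<exists>I\<subseteq>{..<k}. snd M p = (\<Union>i\<in>I. CC_X k i))))"

text \<open>In the order of the constructors: \<open>m\<^sup><\<close>, \<open>\<circ> \<lhd> m\<^sup><\<close>, the reflexive
  \<open>k\<close>-point cluster, \<open>\<CC>(k, \<bullet>)\<close> and \<open>\<CC>(k, \<circ>)\<close>.\<close>

datatype atom = Chain nat | RChain nat | Cluster nat | CIrr nat | CRefl nat

fun atom_in_range :: "nat set \<Rightarrow> atom \<Rightarrow> bool" where
  "atom_in_range \<delta> (Chain m) = (0 < m)"
| "atom_in_range \<delta> (RChain m) = (0 < m)"
| "atom_in_range \<delta> (Cluster k) = (0 < k \<and> k \<le> 2 ^ card \<delta>)"
| "atom_in_range \<delta> (CIrr k) = (0 < k \<and> k \<le> 2 ^ card \<delta>)"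
| "atom_in_range \<delta> (CRefl k) = (0 < k \<and> k \<le> 2 ^ card \<delta>)"

fun atom_frame :: "atom \<Rightarrow> point gframe" where
  "atom_frame (Chain m) =
     kripke_frame (A ` {..<m}) {(A i, A j) |i j. i < j \<and> j < m}"
| "atom_frame (RChain m) =
     kripke_frame (A ` {..m}) ({(A i, A j) |i j. i < j \<and> j \<le> m} \<union> {(A 0, A 0)})"
| "atom_frame (Cluster k) = kripke_frame (A ` {..<k}) ((A ` {..<k}) \<times> (A ` {..<k}))"
| "atom_frame (CIrr k) = CC k False"
| "atom_frame (CRefl k) = CC k True"

fun atom_size :: "atom \<Rightarrow> nat" where
  "atom_size (Chain m) = m"
| "atom_size (RChain m) = Suc m"
| "atom_size (Cluster k) = k"
| "atom_size (CIrr k) = k"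
| "atom_size (CRefl k) = k"

definition sum_size :: "atom list \<Rightarrow> nat" where
  "sum_size cs = sum_list (map atom_size cs)"

text \<open>\<open>N\<close> is the ordered sum of finitely many simple \<open>\<delta>\<close>-models based on the atomic
  frames \<open>cs\<close>; its size is then \<^term>\<open>sum_size cs\<close>.\<close>

definition atomic_sum :: "nat set \<Rightarrow> atom list \<Rightarrow> (nat \<times> point) model \<Rightarrow> bool" where
  "atomic_sum \<delta> cs N \<longleftrightarrow>
     cs \<noteq> [] \<and> (\<forall>c\<in>set cs. atom_in_range \<delta> c) \<and>
     (\<exists>Ms. list_all2 (\<lambda>c M. fst M = atom_frame c \<and> simple_model \<delta> M) cs Ms \<and>
           N = ordered_sum Ms)"

end

theory Submission
  imports Defs
begin

text \<open>
  Without an interpolant, some points \<open>x\<^sub>1 \<ni> \<phi>\<^sub>1\<close> and \<open>x\<^sub>2 \<ni> \<not>\<phi>\<^sub>2\<close> of the canonical model of \<open>L\<close>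
  have the same \<open>\<sigma>\<close>-theory. Above \<open>x\<^sub>i\<close> choose a maximal point for every \<open>\<psi>\<close> with \<open>\<diamond>\<psi>\<close> a
  subformula, a final point, and a maximal point for each \<open>\<sigma>\<close>-theory of a point chosen on either
  side. These finitely many points carry the truth of the formula, and since the maximal points for a
  \<open>\<sigma>\<close>-theory are available on both sides, equality of \<open>\<sigma>\<close>-theories is a bisimulation.

  The frame need not validate \<open>L\<close> if a chosen point is not definable, that is, not maximal for any
  single formula. Its cluster is then a limit, from above, of definable points, either of
  irreflexive or of reflexive ones, and is replaced by \<open>\<CC>(k, \<bullet>)\<close> or \<open>\<CC>(k, \<circ>)\<close>.
  A refutation of a canonical formula in the resulting sum uses only finitely many of the points
  \<open>b\<^sub>n\<close>; sending these to definable points yields a refutation in the canonical model. By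
  compactness, a point maximal for a \<open>\<sigma>\<close>-theory is definable iff it is definable by a
  \<open>\<sigma>\<close>-formula, so limit clusters correspond to each other on the two sides.
\<close>

section \<open>Satisfaction and soundness\<close>

text \<open>The canonical model verifies every substitution instance of the canonical formulas, but
  its underlying frame may refute them. A refutation in the constructed sum is therefore absurd only
  once its preimages have been cut out by formulas; this is where definability enters. Points
  maximal for one formula are definable, so only the root and points chosen for a
  \<open>\<sigma>\<close>-theory can fail to be, and the latter choice is forced by the
  bisimulation. A point \<open>b\<^sub>n\<close> misses most of the cluster whose labels it carries.
  It still satisfies the right formulas, because the witness chosen for \<open>\<psi>\<close> is
  definable and hence never sits in a limit cluster. The other obstacle is a root that is not
  definable: it becomes a separate one-point summand, even when a limit summand made from the same
  cluster follows. The factor 3 in the bound covers the points chosen for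
  \<open>\<phi>\<^sub>1\<close> and for \<open>\<phi>\<^sub>2\<close>, which enter each model
  through their \<open>\<sigma>\<close>-theories, and the points chosen for the formula of that
  model itself.\<close>

lemma sat_Or [simp]: "sat M x (Or \<phi> \<psi>) \<longleftrightarrow> sat M x \<phi> \<or> sat M x \<psi>"
  by (simp add: Or_def)

lemma sat_Imp [simp]: "sat M x (Imp \<phi> \<psi>) \<longleftrightarrow> (sat M x \<phi> \<longrightarrow> sat M x \<psi>)"
  by (simp add: Imp_def)

lemma sat_Iff [simp]: "sat M x (Iff \<phi> \<psi>) \<longleftrightarrow> (sat M x \<phi> \<longleftrightarrow> sat M x \<psi>)"
  by (auto simp: Iff_def)

lemma sat_Box [simp]: "sat M x (Box \<phi>) \<longleftrightarrow> (\<forall>y. (x, y) \<in> acc (fst M) \<longrightarrow> sat M y \<phi>)"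
  by (simp add: Box_def)

lemma sat_Boxp [simp]:
  "sat M x (Boxp \<phi>) \<longleftrightarrow> (\<forall>y. y = x \<or> (x, y) \<in> acc (fst M) \<longrightarrow> sat M y \<phi>)"
  by (auto simp: Boxp_def)

lemma sat_BigAnd [simp]: "sat M x (BigAnd \<phi>s) \<longleftrightarrow> (\<forall>\<phi>\<in>set \<phi>s. sat M x \<phi>)"
  by (induction \<phi>s) (auto simp: BigAnd_def)

lemma sat_peval: "sat M x \<phi> = peval (sat M x) \<phi>"
  by (induction \<phi>) auto

lemma sat_tautology: "tautology \<phi> \<Longrightarrow> sat M x \<phi>"
  by (subst sat_peval) (simp add: tautology_def)

lemma sat_subst:
  assumes "acc F \<subseteq> worlds F \<times> worlds F" "x \<in> worlds F"
  shows "sat (F, v) x (subst s \<phi>) \<longleftrightarrow>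
         sat (F, \<lambda>p. {y \<in> worlds F. sat (F, v) y (s p)}) x \<phi>"
  using assms(2)
proof (induction \<phi> arbitrary: x)
  case (Dia \<phi>)
  then show ?case using assms(1) by (auto 0 4)
qed auto

text \<open>In a model refuting a canonical formula, the points above the refuting one at which
  \<^term>\<open>Var i\<close> fails form the preimage of \<open>i\<close> under a cofinal subreduction; \<open>v i\<close> is its
  complement.\<close>

definition subreduction ::
  "nat \<Rightarrow> (nat \<times> nat) set \<Rightarrow> ('a \<times> 'a) set \<Rightarrow> 'a set \<Rightarrow> (nat \<Rightarrow> 'a set) \<Rightarrow> bool" where
  "subreduction n G R U v \<longleftrightarrow>
     (\<forall>i\<le>n. \<forall>j\<le>n. (i, j) \<in> G \<longrightarrow> (\<forall>y\<in>U - v i. \<exists>z. (y, z) \<in> R \<and> z \<notin> v j)) \<and>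
     (\<forall>i\<le>n. \<forall>y\<in>U - v i.
        (\<forall>j\<le>n. (i, j) \<notin> G \<longrightarrow> (\<forall>z. (y, z) \<in> R \<longrightarrow> z \<in> v j)) \<and>
        (\<forall>j\<le>n. j \<noteq> i \<longrightarrow> y \<in> v j)) \<and>
     (\<forall>y\<in>U. \<exists>i\<le>n. \<exists>z. (z = y \<or> (y, z) \<in> R) \<and> z \<notin> v i)"

lemma sat_canonical_fm:
  "\<not> sat (F, v) x (canonical_fm n G) \<longleftrightarrow>
     x \<notin> v 0 \<and> subreduction n G (acc F) {y. y = x \<or> (x, y) \<in> acc F} v"
proof -
  \<comment> \<open>All three kinds of premises start with \<open>Boxp\<close>, so all of them speak
    about the points of \<open>U\<close>.\<close>
  define U where "U = {y. y = x \<or> (x, y) \<in> acc F}"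
  have Boxp: "sat (F, v) x (Boxp \<phi>) \<longleftrightarrow> (\<forall>y\<in>U. sat (F, v) y \<phi>)" for \<phi>
    by (auto simp: U_def)
  have set: "(\<forall>\<phi>\<in>set [can_rel i j. i \<leftarrow> [0..<Suc n], j \<leftarrow> [0..<Suc n], (i, j) \<in> G]. P \<phi>) \<longleftrightarrow>
      (\<forall>i\<le>n. \<forall>j\<le>n. (i, j) \<in> G \<longrightarrow> P (can_rel i j))" for P
    by (force simp: less_Suc_eq_le simp del: upt_Suc)
  have set': "(\<forall>\<phi>\<in>set [f i. i \<leftarrow> [0..<Suc n]]. P \<phi>) \<longleftrightarrow> (\<forall>i\<le>n. P (f i))" for P and f :: "nat \<Rightarrow> fm"
    by (auto simp: less_Suc_eq_le simp del: upt_Suc)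
  have set'': "(\<forall>\<phi>\<in>set [f k. k \<leftarrow> [0..<Suc n], Q k]. P \<phi>) \<longleftrightarrow> (\<forall>k\<le>n. Q k \<longrightarrow> P (f k))"
    for P Q and f :: "nat \<Rightarrow> fm"
    by (auto simp: less_Suc_eq_le simp del: upt_Suc)
  have rel: "sat (F, v) x (can_rel i j) \<longleftrightarrow> (\<forall>y\<in>U - v i. \<exists>z. (y, z) \<in> acc F \<and> z \<notin> v j)" for i j
    unfolding can_rel_def Boxp by auto
  have pt: "sat (F, v) x (can_pt n G i) \<longleftrightarrow>
     (\<forall>y\<in>U - v i.
        (\<forall>j\<le>n. (i, j) \<notin> G \<longrightarrow> (\<forall>z. (y, z) \<in> acc F \<longrightarrow> z \<in> v j)) \<and>
        (\<forall>j\<le>n. j \<noteq> i \<longrightarrow> y \<in> v j))" for i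
    unfolding can_pt_def Boxp sat_Imp sat.simps sat_BigAnd set'' sat_Box fst_conv snd_conv by blast
  have cof: "sat (F, v) x (can_cof n) \<longleftrightarrow>
     (\<forall>y\<in>U. \<exists>i\<le>n. \<exists>z. (z = y \<or> (y, z) \<in> acc F) \<and> z \<notin> v i)"
    unfolding can_cof_def Boxp unfolding sat_Imp sat.simps sat_BigAnd set' sat_Boxp fst_conv snd_conv
    by (intro ball_cong refl) auto
  show ?thesis
    unfolding canonical_fm_def subreduction_def sat_Imp sat.simps sat_BigAnd set set'
      cof snd_conv rel pt U_def[symmetric] by blast
qed

text \<open>Soundness of the rule \<open>Subst\<close> rests on this: a substitution amounts to
  giving each variable a truth set as its value, and such a value is admissible.\<close>

lemma truth_set_internal:
  fixes v :: "nat \<Rightarrow> 'a set"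
  assumes "general_frame F" "\<And>p. v p \<in> internal F"
  shows "{x \<in> worlds F. sat (F, v) x \<phi>} \<in> internal F"
proof (induction \<phi>)
  case Top
  then show ?case using assms(1) unfolding general_frame_def by simp (metis Diff_empty)
next
  case Bot
  then show ?case using assms(1) by (simp add: general_frame_def)
next
  case (Var p)
  have "{x \<in> worlds F. x \<in> v p} = v p" using assms by (auto simp: general_frame_def)
  then show ?case using assms(2) by simp
next
  case (Neg \<phi>)
  have "{x \<in> worlds F. \<not> sat (F, v) x \<phi>} = worlds F - {x \<in> worlds F. sat (F, v) x \<phi>}" by auto
  then show ?case using Neg assms(1) by (simp add: general_frame_def)
next
  case (And \<phi> \<psi>)
  have "{x \<in> worlds F. sat (F, v) x \<phi> \<and> sat (F, v) x \<psi>} =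
    {x \<in> worlds F. sat (F, v) x \<phi>} \<inter> {x \<in> worlds F. sat (F, v) x \<psi>}" by auto
  then show ?case using And assms(1) by (simp add: general_frame_def)
next
  case (Dia \<phi>)
  have "{x \<in> worlds F. sat (F, v) x (Dia \<phi>)} =
    dia_set (worlds F) (acc F) {x \<in> worlds F. sat (F, v) x \<phi>}"
    using assms(1) by (auto simp: dia_set_def general_frame_def)
  then show ?case using Dia assms(1) unfolding general_frame_def by metis
qed

lemma valid_normal_cl:
  fixes F :: "'a gframe"
  assumes F: "general_frame F" and ax: "\<And>\<phi>. \<phi> \<in> \<Gamma> \<Longrightarrow> valid_in F \<phi>"
    and "\<phi> \<in> normal_cl \<Gamma>"
  shows "valid_in F \<phi>"
  using assms(3)
proof induction
  case (Taut \<phi>)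
  then show ?case by (simp add: valid_in_def sat_tautology)
next
  case (Nec \<phi>)
  then show ?case using F by (auto simp: valid_in_def general_frame_def)
next
  case (Subst \<phi> s)
  show ?case unfolding valid_in_def
  proof (intro allI impI ballI)
    fix v :: "nat \<Rightarrow> 'a set" and x assume v: "\<forall>p. v p \<in> internal F" and x: "x \<in> worlds F"
    have "acc F \<subseteq> worlds F \<times> worlds F" using F by (simp add: general_frame_def)
    with x Subst truth_set_internal[OF F] v show "sat (F, v) x (subst s \<phi>)"
      by (simp add: sat_subst valid_in_def)
  qed
qed (use ax in \<open>auto simp: valid_in_def\<close>)

lemma valid_oplus:
  assumes "general_frame F" and "\<And>\<phi>. \<phi> \<in> L \<Longrightarrow> valid_in F \<phi>"
    and "\<And>\<phi>. \<phi> \<in> \<Gamma> \<Longrightarrow> valid_in F \<phi>" and "\<phi> \<in> L \<oplus> \<Gamma>"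
  shows "valid_in F \<phi>"
  using assms(4) unfolding oplus_def
  by (rule valid_normal_cl[OF assms(1), rotated]) (use assms(2,3) in blast)

lemma valid_logic_K43:
  assumes F: "general_frame F" and "trans (acc F)"
    and conn: "\<And>x y z. (x, y) \<in> acc F \<Longrightarrow> (x, z) \<in> acc F \<Longrightarrow>
                 y = z \<or> (y, z) \<in> acc F \<or> (z, y) \<in> acc F"
    and "\<phi> \<in> logic_K43"
  shows "valid_in F \<phi>"
proof -
  have 4: "valid_in F (Imp (Box (Var 0)) (Box (Box (Var 0))))"
    using assms(2) by (simp add: valid_in_def) (meson transD)
  have 3: "valid_in F (Or (Box (Imp (Boxp (Var 0)) (Var 1))) (Box (Imp (Boxp (Var 1)) (Var 0))))"
    by (simp add: valid_in_def) (metis conn)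
  show ?thesis
    using assms(4) unfolding logic_K43_def
  proof (rule valid_oplus[OF F, rotated 2])
    show "valid_in F \<psi>" if "\<psi> \<in> logic_K \<oplus> {Imp (Box (Var 0)) (Box (Box (Var 0)))}" for \<psi>
      using that
    proof (rule valid_oplus[OF F, rotated 2])
      show "valid_in F \<chi>" if "\<chi> \<in> logic_K" for \<chi>
        using that unfolding logic_K_def by (rule valid_normal_cl[OF F, rotated]) simp
    qed (use 4 in simp)
  qed (use 3 in simp)
qed

lemma frame_for_cofinal_subframe_logic:
  assumes F: "general_frame F" and "trans (acc F)"
    and "\<And>x y z. (x, y) \<in> acc F \<Longrightarrow> (x, z) \<in> acc F \<Longrightarrow>
           y = z \<or> (y, z) \<in> acc F \<or> (z, y) \<in> acc F"
    and can: "\<And>n R. (n, R) \<in> \<G> \<Longrightarrow> valid_in F (canonical_fm n R)"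
  shows "frame_for (logic_K43 \<oplus> {canonical_fm n R |n R. (n, R) \<in> \<G>}) F"
proof -
  have "valid_in F \<phi>" if "\<phi> \<in> logic_K43 \<oplus> {canonical_fm n R |n R. (n, R) \<in> \<G>}" for \<phi>
    using that
  proof (rule valid_oplus[OF F, rotated 2])
    show "valid_in F \<psi>" if "\<psi> \<in> logic_K43" for \<psi>
      using that by (rule valid_logic_K43[OF assms(1,2), rotated]) (fact assms(3))
    show "valid_in F \<psi>" if "\<psi> \<in> {canonical_fm n R |n R. (n, R) \<in> \<G>}" for \<psi>
      using that can by auto
  qed
  then show ?thesis using F by (simp add: frame_for_def)
qed

section \<open>Canonical models\<close>

lemma peval_BigAnd [simp]: "peval a (BigAnd \<phi>s) \<longleftrightarrow> (\<forall>\<phi>\<in>set \<phi>s. peval a \<phi>)"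
  by (induction \<phi>s) (auto simp: BigAnd_def)

lemma peval_Imp [simp]: "peval a (Imp \<phi> \<psi>) \<longleftrightarrow> (peval a \<phi> \<longrightarrow> peval a \<psi>)"
  by (simp add: Imp_def)

lemma peval_Iff [simp]: "peval a (Iff \<phi> \<psi>) \<longleftrightarrow> (peval a \<phi> \<longleftrightarrow> peval a \<psi>)"
  by (auto simp: Iff_def)

lemma peval_Or [simp]: "peval a (Or \<phi> \<psi>) \<longleftrightarrow> peval a \<phi> \<or> peval a \<psi>"
  by (simp add: Or_def)

lemma sig_BigAnd: "sig (BigAnd \<phi>s) = (\<Union>\<phi>\<in>set \<phi>s. sig \<phi>)"
  by (induction \<phi>s) (auto simp: BigAnd_def)

text \<open>Closure under substitution is replaced by postulating \<open>dist\<close> and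
  \<open>dual\<close> in all instances. The theory used later contains \<open>Var p\<close> for
  every \<open>p\<close> outside \<open>\<delta>\<close>, and closing it under substitution would
  make every formula a theorem.\<close>

locale modal_theory =
  fixes K :: "fm set"
  assumes taut: "tautology \<phi> \<Longrightarrow> \<phi> \<in> K"
    and mp: "Imp \<phi> \<psi> \<in> K \<Longrightarrow> \<phi> \<in> K \<Longrightarrow> \<psi> \<in> K"
    and nec: "\<phi> \<in> K \<Longrightarrow> Box \<phi> \<in> K"
    and dist: "Imp (Box (Imp \<phi> \<psi>)) (Imp (Box \<phi>) (Box \<psi>)) \<in> K"
    and dual: "Iff (Dia \<phi>) (Neg (Box (Neg \<phi>))) \<in> K"
begin

lemma taut_mp: "\<phi> \<in> K \<Longrightarrow> tautology (Imp \<phi> \<psi>) \<Longrightarrow> \<psi> \<in> K"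
  using mp taut by blast

lemma taut_mp2: "\<phi> \<in> K \<Longrightarrow> \<psi> \<in> K \<Longrightarrow> tautology (Imp \<phi> (Imp \<psi> \<chi>)) \<Longrightarrow> \<chi> \<in> K"
  using mp taut by blast

lemma box_mono: "Imp \<phi> \<psi> \<in> K \<Longrightarrow> Imp (Box \<phi>) (Box \<psi>) \<in> K"
  using mp dist nec by blast

definition con :: "fm set \<Rightarrow> bool" where
  "con S \<longleftrightarrow> (\<forall>\<phi>s. set \<phi>s \<subseteq> S \<longrightarrow> Neg (BigAnd \<phi>s) \<notin> K)"

definition mcs :: "fm set \<Rightarrow> bool" where
  "mcs x \<longleftrightarrow> con x \<and> (\<forall>\<phi>. \<phi> \<notin> x \<longrightarrow> Neg \<phi> \<in> x)"

lemma lindenbaum: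
  assumes "con S"
  shows "\<exists>x. mcs x \<and> S \<subseteq> x"
proof -
  have "\<exists>M\<in>{X. S \<subseteq> X \<and> con X}. \<forall>X\<in>{X. S \<subseteq> X \<and> con X}. M \<subseteq> X \<longrightarrow> X = M"
  proof (rule subset_Zorn_nonempty)
    show "{X. S \<subseteq> X \<and> con X} \<noteq> {}" using assms by auto
  next
    fix C assume C: "C \<noteq> {}" "subset.chain {X. S \<subseteq> X \<and> con X} C"
    have "con (\<Union>C)" unfolding con_def
    proof (intro allI impI)
      fix \<phi>s assume "set \<phi>s \<subseteq> \<Union>C"
      then obtain B where "B \<in> C" "set \<phi>s \<subseteq> B"
        using finite_subset_Union_chain[OF _ _ C] by (metis List.finite_set)
      then show "Neg (BigAnd \<phi>s) \<notin> K"
        using C(2) by (auto simp: con_def subset_chain_def)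
    qed
    moreover have "S \<subseteq> \<Union>C" using C by (fast dest: subset_chain_def[THEN iffD1])
    ultimately show "\<Union>C \<in> {X. S \<subseteq> X \<and> con X}" by simp
  qed
  then obtain M where M: "S \<subseteq> M" "con M" and max: "\<And>X. S \<subseteq> X \<Longrightarrow> con X \<Longrightarrow> M \<subseteq> X \<Longrightarrow> X = M"
    by auto
  have "Neg \<phi> \<in> M" if "\<phi> \<notin> M" for \<phi>
  proof -
    \<comment> \<open>By maximality, a formula outside \<open>M\<close> is refuted by finitely many
      members of \<open>M\<close>. Applied to both \<open>\<phi>\<close> and
      \<open>Neg \<phi>\<close>, this refutes a finite part of \<open>M\<close> itself.\<close>
    have incon: "\<exists>\<phi>s. set \<phi>s \<subseteq> M \<and> Neg (And \<psi> (BigAnd \<phi>s)) \<in> K" if \<psi>: "\<psi> \<notin> M" for \<psi>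
    proof -
      have "\<not> con (insert \<psi> M)" using max[of "insert \<psi> M"] M \<psi> by auto
      then obtain \<phi>s where 1: "set \<phi>s \<subseteq> insert \<psi> M" "Neg (BigAnd \<phi>s) \<in> K" by (auto simp: con_def)
      show ?thesis
        using 1 by (intro exI[of _ "filter (\<lambda>\<chi>. \<chi> \<noteq> \<psi>) \<phi>s"] conjI taut_mp[OF 1(2)])
          (auto simp: tautology_def)
    qed
    show ?thesis
    proof (rule ccontr)
      assume "Neg \<phi> \<notin> M"
      from incon[OF this] incon[OF that] obtain \<phi>s \<psi>s
        where 1: "set \<phi>s \<subseteq> M" "set \<psi>s \<subseteq> M"
          and 2: "Neg (And (Neg \<phi>) (BigAnd \<phi>s)) \<in> K" "Neg (And \<phi> (BigAnd \<psi>s)) \<in> K"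
        by blast
      have "Neg (BigAnd (\<phi>s @ \<psi>s)) \<in> K"
        by (rule taut_mp2[OF 2]) (auto simp: tautology_def)
      then show False using 1 M(2) unfolding con_def by (metis set_append Un_least)
    qed
  qed
  with M show ?thesis by (auto simp: mcs_def)
qed

section \<open>Closure properties of maximal consistent sets\<close>

lemma mcs_deduct:
  assumes "mcs x" "set \<phi>s \<subseteq> x" "Imp (BigAnd \<phi>s) \<psi> \<in> K"
  shows "\<psi> \<in> x"
proof (rule ccontr)
  assume "\<psi> \<notin> x"
  then have *: "set (Neg \<psi> # \<phi>s) \<subseteq> x" using assms by (auto simp: mcs_def)
  have "Neg (BigAnd (Neg \<psi> # \<phi>s)) \<in> K"
    by (rule taut_mp[OF assms(3)]) (auto simp: tautology_def)
  with * assms(1) show False unfolding mcs_def con_def by blast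
qed

lemma mcs_K: "mcs x \<Longrightarrow> \<phi> \<in> K \<Longrightarrow> \<phi> \<in> x"
  by (rule mcs_deduct[of x "[]"]) (auto intro: taut_mp simp: tautology_def)

lemma mcs_mp: "mcs x \<Longrightarrow> Imp \<phi> \<psi> \<in> x \<Longrightarrow> \<phi> \<in> x \<Longrightarrow> \<psi> \<in> x"
  by (rule mcs_deduct[of x "[\<phi>, Imp \<phi> \<psi>]"]) (auto intro!: taut simp: tautology_def)

lemma mcs_K_mp: "mcs x \<Longrightarrow> Imp \<phi> \<psi> \<in> K \<Longrightarrow> \<phi> \<in> x \<Longrightarrow> \<psi> \<in> x"
  using mcs_K mcs_mp by blast

lemma mcs_Neg: "mcs x \<Longrightarrow> Neg \<phi> \<in> x \<longleftrightarrow> \<phi> \<notin> x"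
proof -
  assume x: "mcs x"
  have "Neg (BigAnd [\<phi>, Neg \<phi>]) \<in> K" by (auto intro!: taut simp: tautology_def)
  then have "\<not> set [\<phi>, Neg \<phi>] \<subseteq> x" using x unfolding mcs_def con_def by blast
  then show ?thesis using x by (auto simp: mcs_def)
qed

lemma mcs_BigAnd: "mcs x \<Longrightarrow> BigAnd \<phi>s \<in> x \<longleftrightarrow> set \<phi>s \<subseteq> x"
proof (intro iffI subsetI)
  assume x: "mcs x" "BigAnd \<phi>s \<in> x"
  fix \<phi> assume "\<phi> \<in> set \<phi>s"
  then show "\<phi> \<in> x" using x by (intro mcs_K_mp[OF x(1) _ x(2)] taut) (auto simp: tautology_def)
qed (rule mcs_deduct[of _ \<phi>s], auto intro!: taut simp: tautology_def)

lemma mcs_And: "mcs x \<Longrightarrow> And \<phi> \<psi> \<in> x \<longleftrightarrow> \<phi> \<in> x \<and> \<psi> \<in> x"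
proof -
  have 1: "Imp (And \<phi> \<psi>) (BigAnd [\<phi>, \<psi>]) \<in> K" and 2: "Imp (BigAnd [\<phi>, \<psi>]) (And \<phi> \<psi>) \<in> K"
    by (auto intro!: taut simp: tautology_def)
  assume x: "mcs x"
  have "BigAnd [\<phi>, \<psi>] \<in> x \<longleftrightarrow> \<phi> \<in> x \<and> \<psi> \<in> x" using mcs_BigAnd[OF x] by simp
  then show "And \<phi> \<psi> \<in> x \<longleftrightarrow> \<phi> \<in> x \<and> \<psi> \<in> x" using mcs_K_mp[OF x 1] mcs_K_mp[OF x 2] by blast
qed

lemma mcs_Imp: "mcs x \<Longrightarrow> Imp \<phi> \<psi> \<in> x \<longleftrightarrow> (\<phi> \<in> x \<longrightarrow> \<psi> \<in> x)"
  by (simp add: Imp_def mcs_Neg mcs_And)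

lemma mcs_Or: "mcs x \<Longrightarrow> Or \<phi> \<psi> \<in> x \<longleftrightarrow> (\<phi> \<in> x \<or> \<psi> \<in> x)"
  by (simp add: Or_def mcs_Neg mcs_And)

lemma mcs_Iff: "mcs x \<Longrightarrow> Iff \<phi> \<psi> \<in> x \<longleftrightarrow> (\<phi> \<in> x \<longleftrightarrow> \<psi> \<in> x)"
  by (auto simp: Iff_def mcs_Imp mcs_And)

lemma mcs_Dia_Box: "mcs x \<Longrightarrow> Dia \<phi> \<in> x \<longleftrightarrow> Box (Neg \<phi>) \<notin> x"
  using mcs_K[OF _ dual] by (simp add: mcs_Iff mcs_Neg)

section \<open>The canonical relation\<close>

definition canon_rel :: "fm set \<Rightarrow> fm set \<Rightarrow> bool" where
  "canon_rel x y \<longleftrightarrow> mcs x \<and> mcs y \<and> (\<forall>\<phi>\<in>y. Dia \<phi> \<in> x)"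

lemma canon_rel_Box: "canon_rel x y \<longleftrightarrow> mcs x \<and> mcs y \<and> (\<forall>\<phi>. Box \<phi> \<in> x \<longrightarrow> \<phi> \<in> y)"
proof -
  have *: "Box \<phi> \<in> x \<longleftrightarrow> Dia (Neg \<phi>) \<notin> x" if "mcs x" for \<phi>
    using that by (simp add: Box_def mcs_Neg)
  \<comment> \<open>\<open>Box (Neg \<phi>)\<close> unfolds to a negated diamond of a double
    negation, so cancelling that double negation under the diamond has to be derived in
    \<open>K\<close>.\<close>
  have neg: "Dia \<phi> \<in> x \<longleftrightarrow> Dia (Neg (Neg \<phi>)) \<in> x" if "mcs x" for \<phi>
  proof -
    have "Imp (Box (Neg \<phi>)) (Box (Neg (Neg (Neg \<phi>)))) \<in> K"
      "Imp (Box (Neg (Neg (Neg \<phi>)))) (Box (Neg \<phi>)) \<in> K"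
      by (intro box_mono taut, simp add: tautology_def)+
    then show ?thesis using that mcs_Dia_Box mcs_K_mp by blast
  qed
  show ?thesis
    unfolding canon_rel_def using * neg mcs_Neg by (metis (no_types))
qed

text \<open>The existence lemma for a whole set of formulas at once. It is the source of all later
  compactness arguments, among them the existence of successors with a prescribed
  \<open>\<sigma>\<close>-theory.\<close>

lemma canon_rel_exists:
  assumes x: "mcs x" and dia: "\<And>\<phi>s. set \<phi>s \<subseteq> S \<Longrightarrow> Dia (BigAnd \<phi>s) \<in> x"
  shows "\<exists>y. canon_rel x y \<and> S \<subseteq> y"
proof -
  let ?B = "{\<phi>. Box \<phi> \<in> x}"
  have "con (S \<union> ?B)" unfolding con_def
  proof (intro allI impI notI)
    fix \<phi>s assume \<phi>s: "set \<phi>s \<subseteq> S \<union> ?B" and K: "Neg (BigAnd \<phi>s) \<in> K"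
    let ?s = "filter (\<lambda>\<phi>. \<phi> \<in> S) \<phi>s" and ?b = "filter (\<lambda>\<phi>. \<phi> \<notin> S) \<phi>s"
    have box: "Box (BigAnd \<psi>s) \<in> x" if "set \<psi>s \<subseteq> ?B" for \<psi>s
      using that
    proof (induction \<psi>s)
      case Nil
      then show ?case by (intro mcs_K[OF x] nec taut) (simp add: tautology_def)
    next
      case (Cons \<psi> \<psi>s)
      have "Imp (Box \<psi>) (Box (Imp (BigAnd \<psi>s) (BigAnd (\<psi> # \<psi>s)))) \<in> K"
        by (intro box_mono taut) (auto simp: tautology_def)
      then have "Box (Imp (BigAnd \<psi>s) (BigAnd (\<psi> # \<psi>s))) \<in> x"
        using Cons.prems mcs_K_mp[OF x] by auto
      then show ?case
        using Cons mcs_mp[OF x] mcs_K_mp[OF x dist] by auto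
    qed
    have "Imp (BigAnd ?b) (Neg (BigAnd ?s)) \<in> K"
      by (rule taut_mp[OF K]) (auto simp: tautology_def)
    then have "Imp (Box (BigAnd ?b)) (Box (Neg (BigAnd ?s))) \<in> K" by (rule box_mono)
    moreover have "Box (BigAnd ?b) \<in> x" using \<phi>s by (intro box) auto
    ultimately have "Box (Neg (BigAnd ?s)) \<in> x" using mcs_K_mp[OF x] by blast
    then have "Dia (BigAnd ?s) \<notin> x" using mcs_Dia_Box[OF x] by blast
    then show False using dia[of ?s] by auto
  qed
  then obtain y where "mcs y" "S \<union> ?B \<subseteq> y" using lindenbaum by blast
  then show ?thesis using x by (auto simp: canon_rel_Box)
qed

lemma canon_rel_Dia:
  assumes "mcs x"
  shows "Dia \<phi> \<in> x \<longleftrightarrow> (\<exists>y. canon_rel x y \<and> \<phi> \<in> y)"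
proof
  assume dia: "Dia \<phi> \<in> x"
  have "Dia (BigAnd \<phi>s) \<in> x" if "set \<phi>s \<subseteq> {\<phi>}" for \<phi>s
  proof -
    have "Imp (Box (Neg (BigAnd \<phi>s))) (Box (Neg \<phi>)) \<in> K"
      using that by (intro box_mono taut) (auto simp: tautology_def)
    then show ?thesis using dia mcs_Dia_Box[OF assms] mcs_K_mp[OF assms] by blast
  qed
  then show "\<exists>y. canon_rel x y \<and> \<phi> \<in> y" using canon_rel_exists[OF assms, of "{\<phi>}"] by auto
qed (auto simp: canon_rel_def)

lemma canon_rel_compact:
  assumes x: "mcs x" and fin: "\<And>F. finite F \<Longrightarrow> F \<subseteq> S \<Longrightarrow> \<exists>y. canon_rel x y \<and> F \<subseteq> y"
  shows "\<exists>y. canon_rel x y \<and> S \<subseteq> y"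
proof (rule canon_rel_exists[OF x])
  fix \<phi>s assume "set \<phi>s \<subseteq> S"
  then obtain y where "canon_rel x y" "set \<phi>s \<subseteq> y" using fin[of "set \<phi>s"] by auto
  moreover from this have "BigAnd \<phi>s \<in> y" using mcs_BigAnd by (auto simp: canon_rel_def)
  ultimately show "Dia (BigAnd \<phi>s) \<in> x" by (auto simp: canon_rel_def)
qed

lemma canon_rel_trans:
  assumes "\<And>\<phi>. Imp (Box \<phi>) (Box (Box \<phi>)) \<in> K" "canon_rel x y" "canon_rel y z"
  shows "canon_rel x z"
  using assms mcs_K_mp unfolding canon_rel_Box by blast

lemma canon_rel_conn:
  assumes conn: "\<And>\<phi> \<psi>. Or (Box (Imp (Boxp \<phi>) \<psi>)) (Box (Imp (Boxp \<psi>) \<phi>)) \<in> K"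
    and "canon_rel x y" "canon_rel x z"
  shows "y = z \<or> canon_rel y z \<or> canon_rel z y"
proof (rule ccontr)
  assume neg: "\<not> ?thesis"
  have m: "mcs x" "mcs y" "mcs z" using assms by (auto simp: canon_rel_def)
  \<comment> \<open>The axiom speaks of \<open>Boxp\<close>, so the separating formula must be true
    at \<open>y\<close> as well as boxed there. Failure of the relation gives a boxed formula,
    distinctness a true one, and their disjunction is both.\<close>
  have sep: "\<exists>\<phi>. \<phi> \<in> y \<and> Box \<phi> \<in> y \<and> \<phi> \<notin> z"
    if m: "mcs y" "mcs z" and ne: "y \<noteq> z" and nr: "\<not> canon_rel y z" for y z
  proof -
    obtain \<phi> where 1: "Box \<phi> \<in> y" "\<phi> \<notin> z" using m nr by (auto simp: canon_rel_Box)
    obtain \<psi> where 2: "\<psi> \<in> y" "\<psi> \<notin> z"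
      using ne mcs_Neg[OF m(1)] mcs_Neg[OF m(2)] by blast
    have "Imp (Box \<phi>) (Box (Or \<phi> \<psi>)) \<in> K" by (intro box_mono taut) (simp add: tautology_def)
    then have "Box (Or \<phi> \<psi>) \<in> y" using 1 m mcs_K_mp by blast
    then show ?thesis using 1 2 m by (intro exI[of _ "Or \<phi> \<psi>"]) (auto simp: mcs_Or)
  qed
  obtain \<phi> where \<phi>: "\<phi> \<in> y" "Box \<phi> \<in> y" "\<phi> \<notin> z" using sep[of y z] neg m by auto
  obtain \<psi> where \<psi>: "\<psi> \<in> z" "Box \<psi> \<in> z" "\<psi> \<notin> y" using sep[of z y] neg m by auto
  have "Or (Box (Imp (Boxp \<phi>) \<psi>)) (Box (Imp (Boxp \<psi>) \<phi>)) \<in> x" using conn m mcs_K by blast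
  then have "Imp (Boxp \<phi>) \<psi> \<in> y \<or> Imp (Boxp \<psi>) \<phi> \<in> z"
    using assms(2,3) m by (auto simp: mcs_Or canon_rel_Box)
  then show False using \<phi> \<psi> m by (auto simp: mcs_Imp Boxp_def mcs_And)
qed

end

section \<open>Definable and maximal points\<close>

locale K43_theory = modal_theory K for K +
  fixes \<delta> :: "nat set" and \<G> :: "(nat \<times> (nat \<times> nat) set) set"
  assumes ax_4: "Imp (Box \<phi>) (Box (Box \<phi>)) \<in> K"
    and ax_3: "Or (Box (Imp (Boxp \<phi>) \<psi>)) (Box (Imp (Boxp \<psi>) \<phi>)) \<in> K"
    and ax_can: "(n, G) \<in> \<G> \<Longrightarrow> subst s (canonical_fm n G) \<in> K"
    and ax_var: "p \<notin> \<delta> \<Longrightarrow> Var p \<in> K"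
    and fin_\<delta>: "finite \<delta>"
begin

abbreviation Rel (infix \<open>\<leadsto>\<close> 50) where "x \<leadsto> y \<equiv> canon_rel x y"

definition strict (infix \<open>\<prec>\<close> 50) where "x \<prec> y \<longleftrightarrow> x \<leadsto> y \<and> \<not> y \<leadsto> x"

lemma trans: "x \<leadsto> y \<Longrightarrow> y \<leadsto> z \<Longrightarrow> x \<leadsto> z"
  using canon_rel_trans ax_4 by blast

lemma conn: "x \<leadsto> y \<Longrightarrow> x \<leadsto> z \<Longrightarrow> y = z \<or> y \<leadsto> z \<or> z \<leadsto> y"
  using canon_rel_conn ax_3 by blast

lemma rel_mcs: "x \<leadsto> y \<Longrightarrow> mcs x" "x \<leadsto> y \<Longrightarrow> mcs y"
  by (auto simp: canon_rel_def)

lemma rel_Dia: "x \<leadsto> y \<Longrightarrow> \<phi> \<in> y \<Longrightarrow> Dia \<phi> \<in> x"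
  by (auto simp: canon_rel_def)

lemma strict_trans: "x \<prec> y \<Longrightarrow> y \<prec> z \<Longrightarrow> x \<prec> z"
  and rel_strict_trans: "x \<leadsto> y \<Longrightarrow> y \<prec> z \<Longrightarrow> x \<prec> z"
  and strict_rel_trans: "x \<prec> y \<Longrightarrow> y \<leadsto> z \<Longrightarrow> x \<prec> z"
  using trans unfolding strict_def by blast+

lemma mcs_eqI: "mcs x \<Longrightarrow> mcs y \<Longrightarrow> x \<subseteq> y \<Longrightarrow> x = y"
  using mcs_Neg by blast

definition definable :: "fm set \<Rightarrow> bool" where
  "definable x \<longleftrightarrow> mcs x \<and> (\<exists>\<psi>\<in>x. \<forall>z. x \<leadsto> z \<and> \<psi> \<in> z \<longrightarrow> z \<leadsto> x)"

definition maximal :: "fm set \<Rightarrow> fm set \<Rightarrow> bool" where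
  "maximal S x \<longleftrightarrow> mcs x \<and> S \<subseteq> x \<and> (\<forall>z. x \<leadsto> z \<and> S \<subseteq> z \<longrightarrow> z \<leadsto> x)"

definition conj_closed :: "fm set \<Rightarrow> bool" where
  "conj_closed S \<longleftrightarrow> (\<forall>\<phi>s. set \<phi>s \<subseteq> S \<longrightarrow> BigAnd \<phi>s \<in> S)"

text \<open>Zorn's lemma is applied to the boxed formulas of the points: they increase along the
  relation, and a property of all finite subsets passes to the union by compactness.\<close>

lemma maximal_exists:
  assumes "mcs x" "S \<subseteq> x"
  shows "\<exists>y. (y = x \<or> x \<leadsto> y) \<and> maximal S y"
proof (cases "\<exists>y. x \<leadsto> y \<and> S \<subseteq> y")
  case False
  then show ?thesis using assms by (auto simp: maximal_def)
next
  case True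
  let ?A = "{P. \<exists>z. x \<leadsto> z \<and> S \<union> Box ` P \<subseteq> z}"
  have "\<exists>P\<in>?A. \<forall>X\<in>?A. P \<subseteq> X \<longrightarrow> X = P"
  proof (rule subset_Zorn_nonempty)
    show "?A \<noteq> {}" using True by (auto intro: exI[of _ "{}"])
  next
    fix C assume C: "C \<noteq> {}" "subset.chain ?A C"
    have "\<exists>z. x \<leadsto> z \<and> S \<union> Box ` (\<Union>C) \<subseteq> z"
    proof (rule canon_rel_compact[OF assms(1)])
      fix F assume F: "finite F" "F \<subseteq> S \<union> Box ` (\<Union>C)"
      then have "finite (F - S)" "F - S \<subseteq> Box ` (\<Union>C)" by auto
      then obtain F' where F': "F' \<subseteq> \<Union>C" "finite F'" "F - S = Box ` F'"
        using finite_subset_image by metis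
      then obtain B where "B \<in> C" "F' \<subseteq> B"
        using finite_subset_Union_chain[OF _ _ C] by metis
      then obtain z where z: "x \<leadsto> z" "S \<union> Box ` B \<subseteq> z" using C(2) by (auto simp: subset_chain_def)
      moreover have "F \<subseteq> S \<union> Box ` B" using F' \<open>F' \<subseteq> B\<close> by blast
      ultimately show "\<exists>z. x \<leadsto> z \<and> F \<subseteq> z" by blast
    qed
    then show "\<Union>C \<in> ?A" by simp
  qed
  then obtain P where P: "P \<in> ?A" and P_max: "\<forall>X\<in>?A. P \<subseteq> X \<longrightarrow> X = P" by (rule bexE)
  obtain z where z: "x \<leadsto> z" "S \<subseteq> z" "Box ` P \<subseteq> z" using P by auto
  have max: "X = P" if "x \<leadsto> z'" "S \<subseteq> z'" "Box ` X \<subseteq> z'" "P \<subseteq> X" for X z'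
  proof -
    have "X \<in> ?A" using that by auto
    then show ?thesis using P_max that(4) by blast
  qed
  \<comment> \<open>Boxed formulas persist upward by axiom 4, and \<open>P\<close> cannot be
    enlarged; so all points containing \<open>S\<close> from \<open>z\<close> upward have exactly
    the formulas of \<open>P\<close> boxed.\<close>
  have up: "{\<phi>. Box \<phi> \<in> z'} = P" if "z = z' \<or> z \<leadsto> z'" "S \<subseteq> z'" for z'
  proof -
    have "Box \<phi> \<in> z'" if "\<phi> \<in> P" for \<phi>
    proof -
      have 1: "Box \<phi> \<in> z" using z(3) that by blast
      then have "Box (Box \<phi>) \<in> z" using mcs_K_mp[OF _ ax_4] rel_mcs(2)[OF z(1)] by blast
      then show ?thesis using 1 \<open>z = z' \<or> z \<leadsto> z'\<close> by (auto simp: canon_rel_Box)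
    qed
    moreover have "x \<leadsto> z'" using that(1) z(1) trans[of x z z'] by blast
    ultimately show ?thesis using max[of z' "{\<phi>. Box \<phi> \<in> z'}"] that(2) by auto
  qed
  show ?thesis
  proof (cases "\<exists>y. z \<leadsto> y \<and> S \<subseteq> y")
    case False
    then show ?thesis using z rel_mcs by (auto simp: maximal_def)
  next
    case True
    then obtain y where y: "z \<leadsto> y" "S \<subseteq> y" by blast
    \<comment> \<open>\<open>u\<close> and \<open>z\<close> have the same boxed formulas, hence
      \<open>u\<close> sees everything that \<open>z\<close> sees.\<close>
    have "u \<leadsto> y" if "y \<leadsto> u" "S \<subseteq> u" for u
    proof -
      have "{\<phi>. Box \<phi> \<in> u} = {\<phi>. Box \<phi> \<in> z}"
        using up[of u] up[of z] y z that trans[OF y(1) that(1)] by simp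
      then show ?thesis using y(1) rel_mcs[OF that(1)] by (auto simp: canon_rel_Box)
    qed
    then have "maximal S y" using y rel_mcs by (auto simp: maximal_def)
    then show ?thesis using trans[OF z(1) y(1)] by blast
  qed
qed

lemma maximal_definable: "maximal {\<psi>} x \<Longrightarrow> definable x"
  by (auto simp: maximal_def definable_def)

text \<open>The formula \<open>\<psi>\<close> that defines \<open>x\<close> may fail at
  \<open>y\<close>, but \<open>Dia \<psi>\<close> holds throughout the cluster and nowhere strictly
  above it.\<close>

lemma definable_cluster:
  assumes "definable x" "x \<leadsto> y" "y \<leadsto> x"
  shows "definable y"
proof -
  obtain \<psi> where \<psi>: "\<psi> \<in> x" "\<And>z. x \<leadsto> z \<Longrightarrow> \<psi> \<in> z \<Longrightarrow> z \<leadsto> x"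
    using assms(1) by (auto simp: definable_def)
  have "z \<leadsto> y" if "y \<leadsto> z" "Dia \<psi> \<in> z" for z
    using that \<psi> assms trans canon_rel_Dia rel_mcs by meson
  then show ?thesis
    using rel_Dia[OF assms(3) \<psi>(1)] rel_mcs(2)[OF assms(2)] by (auto simp: definable_def)
qed

text \<open>If \<open>x\<close> does not see itself, some \<open>\<psi>\<close> in \<open>x\<close>
  has \<open>Dia \<psi>\<close> outside \<open>x\<close>, and this \<open>\<psi>\<close> fails at
  all successors.\<close>

lemma irreflexive_definable: "mcs x \<Longrightarrow> \<not> x \<leadsto> x \<Longrightarrow> definable x"
  unfolding definable_def using rel_Dia by (auto simp: canon_rel_def)

lemma not_definable_reflexive: "mcs x \<Longrightarrow> \<not> definable x \<Longrightarrow> x \<leadsto> x"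
  using irreflexive_definable by blast

text \<open>Compactness: if every member of \<open>S\<close> held at \<open>w\<close> or somewhere
  above it, then all of \<open>S\<close> would hold at a single successor of \<open>w\<close>, which
  lies strictly above \<open>x\<close>.\<close>

lemma maximal_separated:
  assumes max: "maximal S x" and S: "conj_closed S" and "x \<prec> w"
  shows "\<exists>\<alpha>\<in>S. \<alpha> \<notin> w \<and> (\<forall>z. w \<leadsto> z \<longrightarrow> \<alpha> \<notin> z)"
proof (rule ccontr)
  assume neg: "\<not> ?thesis"
  have w: "mcs w" using assms(3) rel_mcs by (auto simp: strict_def)
  obtain \<alpha> where \<alpha>: "\<alpha> \<in> S" "\<alpha> \<notin> w" using max assms(3) by (auto simp: maximal_def strict_def)
  have "Dia (BigAnd \<phi>s) \<in> w" if "set \<phi>s \<subseteq> S" for \<phi>s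
  proof -
    \<comment> \<open>Prefixing \<open>\<alpha>\<close>, which fails at \<open>w\<close>, forces the
      conjunction to hold at a successor of \<open>w\<close> rather than at \<open>w\<close> itself,
      as \<open>Dia\<close> demands.\<close>
    have "BigAnd (\<alpha> # \<phi>s) \<in> S" using S that \<alpha> by (simp add: conj_closed_def)
    moreover have "BigAnd (\<alpha> # \<phi>s) \<notin> w" using mcs_BigAnd[OF w] \<alpha> by simp
    ultimately obtain z where z: "w \<leadsto> z" "BigAnd (\<alpha> # \<phi>s) \<in> z" using neg by blast
    then have "BigAnd \<phi>s \<in> z" using mcs_BigAnd[OF rel_mcs(2)[OF z(1)]] by auto
    then show ?thesis using z rel_Dia by blast
  qed
  then obtain z where "w \<leadsto> z" "S \<subseteq> z" using canon_rel_exists[OF w] by blast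
  then show False using max assms(3) trans unfolding maximal_def strict_def by blast
qed

text \<open>With \<open>S\<close> a \<open>\<sigma>\<close>-theory this makes definability a matter
  of \<open>\<sigma>\<close>-formulas. If no member of \<open>S\<close> worked, compactness would
  give a successor containing \<open>S\<close> at which \<open>Dia \<psi>\<close> fails, for
  \<open>\<psi>\<close> defining \<open>x\<close>; it cannot see \<open>x\<close>, against
  maximality.\<close>

lemma maximal_definable_in:
  assumes max: "maximal S x" and S: "conj_closed S" and "definable x"
  shows "\<exists>\<alpha>\<in>S. \<forall>z. x \<leadsto> z \<and> \<alpha> \<in> z \<longrightarrow> z \<leadsto> x"
proof (rule ccontr)
  assume neg: "\<not> ?thesis"
  obtain \<psi> where x: "mcs x" and \<psi>: "\<psi> \<in> x" "\<And>z. x \<leadsto> z \<Longrightarrow> \<psi> \<in> z \<Longrightarrow> z \<leadsto> x"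
    using assms(3) by (auto simp: definable_def)
  have "\<exists>z. x \<leadsto> z \<and> insert (Neg (Dia \<psi>)) (insert (Neg \<psi>) S) \<subseteq> z"
  proof (rule canon_rel_compact[OF x])
    fix F assume F: "finite F" "F \<subseteq> insert (Neg (Dia \<psi>)) (insert (Neg \<psi>) S)"
    then obtain \<phi>s where \<phi>s: "set \<phi>s = F \<inter> S" using finite_list[of "F \<inter> S"] by auto
    then have "BigAnd \<phi>s \<in> S" using S by (simp add: conj_closed_def)
    then obtain z where z: "x \<leadsto> z" "BigAnd \<phi>s \<in> z" "\<not> z \<leadsto> x" using neg by blast
    have mz: "mcs z" using z rel_mcs by blast
    have "Neg \<psi> \<in> z" using z \<psi> mcs_Neg[OF mz] by blast
    moreover have "Neg (Dia \<psi>) \<in> z"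
    proof (rule ccontr)
      assume "Neg (Dia \<psi>) \<notin> z"
      then obtain e where "z \<leadsto> e" "\<psi> \<in> e" using mcs_Neg[OF mz] canon_rel_Dia[OF mz] by blast
      then show False using z(1,3) \<psi>(2)[of e] trans[of x z e] trans[of z e x] by blast
    qed
    moreover have "F \<inter> S \<subseteq> z" using z(2) mcs_BigAnd[OF mz] \<phi>s by simp
    ultimately show "\<exists>z. x \<leadsto> z \<and> F \<subseteq> z" using F(2) z(1) by blast
  qed
  then obtain z where z: "x \<leadsto> z" "Neg (Dia \<psi>) \<in> z" "S \<subseteq> z" by blast
  then have "z \<leadsto> x" using max by (auto simp: maximal_def)
  then show False using z rel_Dia[OF _ \<psi>(1)] mcs_Neg rel_mcs by blast
qed

lemma conj_closed_mcs: "mcs x \<Longrightarrow> conj_closed x"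
  by (simp add: conj_closed_def mcs_BigAnd)

lemma maximal_self: "mcs x \<Longrightarrow> maximal x x"
  unfolding maximal_def using mcs_eqI rel_mcs by blast

text \<open>Take a point maximal for \<open>\<alpha>\<close> at or above \<open>x\<close>. It is
  definable, so it has left the cluster of \<open>x\<close>; it satisfies \<open>\<alpha>\<close>,
  so it stays strictly below \<open>w\<close>.\<close>

lemma definable_above:
  assumes "x \<prec> w" "\<not> definable x" "\<alpha> \<in> x" "\<alpha> \<notin> w" "\<And>z. w \<leadsto> z \<Longrightarrow> \<alpha> \<notin> z"
  obtains z where "x \<prec> z" "z \<prec> w" "maximal {\<alpha>} z"
proof -
  have "mcs x" using assms(1) rel_mcs by (auto simp: strict_def)
  then obtain z where z: "z = x \<or> x \<leadsto> z" "maximal {\<alpha>} z" using maximal_exists[of x "{\<alpha>}"] assms(3) by auto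
  have "x \<prec> z" using z maximal_definable assms(2) definable_cluster by (auto simp: strict_def)
  moreover have "z \<prec> w"
    using conn[of x z w] assms z(2) calculation by (auto simp: strict_def maximal_def)
  ultimately show thesis using that z by blast
qed

text \<open>The first clause keeps the second from holding vacuously at final points. The values
  \<open>True\<close> and \<open>False\<close> of \<open>r\<close> lead to \<open>CRefl\<close> and
  \<open>CIrr\<close>.\<close>

definition approx :: "bool \<Rightarrow> fm set \<Rightarrow> bool" where
  "approx r x \<longleftrightarrow> (\<exists>w. x \<prec> w) \<and>
     (\<forall>w. x \<prec> w \<longrightarrow> (\<exists>z. x \<prec> z \<and> z \<prec> w \<and> definable z \<and> (z \<leadsto> z \<longleftrightarrow> r)))"

lemma not_definable_strict: "mcs x \<Longrightarrow> \<not> definable x \<Longrightarrow> \<exists>w. x \<prec> w"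
  using mcs_BigAnd[of x "[]"] unfolding definable_def strict_def by auto

text \<open>This serves the root, which need not be maximal for its \<open>\<sigma>\<close>-theory.
  Definable points come arbitrarily close to \<open>x\<close> from above; if the irreflexive ones do
  not, then below some \<open>w0\<close> all of them are reflexive.\<close>

lemma approx_exists:
  assumes "mcs x" "\<not> definable x"
  shows "\<exists>r. approx r x"
proof (cases "approx False x")
  case False
  then obtain w0 where w0: "x \<prec> w0"
    and refl: "\<And>z. x \<prec> z \<Longrightarrow> z \<prec> w0 \<Longrightarrow> definable z \<Longrightarrow> z \<leadsto> z"
    using not_definable_strict[OF assms] by (auto simp: approx_def)
  have dense: "\<exists>z. x \<prec> z \<and> z \<prec> w \<and> definable z" if w: "x \<prec> w" for w
  proof -
    obtain \<alpha> where "\<alpha> \<in> x" "\<alpha> \<notin> w" "\<And>z. w \<leadsto> z \<Longrightarrow> \<alpha> \<notin> z"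
      using maximal_separated[OF maximal_self[OF assms(1)] conj_closed_mcs[OF assms(1)] w] by blast
    from definable_above[OF w assms(2) this] show ?thesis using maximal_definable by blast
  qed
  have "\<exists>z. x \<prec> z \<and> z \<prec> w \<and> definable z \<and> z \<leadsto> z" if w: "x \<prec> w" for w
  proof -
    have "w = w0 \<or> w \<leadsto> w0 \<or> w0 \<leadsto> w" using conn w w0 by (auto simp: strict_def)
    then obtain u where u: "x \<prec> u" "u = w \<or> u \<leadsto> w" "u = w0 \<or> u \<leadsto> w0" using w w0 by blast
    obtain z where z: "x \<prec> z" "z \<prec> u" "definable z" using dense[OF u(1)] by blast
    have "z \<prec> w" "z \<prec> w0" using z(2) u strict_rel_trans[of z u] by blast+
    then show ?thesis using z refl by blast
  qed
  then have "approx True x" using w0 by (auto simp: approx_def)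
  then show ?thesis ..
qed auto

section \<open>Theories in the common vocabulary\<close>

definition th :: "nat set \<Rightarrow> fm set \<Rightarrow> fm set" where
  "th \<sigma> x = {\<phi> \<in> x. sig \<phi> \<subseteq> \<sigma>}"

lemma conj_closed_th: "mcs x \<Longrightarrow> conj_closed (th \<sigma> x)"
  by (auto simp: conj_closed_def th_def mcs_BigAnd sig_BigAnd)

lemma th_subset:
  assumes "mcs x" "mcs y"
  shows "th \<sigma> x \<subseteq> y \<longleftrightarrow> th \<sigma> y = th \<sigma> x"
proof
  assume *: "th \<sigma> x \<subseteq> y"
  have "\<phi> \<in> x" if "\<phi> \<in> y" "sig \<phi> \<subseteq> \<sigma>" for \<phi>
  proof (rule ccontr)
    assume "\<phi> \<notin> x"
    then have "Neg \<phi> \<in> th \<sigma> x" using assms that by (simp add: th_def mcs_Neg)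
    then show False using * assms that mcs_Neg by blast
  qed
  then show "th \<sigma> y = th \<sigma> x" using * by (auto simp: th_def)
qed (auto simp: th_def)

text \<open>The canonical model is saturated enough for the Hennessy-Milner argument; by symmetry
  this is also the back condition.\<close>

lemma th_forth:
  assumes "mcs y" "th \<sigma> x = th \<sigma> y" "x \<leadsto> x'"
  shows "\<exists>y'. y \<leadsto> y' \<and> th \<sigma> y' = th \<sigma> x'"
proof -
  have x': "mcs x'" using assms rel_mcs by blast
  have "Dia (BigAnd \<phi>s) \<in> y" if "set \<phi>s \<subseteq> th \<sigma> x'" for \<phi>s
  proof -
    have *: "BigAnd \<phi>s \<in> th \<sigma> x'" using conj_closed_th[OF x'] that by (simp add: conj_closed_def)
    then have "Dia (BigAnd \<phi>s) \<in> x" using rel_Dia[OF assms(3)] by (simp add: th_def)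
    then have "Dia (BigAnd \<phi>s) \<in> th \<sigma> x" using * by (simp add: th_def)
    then have "Dia (BigAnd \<phi>s) \<in> th \<sigma> y" using assms(2) by simp
    then show ?thesis by (simp add: th_def)
  qed
  then obtain y' where "y \<leadsto> y'" "th \<sigma> x' \<subseteq> y'" using canon_rel_exists[OF assms(1)] by blast
  then show ?thesis using th_subset[OF x'] rel_mcs by blast
qed

text \<open>Whether a non-definable maximal point is a limit of irreflexive or of reflexive definable
  points has to be read off its \<open>\<sigma>\<close>-theory, so that both models make the same choice.\<close>

definition irr_limit :: "nat set \<Rightarrow> fm set \<Rightarrow> bool" where
  "irr_limit \<sigma> t \<longleftrightarrow>
     (\<forall>\<alpha>\<in>t. \<exists>\<beta>. sig \<beta> \<subseteq> \<sigma> \<and> Dia (And \<alpha> (And \<beta> (Neg (Dia \<beta>)))) \<in> t)"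

text \<open>\<open>And \<beta> (Neg (Dia \<beta>))\<close> can hold only at an irreflexive point,
  and such a point is definable. Conjoining a formula of the theory that has died out from
  \<open>w\<close> upward places it between \<open>x\<close> and \<open>w\<close>.\<close>

lemma approx_irr_limit:
  assumes max: "maximal (th \<sigma> x) x" and "\<not> definable x"
  shows "approx (\<not> irr_limit \<sigma> (th \<sigma> x)) x"
proof -
  have x: "mcs x" using max by (simp add: maximal_def)
  have "\<exists>z. x \<prec> z \<and> z \<prec> w \<and> definable z \<and> (z \<leadsto> z \<longleftrightarrow> \<not> irr_limit \<sigma> (th \<sigma> x))" if w: "x \<prec> w" for w
  proof -
    obtain \<alpha> where \<alpha>: "\<alpha> \<in> th \<sigma> x" "\<alpha> \<notin> w" "\<And>z. w \<leadsto> z \<Longrightarrow> \<alpha> \<notin> z"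
      using maximal_separated[OF max conj_closed_th[OF x] w] by blast
    show ?thesis
    proof (cases "irr_limit \<sigma> (th \<sigma> x)")
      case True
      then obtain \<beta> where "Dia (And \<alpha> (And \<beta> (Neg (Dia \<beta>)))) \<in> x"
        using \<alpha> by (auto simp: irr_limit_def th_def)
      then obtain z where z: "x \<leadsto> z" "And \<alpha> (And \<beta> (Neg (Dia \<beta>))) \<in> z"
        using canon_rel_Dia[OF x] by blast
      have mz: "mcs z" using z rel_mcs by blast
      have z': "\<alpha> \<in> z" "\<beta> \<in> z" "Dia \<beta> \<notin> z" using z mz by (auto simp: mcs_And mcs_Neg)
      have irr: "\<not> z \<leadsto> z" using z' rel_Dia by blast
      then have "x \<prec> z" using z trans unfolding strict_def by blast
      moreover have "z \<prec> w"
        using conn[OF z(1), of w] w \<alpha> z' by (auto simp: strict_def)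
      ultimately show ?thesis using irr irreflexive_definable[OF mz irr] True by blast
    next
      case False
      then obtain \<alpha>0 where \<alpha>0: "\<alpha>0 \<in> th \<sigma> x"
        "\<And>\<beta>. sig \<beta> \<subseteq> \<sigma> \<Longrightarrow> Dia (And \<alpha>0 (And \<beta> (Neg (Dia \<beta>)))) \<notin> th \<sigma> x"
        by (auto simp: irr_limit_def)
      \<comment> \<open>If a maximal point of this formula were irreflexive, the formula itself
        would be the \<open>\<beta>\<close> that the failure of \<open>irr_limit\<close> denies to
        \<open>\<alpha>0\<close>.\<close>
      let ?\<beta> = "And \<alpha>0 \<alpha>"
      have sig: "sig ?\<beta> \<subseteq> \<sigma>" and "?\<beta> \<in> x" using \<alpha> \<alpha>0 x by (auto simp: th_def mcs_And)
      moreover have "?\<beta> \<notin> w" "\<And>z. w \<leadsto> z \<Longrightarrow> ?\<beta> \<notin> z"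
        using \<alpha> w rel_mcs by (auto simp: mcs_And strict_def)
      ultimately obtain z where z: "x \<prec> z" "z \<prec> w" "maximal {?\<beta>} z"
        using definable_above[OF w assms(2)] by metis
      have mz: "mcs z" using z(3) by (simp add: maximal_def)
      have "z \<leadsto> z"
      proof (rule ccontr)
        assume irr: "\<not> z \<leadsto> z"
        have "Dia ?\<beta> \<notin> z"
        proof
          assume "Dia ?\<beta> \<in> z"
          then obtain e where "z \<leadsto> e" "?\<beta> \<in> e" using canon_rel_Dia[OF mz] by blast
          then show False using z(3) irr trans[of z e z] by (auto simp: maximal_def)
        qed
        then have "And \<alpha>0 (And ?\<beta> (Neg (Dia ?\<beta>))) \<in> z"
          using z(3) mz by (auto simp: maximal_def mcs_And mcs_Neg)
        then have "Dia (And \<alpha>0 (And ?\<beta> (Neg (Dia ?\<beta>)))) \<in> th \<sigma> x"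
          using z(1) rel_Dia[of x z] sig by (auto simp: strict_def th_def)
        then show False using \<alpha>0(2)[OF sig] by blast
      qed
      then show ?thesis using z maximal_definable False by blast
    qed
  qed
  then show ?thesis using not_definable_strict[OF x assms(2)] by (auto simp: approx_def)
qed

lemma approx_below_finite:
  assumes "approx r x" "finite V" "\<And>v. v \<in> V \<Longrightarrow> x \<prec> v"
  shows "\<exists>z. x \<prec> z \<and> definable z \<and> (z \<leadsto> z \<longleftrightarrow> r) \<and> (\<forall>v\<in>V. z \<prec> v)"
  using assms(2,3)
proof (induction V)
  case empty
  then show ?case using assms(1) by (auto simp: approx_def)
next
  case (insert v V)
  then obtain z where z: "x \<prec> z" "\<forall>v\<in>V. z \<prec> v" by blast
  have v: "x \<prec> v" using insert.prems by blast
  have "z = v \<or> z \<leadsto> v \<or> v \<leadsto> z" using conn z(1) v by (auto simp: strict_def)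
  then have "\<exists>u. x \<prec> u \<and> (u = z \<or> u \<leadsto> z) \<and> (u = v \<or> u \<leadsto> v)" using z(1) v by blast
  then obtain u where u: "x \<prec> u" "u = z \<or> u \<leadsto> z" "u = v \<or> u \<leadsto> v" by blast
  then obtain z' where z': "x \<prec> z'" "z' \<prec> u" "definable z'" "z' \<leadsto> z' \<longleftrightarrow> r"
    using assms(1) unfolding approx_def by meson
  then have "z' \<prec> z" "z' \<prec> v" using u strict_rel_trans[of z' u] by blast+
  then have "\<forall>w\<in>insert v V. z' \<prec> w" using z(2) strict_trans[of z' z] by blast
  then show ?case using z' by blast
qed

text \<open>A copy of the first \<open>N\<close> points \<open>B n\<close> of a frame
  \<open>CC\<close>: a larger index means a lower point, and \<open>r\<close> prescribes
  reflexivity.\<close>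

lemma approx_descending:
  assumes "approx r x" "finite V" "\<And>v. v \<in> V \<Longrightarrow> x \<prec> v"
  shows "\<exists>z :: nat \<Rightarrow> fm set. \<forall>n<N. x \<prec> z n \<and> definable (z n) \<and> (z n \<leadsto> z n \<longleftrightarrow> r) \<and>
           (\<forall>v\<in>V. z n \<prec> v) \<and> (\<forall>m<n. z n \<prec> z m)"
proof (induction N)
  case (Suc N)
  then obtain z where z: "\<And>n. n < N \<Longrightarrow> x \<prec> z n \<and> definable (z n) \<and> (z n \<leadsto> z n \<longleftrightarrow> r) \<and>
           (\<forall>v\<in>V. z n \<prec> v) \<and> (\<forall>m<n. z n \<prec> z m)" by blast
  have "\<exists>z'. x \<prec> z' \<and> definable z' \<and> (z' \<leadsto> z' \<longleftrightarrow> r) \<and> (\<forall>v\<in>V \<union> z ` {..<N}. z' \<prec> v)"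
    using assms z by (intro approx_below_finite) auto
  then obtain z' where "x \<prec> z'" "definable z'" "z' \<leadsto> z' \<longleftrightarrow> r" "\<forall>v\<in>V \<union> z ` {..<N}. z' \<prec> v"
    by blast
  then have "\<forall>n<Suc N. x \<prec> (z(N := z')) n \<and> definable ((z(N := z')) n) \<and>
      ((z(N := z')) n \<leadsto> (z(N := z')) n \<longleftrightarrow> r) \<and>
      (\<forall>v\<in>V. (z(N := z')) n \<prec> v) \<and> (\<forall>m<n. (z(N := z')) n \<prec> (z(N := z')) m)"
    using z by (auto simp: less_Suc_eq)
  then show ?case by blast
qed auto

text \<open>Points of one cluster have the same successors, hence the same diamonds, and variables
  outside \<open>\<delta>\<close> are true everywhere; what remains are the variables in
  \<open>\<delta>\<close>.\<close>

lemma cluster_eqI: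
  assumes "x \<leadsto> y" "y \<leadsto> x" and "\<And>p. p \<in> \<delta> \<Longrightarrow> Var p \<in> x \<longleftrightarrow> Var p \<in> y"
  shows "x = y"
proof -
  have m: "mcs x" "mcs y" using assms rel_mcs by blast+
  have "\<phi> \<in> x \<longleftrightarrow> \<phi> \<in> y" for \<phi>
  proof (induction \<phi>)
    case Top
    then show ?case using mcs_BigAnd[of _ "[]"] m by (simp add: BigAnd_def)
  next
    case Bot
    have "Neg Bot \<in> K" by (rule taut) (simp add: tautology_def)
    then have "Bot \<notin> z" if "mcs z" for z using that mcs_K mcs_Neg by blast
    then show ?case using m by blast
  next
    case (Var p)
    then show ?case using assms(3) ax_var[of p] mcs_K m by blast
  next
    case (Dia \<phi>)
    then show ?case using canon_rel_Dia m trans assms(1,2) by blast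
  qed (use m in \<open>auto simp: mcs_Neg mcs_And\<close>)
  then show ?thesis by blast
qed

lemma cluster_card:
  assumes "\<And>x y. x \<in> C \<Longrightarrow> y \<in> C \<Longrightarrow> x \<leadsto> y"
  shows "card C \<le> 2 ^ card \<delta>"
proof -
  have "inj_on (\<lambda>x. {p \<in> \<delta>. Var p \<in> x}) C"
    using assms by (intro inj_onI cluster_eqI) blast+
  then have "card C \<le> card (Pow \<delta>)" using fin_\<delta> by (intro card_inj_on_le) auto
  then show ?thesis using fin_\<delta> by (simp add: card_Pow)
qed

section \<open>Refuting canonical formulas in the canonical model\<close>

lemma sat_canonical_model:
  assumes "mcs x"
  shows "sat (\<lparr>worlds = {x. mcs x}, acc = {(x, y). x \<leadsto> y}, internal = \<I>\<rparr>, \<lambda>p. {x. Var p \<in> x}) x \<phi> \<longleftrightarrow>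
         \<phi> \<in> x"
  using assms
proof (induction \<phi> arbitrary: x)
  case Top
  then show ?case using mcs_BigAnd[of x "[]"] by (simp add: BigAnd_def)
next
  case Bot
  have "Neg Bot \<in> K" by (rule taut) (simp add: tautology_def)
  then show ?case using Bot mcs_K mcs_Neg by auto
next
  case (Dia \<phi>)
  then show ?case using canon_rel_Dia[OF Dia.prems] rel_mcs(2) by auto
qed (auto simp: mcs_Neg mcs_And)

text \<open>What \<open>K\<close> provides are the substitution instances of the canonical formula;
  they exclude just those subreductions whose preimages are complements of truth sets.\<close>

lemma no_definable_subreduction:
  assumes nG: "(n, G) \<in> \<G>" and x: "mcs x" and "s 0 \<notin> x"
  shows "\<not> subreduction n G {(x, y). x \<leadsto> y} {y. y = x \<or> x \<leadsto> y} (\<lambda>p. {y. mcs y \<and> s p \<in> y})"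
proof
  let ?F = "\<lparr>worlds = {x. mcs x}, acc = {(x, y). x \<leadsto> y}, internal = {}\<rparr>"
  let ?v = "\<lambda>p. {x. Var p \<in> x}" let ?v' = "\<lambda>p. {y. mcs y \<and> s p \<in> y}"
  assume "subreduction n G {(x, y). x \<leadsto> y} {y. y = x \<or> x \<leadsto> y} ?v'"
  then have "\<not> sat (?F, ?v') x (canonical_fm n G)"
    unfolding sat_canonical_fm using assms(3) by simp
  moreover have "?v' = (\<lambda>p. {y \<in> worlds ?F. sat (?F, ?v) y (s p)})"
    by (auto simp: sat_canonical_model)
  ultimately have "\<not> sat (?F, ?v) x (subst s (canonical_fm n G))"
    using sat_subst[of ?F x ?v s "canonical_fm n G"] x rel_mcs by fastforce
  then show False
    using mcs_K[OF x ax_can[OF nG]] by (simp add: sat_canonical_model x)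
qed

text \<open>\<open>Z d\<close> is a Jankov-Fine style description of \<open>d\<close> relative to \<open>D\<close>. A point satisfying it
  need not be \<open>d\<close>, but it sees exactly those points of \<open>D\<close> that \<open>d\<close> sees.\<close>

lemma no_definable_finite_subreduction:
  assumes nG: "(n, G) \<in> \<G>" and fin: "finite D" and def: "\<And>d. d \<in> D \<Longrightarrow> definable d"
    and d0: "d0 \<in> D" "f d0 = 0" and above: "\<And>d. d \<in> D \<Longrightarrow> d = d0 \<or> d0 \<leadsto> d"
    and range: "\<And>d. d \<in> D \<Longrightarrow> f d \<le> n"
    and G: "\<And>d d'. d \<in> D \<Longrightarrow> d' \<in> D \<Longrightarrow> d \<leadsto> d' \<Longrightarrow> (f d, f d') \<in> G"
      "\<And>d j. d \<in> D \<Longrightarrow> j \<le> n \<Longrightarrow> (f d, j) \<in> G \<Longrightarrow> \<exists>d'\<in>D. d \<leadsto> d' \<and> f d' = j"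
    and t: "t \<in> D" "\<And>y. t \<leadsto> y \<Longrightarrow> y \<leadsto> t"
  shows False
proof -
  obtain Dl where Dl: "set Dl = D" using finite_list[OF fin] by blast
  have mcs_D: "mcs d" if "d \<in> D" for d using def[OF that] by (simp add: definable_def)
  have "\<forall>d\<in>D. \<exists>\<psi>. \<psi> \<in> d \<and> (\<forall>z. d \<leadsto> z \<and> \<psi> \<in> z \<longrightarrow> z \<leadsto> d)" using def by (auto simp: definable_def)
  then obtain \<beta> where \<beta>: "\<And>d. d \<in> D \<Longrightarrow> \<beta> d \<in> d" "\<And>d z. d \<in> D \<Longrightarrow> d \<leadsto> z \<Longrightarrow> \<beta> d \<in> z \<Longrightarrow> z \<leadsto> d"
    by metis
  have "\<forall>d\<in>D. \<forall>d'\<in>D. \<exists>\<theta>. d \<noteq> d' \<longrightarrow> \<theta> \<in> d \<and> \<theta> \<notin> d'" using mcs_eqI mcs_D by blast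
  then obtain \<theta> where \<theta>: "\<And>d d'. d \<in> D \<Longrightarrow> d' \<in> D \<Longrightarrow> d \<noteq> d' \<Longrightarrow> \<theta> d d' \<in> d \<and> \<theta> d d' \<notin> d'"
    by metis
  \<comment> \<open>The \<open>\<theta>\<close>-parts make the formulas \<open>\<psi> d\<close>
    mutually exclusive at every point, inside \<open>D\<close> or not. The part
    \<open>\<beta> d\<close> ensures that nothing strictly above \<open>d\<close> satisfies
    \<open>\<psi> d\<close>.\<close>
  define \<psi> where "\<psi> d = BigAnd (\<beta> d # [\<theta> d d'. d' \<leftarrow> Dl, d' \<noteq> d] @ [Neg (\<theta> d' d). d' \<leftarrow> Dl, d' \<noteq> d])" for d
  have \<psi>_iff: "\<psi> d \<in> y \<longleftrightarrow> \<beta> d \<in> y \<and> (\<forall>d'\<in>D. d' \<noteq> d \<longrightarrow> \<theta> d d' \<in> y \<and> \<theta> d' d \<notin> y)" if "mcs y" for d y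
    using that Dl by (auto simp: \<psi>_def mcs_BigAnd mcs_Neg)
  have \<psi>_self: "\<psi> d \<in> d" if "d \<in> D" for d
    using that \<beta> \<theta> mcs_D by (auto simp: \<psi>_iff)
  have \<psi>_max: "z \<leadsto> d" if "d \<in> D" "d \<leadsto> z" "\<psi> d \<in> z" for d z
    using that \<beta> rel_mcs(2)[OF that(2)] by (auto simp: \<psi>_iff)
  have \<psi>_excl: "d = d'" if "d \<in> D" "d' \<in> D" "mcs y" "\<psi> d \<in> y" "\<psi> d' \<in> y" for d d' y
    using that by (auto simp: \<psi>_iff)
  define Z where "Z d = BigAnd (\<psi> d # [Dia (\<psi> d'). d' \<leftarrow> Dl, d \<leadsto> d'] @ [Neg (Dia (\<psi> d')). d' \<leftarrow> Dl, \<not> d \<leadsto> d'])" for d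
  have Z_iff: "Z d \<in> y \<longleftrightarrow> \<psi> d \<in> y \<and> (\<forall>d'\<in>D. Dia (\<psi> d') \<in> y \<longleftrightarrow> d \<leadsto> d')" if "mcs y" for d y
    using that Dl by (auto simp: Z_def mcs_BigAnd mcs_Neg)
  have lin: "y = y' \<or> y \<leadsto> y' \<or> y' \<leadsto> y" if "y = d0 \<or> d0 \<leadsto> y" "y' = d0 \<or> d0 \<leadsto> y'" for y y'
    using that conn by blast
  \<comment> \<open>The witness of the diamond need not be \<open>d\<close>, but by linearity it is
    comparable with \<open>d\<close>, and if it lies above \<open>d\<close> it still sees
    \<open>d\<close>.\<close>
  have sees: "y \<leadsto> d" if "d \<in> D" and y: "y = d0 \<or> d0 \<leadsto> y" and Dia: "Dia (\<psi> d) \<in> y" for d y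
  proof -
    have "mcs y" using y mcs_D[OF d0(1)] rel_mcs by blast
    then obtain e where e: "y \<leadsto> e" "\<psi> d \<in> e" using canon_rel_Dia Dia by blast
    have "e = d0 \<or> d0 \<leadsto> e" using y e(1) trans[of d0 y e] by blast
    then have "e = d \<or> e \<leadsto> d \<or> d \<leadsto> e" using lin above[OF that(1)] by blast
    then show ?thesis using e \<psi>_max[OF that(1) _ e(2)] trans[OF e(1)] by blast
  qed
  have Z_self: "Z d \<in> d" if d: "d \<in> D" for d
    using sees[OF _ above[OF d]] rel_Dia[OF _ \<psi>_self] \<psi>_self[OF d] by (auto simp: Z_iff[OF mcs_D[OF d]])
  \<comment> \<open>The variable of \<open>i\<close> has to fail exactly where some description
    \<open>Z d\<close> with \<open>f d = i\<close> holds, whence the negations.\<close>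
  define s where "s i = BigAnd [Neg (Z d). d \<leftarrow> Dl, f d = i]" for i
  have s_iff: "s i \<notin> y \<longleftrightarrow> (\<exists>d\<in>D. f d = i \<and> Z d \<in> y)" if "mcs y" for i y
    using that Dl by (auto simp: s_def mcs_BigAnd mcs_Neg)
  have up_mcs: "mcs y" if "y = d0 \<or> d0 \<leadsto> y" for y using that mcs_D[OF d0(1)] rel_mcs by blast
  have s_self: "s (f d) \<notin> d" if "d \<in> D" for d using s_iff[OF mcs_D[OF that]] Z_self that by blast
  let ?R = "{(x, y). x \<leadsto> y}" and ?U = "{y. y = d0 \<or> d0 \<leadsto> y}" and ?v = "\<lambda>p. {y. mcs y \<and> s p \<in> y}"
  have "s 0 \<notin> d0" using s_self d0 by metis
  then have "\<not> subreduction n G ?R ?U ?v"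
    by (rule no_definable_subreduction[OF nG mcs_D[OF d0(1)]])
  moreover have "subreduction n G ?R ?U ?v"
    unfolding subreduction_def
  proof (intro conjI allI impI ballI)
    fix i j y assume ij: "i \<le> n" "j \<le> n" "(i, j) \<in> G" and y: "y \<in> ?U - ?v i"
    then have y': "y = d0 \<or> d0 \<leadsto> y" "mcs y" using up_mcs by auto
    then obtain d where d: "d \<in> D" "f d = i" "Z d \<in> y" using y s_iff by auto
    obtain d' where d': "d' \<in> D" "d \<leadsto> d'" "f d' = j" using G(2) d ij by blast
    then have "y \<leadsto> d'" using sees[OF d'(1) y'(1)] d y'(2) by (auto simp: Z_iff)
    then show "\<exists>z. (y, z) \<in> ?R \<and> z \<notin> ?v j"
      using s_self[OF d'(1)] d'(3) by auto
  next
    fix i j y z assume ij: "i \<le> n" "j \<le> n" "(i, j) \<notin> G" and y: "y \<in> ?U - ?v i"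
      and z: "(y, z) \<in> ?R"
    then have y': "y = d0 \<or> d0 \<leadsto> y" "mcs y" and z': "y \<leadsto> z" "mcs z" using up_mcs rel_mcs(2) by auto
    then obtain d where d: "d \<in> D" "f d = i" "Z d \<in> y" using y s_iff by auto
    have "s j \<in> z"
    proof (rule ccontr)
      assume "s j \<notin> z"
      then obtain d' where d': "d' \<in> D" "f d' = j" "Z d' \<in> z" using s_iff[OF z'(2)] by blast
      then have "Dia (\<psi> d') \<in> y" using z' rel_Dia by (auto simp: Z_iff)
      then have "d \<leadsto> d'" using d d' y' by (auto simp: Z_iff)
      then show False using G(1) d d' ij by blast
    qed
    then show "z \<in> ?v j" using z' by blast
  next
    fix i j y assume ij: "i \<le> n" "j \<le> n" "j \<noteq> i" and y: "y \<in> ?U - ?v i"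
    then have y': "mcs y" using up_mcs by auto
    then obtain d where d: "d \<in> D" "f d = i" "Z d \<in> y" using y s_iff by auto
    have "s j \<in> y"
    proof (rule ccontr)
      assume "s j \<notin> y"
      then obtain d' where d': "d' \<in> D" "f d' = j" "Z d' \<in> y" using s_iff[OF y'] by blast
      then show False using \<psi>_excl[OF d(1) d'(1) y'] d ij(3) by (simp add: Z_iff[OF y'])
    qed
    then show "y \<in> ?v j" using y' by blast
  next
    fix y assume "y \<in> ?U"
    \<comment> \<open>The single point \<open>t\<close> settles cofinality: everything from
      \<open>d0\<close> upward is comparable with it, and nothing lies strictly above it.\<close>
    then have "y = t \<or> y \<leadsto> t" using lin[of y t] above[OF t(1)] t(2) by blast
    then show "\<exists>i\<le>n. \<exists>z. (z = y \<or> (y, z) \<in> ?R) \<and> z \<notin> ?v i"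
      using s_self[OF t(1)] range[OF t(1)] by blast
  qed
  ultimately show False by blast
qed

end

section \<open>Sums of atomic frames\<close>

lemma generated_sets_subset:
  assumes "\<And>X. X \<in> G \<Longrightarrow> X \<subseteq> W" "X \<in> generated_sets W R G"
  shows "X \<subseteq> W"
  using assms(2) by induction (auto simp: assms(1) dia_set_def)

lemma general_frame_generated:
  assumes "W \<noteq> {}" "R \<subseteq> W \<times> W" "\<And>X. X \<in> G \<Longrightarrow> X \<subseteq> W"
  shows "general_frame \<lparr>worlds = W, acc = R, internal = generated_sets W R G\<rparr>"
  using assms(1,2) generated_sets_subset[of G W _ R] assms(3)
  by (auto simp: general_frame_def intro: generated_sets.intros)

lemma generated_sets_UN:
  assumes "\<And>X. X \<in> G \<Longrightarrow> X \<subseteq> W" "finite I" "\<And>i. i \<in> I \<Longrightarrow> Y i \<in> generated_sets W R G"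
  shows "(\<Union>i\<in>I. Y i) \<in> generated_sets W R G"
  using assms(2,3)
proof (induction I)
  case empty
  then show ?case by (simp add: generated_sets.empty)
next
  case (insert i I)
  let ?U = "\<Union>i\<in>I. Y i"
  have "Y i \<union> ?U = W - ((W - Y i) \<inter> (W - ?U))"
    using insert generated_sets_subset[OF assms(1)] by (smt (verit) Diff_Un Diff_Diff_Int Int_absorb1 Un_least insertI1 insertI2)
  then show ?case using insert by (simp add: generated_sets.compl generated_sets.inter)
qed

section \<open>Internal sets of the frames \<open>CC k r\<close>\<close>

lemma CC_X_subset: "i < k \<Longrightarrow> CC_X k i \<subseteq> CC_worlds k"
  by (auto simp: CC_X_def CC_worlds_def)

lemma CC_generators_subset: "X \<in> CC_X k ` {..<k} \<union> range (\<lambda>n. {B n}) \<Longrightarrow> X \<subseteq> CC_worlds k"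
  using CC_X_subset by (auto simp: CC_worlds_def)

lemma general_frame_CC: "0 < k \<Longrightarrow> general_frame (CC k r)"
  unfolding CC_def
  by (rule general_frame_generated) (use CC_generators_subset in \<open>auto simp: CC_worlds_def CC_acc_def\<close>)

lemma CC_internal_UN: "I \<subseteq> {..<k} \<Longrightarrow> (\<Union>i\<in>I. CC_X k i) \<in> internal (CC k r)"
  unfolding CC_def gframe.simps
  by (rule generated_sets_UN)
    (use CC_generators_subset in \<open>auto intro: generated_sets.gen finite_subset[of I "{..<k}"]\<close>)

text \<open>Far enough out, the points \<open>B n\<close> repeat the points \<open>A i\<close>
  periodically. The case that needs an argument is \<open>dia\<close>: a non-empty set of this kind
  contains some \<open>B m\<close>, so its diamond set contains all points \<open>A i\<close> and
  all \<open>B n\<close> with \<open>n > m\<close>.\<close>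

lemma CC_internal_eventually:
  assumes "X \<in> internal (CC k r)" "0 < k"
  shows "\<exists>N. \<forall>n\<ge>N. B n \<in> X \<longleftrightarrow> A (n mod k) \<in> X"
proof -
  have "X \<in> generated_sets (CC_worlds k) (CC_acc k r) (CC_X k ` {..<k} \<union> range (\<lambda>n. {B n}))"
    using assms(1) by (simp add: CC_def)
  then show ?thesis
  proof induction
    case (gen X)
    then consider i where "i < k" "X = CC_X k i" | n where "X = {B n}" by auto
    then show ?case
    proof cases
      case 1
      then show ?thesis by (auto simp: CC_X_def)
    next
      case 2
      then show ?thesis by (intro exI[of _ "Suc n"]) auto
    qed
  next
    case empty
    then show ?case by simp
  next
    case (compl X)
    then show ?case using assms(2) by (force simp: CC_worlds_def)
  next
    case (inter X Y)
    then obtain N M where "\<forall>n\<ge>N. B n \<in> X \<longleftrightarrow> A (n mod k) \<in> X" "\<forall>n\<ge>M. B n \<in> Y \<longleftrightarrow> A (n mod k) \<in> Y"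
      by blast
    then show ?case by (intro exI[of _ "max N M"]) auto
  next
    case (dia X)
    then obtain N where N: "\<forall>n\<ge>N. B n \<in> X \<longleftrightarrow> A (n mod k) \<in> X" by blast
    have sub: "X \<subseteq> CC_worlds k" using generated_sets_subset[OF CC_generators_subset dia(1)] .
    show ?case
    proof (cases "X = {}")
      case False
      have "\<exists>m. B m \<in> X"
      proof -
        obtain y where y: "y \<in> X" using False by blast
        show ?thesis
        proof (cases y)
          case (A i)
          then have "i < k" using y sub by (auto simp: CC_worlds_def)
          \<comment> \<open>An index beyond \<open>N\<close> in the residue class of
            \<open>i\<close>.\<close>
          then have "(i + k * N) mod k = i" "N \<le> i + k * N"
            using mult_le_mono1[of 1 k N] by (simp, linarith)
          then show ?thesis using N y A by metis
        qed (use y in blast)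
      qed
      then obtain m where "B m \<in> X" ..
      then have "\<forall>n\<ge>Suc m. B n \<in> dia_set (CC_worlds k) (CC_acc k r) X \<and>
                             A (n mod k) \<in> dia_set (CC_worlds k) (CC_acc k r) X"
        using assms(2) by (auto simp: dia_set_def CC_acc_def CC_worlds_def intro!: bexI[of _ "B m"])
      then show ?thesis by blast
    qed (simp add: dia_set_def)
  qed
qed

lemma CC_internal_limit:
  assumes "X \<in> internal (CC k r)" "A i \<in> X" "i < k"
  shows "\<exists>n. B n \<in> X"
proof -
  obtain N where N: "\<forall>n\<ge>N. B n \<in> X \<longleftrightarrow> A (n mod k) \<in> X"
    using CC_internal_eventually[OF assms(1)] assms(3) by auto
  have "(i + k * N) mod k = i" "N \<le> i + k * N"
    using assms(3) mult_le_mono1[of 1 k N] by (simp, linarith)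
  then show ?thesis using N assms(2) by metis
qed

section \<open>Ordered sums of general frames\<close>

lemma ordered_sum_frame_simps [simp]:
  "(i, x) \<in> worlds (ordered_sum_frame Fs) \<longleftrightarrow> i < length Fs \<and> x \<in> worlds (Fs ! i)"
  "((i, x), (j, y)) \<in> acc (ordered_sum_frame Fs) \<longleftrightarrow>
     i < length Fs \<and> j < length Fs \<and> x \<in> worlds (Fs ! i) \<and> y \<in> worlds (Fs ! j) \<and>
     (i < j \<or> i = j \<and> (x, y) \<in> acc (Fs ! i))"
  by (auto simp: ordered_sum_frame_def)

lemma ordered_sum_frame_internal:
  assumes "\<And>F. F \<in> set Fs \<Longrightarrow> general_frame F"
  shows "X \<in> internal (ordered_sum_frame Fs) \<longleftrightarrow>
    X \<subseteq> worlds (ordered_sum_frame Fs) \<and> (\<forall>i<length Fs. {x. (i, x) \<in> X} \<in> internal (Fs ! i))"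
proof
  assume "X \<in> internal (ordered_sum_frame Fs)"
  then obtain Y where X: "X = (\<Union>i<length Fs. Pair i ` Y i)" and Y: "\<forall>i<length Fs. Y i \<in> internal (Fs ! i)"
    by (auto simp: ordered_sum_frame_def)
  have "{x. (i, x) \<in> X} = Y i" if "i < length Fs" for i using that X by auto
  moreover have "Y i \<subseteq> worlds (Fs ! i)" if "i < length Fs" for i
    using assms[of "Fs ! i"] that Y by (auto simp: general_frame_def)
  ultimately show "X \<subseteq> worlds (ordered_sum_frame Fs) \<and> (\<forall>i<length Fs. {x. (i, x) \<in> X} \<in> internal (Fs ! i))"
    using X Y by fastforce
next
  assume X: "X \<subseteq> worlds (ordered_sum_frame Fs) \<and> (\<forall>i<length Fs. {x. (i, x) \<in> X} \<in> internal (Fs ! i))"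
  then have "X = (\<Union>i<length Fs. Pair i ` {x. (i, x) \<in> X})" by (auto simp: ordered_sum_frame_def)
  then show "X \<in> internal (ordered_sum_frame Fs)" using X
    unfolding ordered_sum_frame_def by (auto intro!: exI[of _ "\<lambda>i. {x. (i, x) \<in> X}"])
qed

lemma general_frame_ordered_sum:
  assumes Fs: "\<And>F. F \<in> set Fs \<Longrightarrow> general_frame F" and ne: "Fs \<noteq> []"
  shows "general_frame (ordered_sum_frame Fs)"
proof -
  let ?S = "ordered_sum_frame Fs"
  note int = ordered_sum_frame_internal[OF Fs]
  have gf: "general_frame (Fs ! i)" if "i < length Fs" for i using Fs that by simp
  have "worlds (Fs ! 0) \<noteq> {}" using gf[of 0] ne by (auto simp: general_frame_def)
  then have "worlds ?S \<noteq> {}" using ne by (fastforce simp: ordered_sum_frame_def)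
  moreover have "acc ?S \<subseteq> worlds ?S \<times> worlds ?S" by (auto simp: ordered_sum_frame_def)
  moreover have "internal ?S \<subseteq> Pow (worlds ?S)" "{} \<in> internal ?S"
    using gf by (auto simp: int) (auto simp: general_frame_def)
  moreover have "worlds ?S - X \<in> internal ?S" if X: "X \<in> internal ?S" for X
  proof -
    have "{x. (i, x) \<in> worlds ?S - X} = worlds (Fs ! i) - {x. (i, x) \<in> X}" if "i < length Fs" for i
      using that by auto
    then show ?thesis using X gf by (auto simp: int general_frame_def)
  qed
  moreover have "X \<inter> Y \<in> internal ?S" if X: "X \<in> internal ?S" and Y: "Y \<in> internal ?S" for X Y
  proof -
    have "{x. (i, x) \<in> X \<inter> Y} = {x. (i, x) \<in> X} \<inter> {x. (i, x) \<in> Y}" for i by auto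
    then show ?thesis using X Y gf by (auto simp: int general_frame_def)
  qed
  moreover have "dia_set (worlds ?S) (acc ?S) X \<in> internal ?S" if X: "X \<in> internal ?S" for X
  proof -
    \<comment> \<open>If \<open>X\<close> has a point in a later summand, all of summand
      \<open>i\<close> sees it; otherwise the diamond is computed inside summand
      \<open>i\<close>.\<close>
    have "{x. (i, x) \<in> dia_set (worlds ?S) (acc ?S) X} \<in> internal (Fs ! i)" if i: "i < length Fs" for i
    proof (cases "\<exists>j x. i < j \<and> (j, x) \<in> X")
      case True
      then obtain j y where jy: "i < j" "(j, y) \<in> X" by blast
      moreover have "(j, y) \<in> worlds ?S" using jy X int by blast
      ultimately have "{x. (i, x) \<in> dia_set (worlds ?S) (acc ?S) X} = worlds (Fs ! i)"
        using i by (force simp: dia_set_def intro!: bexI[of _ "(j, y)"])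
      moreover have "worlds (Fs ! i) - {} \<in> internal (Fs ! i)"
        using gf[OF i] unfolding general_frame_def by blast
      ultimately show ?thesis by simp
    next
      case False
      then have "(\<exists>z\<in>X. ((i, x), z) \<in> acc ?S) \<longleftrightarrow> (\<exists>y. (i, y) \<in> X \<and> (x, y) \<in> acc (Fs ! i))"
        if "x \<in> worlds (Fs ! i)" for x
        using that i X by (force simp: int)
      then have "{x. (i, x) \<in> dia_set (worlds ?S) (acc ?S) X} =
          dia_set (worlds (Fs ! i)) (acc (Fs ! i)) {x. (i, x) \<in> X}"
        using i by (auto simp: dia_set_def)
      then show ?thesis using X i gf[OF i] by (auto simp: int general_frame_def)
    qed
    then show ?thesis using X by (auto simp: int dia_set_def)
  qed
  ultimately show ?thesis unfolding general_frame_def by blast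
qed

lemma delta_model_ordered_sum:
  assumes Ms: "\<And>M. M \<in> set Ms \<Longrightarrow> delta_model \<delta> M" and "Ms \<noteq> []"
  shows "delta_model \<delta> (ordered_sum Ms)"
proof -
  have gf: "general_frame F" if "F \<in> set (map fst Ms)" for F
    using that Ms by (auto simp: delta_model_def)
  have "snd (ordered_sum Ms) p \<in> internal (ordered_sum_frame (map fst Ms))" if "p \<in> \<delta>" for p
  proof -
    have "\<forall>i<length (map fst Ms). snd (Ms ! i) p \<in> internal (map fst Ms ! i)"
      using Ms that by (simp add: delta_model_def)
    then show ?thesis unfolding ordered_sum_def ordered_sum_frame_def
      by (auto intro!: exI[of _ "\<lambda>i. snd (Ms ! i) p"])
  qed
  then show ?thesis
    using general_frame_ordered_sum[of "map fst Ms", OF gf] assms(2)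
    by (simp add: delta_model_def ordered_sum_def)
qed

text \<open>One-point chains suffice: a longer \<open>Chain\<close> or an \<open>RChain\<close>
  decomposes into an ordered sum of one-point frames with the same total size.\<close>

fun basic_atom :: "atom \<Rightarrow> bool" where
  "basic_atom (Chain m) = (m = 1)"
| "basic_atom (RChain m) = False"
| "basic_atom (Cluster k) = (0 < k)"
| "basic_atom (CIrr k) = (0 < k)"
| "basic_atom (CRefl k) = (0 < k)"

fun limit_point :: "atom \<Rightarrow> point \<Rightarrow> bool" where
  "limit_point (CIrr k) (A i) = True"
| "limit_point (CRefl k) (A i) = True"
| "limit_point _ _ = False"

section \<open>Order structure of the atomic frames\<close>

lemma CC_simps [simp]: "worlds (CC k r) = CC_worlds k" "acc (CC k r) = CC_acc k r"
  by (simp_all add: CC_def)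

lemma kripke_frame_simps [simp]: "worlds (kripke_frame W R) = W" "acc (kripke_frame W R) = R"
  "internal (kripke_frame W R) = Pow W"
  by (simp_all add: kripke_frame_def)

lemma CC_worlds_simps [simp]: "A i \<in> CC_worlds k \<longleftrightarrow> i < k" "B n \<in> CC_worlds k"
  by (auto simp: CC_worlds_def)

lemma CC_acc_simps [simp]:
  "(A i, y) \<in> CC_acc k r \<longleftrightarrow> i < k \<and> y \<in> CC_worlds k"
  "(B n, A i) \<notin> CC_acc k r"
  "(B n, B m) \<in> CC_acc k r \<longleftrightarrow> m < n \<or> r \<and> m = n"
  by (auto simp: CC_acc_def)

lemma general_frame_kripke: "W \<noteq> {} \<Longrightarrow> R \<subseteq> W \<times> W \<Longrightarrow> general_frame (kripke_frame W R)"
  by (auto simp: general_frame_def dia_set_def)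

lemma general_frame_atom: "basic_atom c \<Longrightarrow> general_frame (atom_frame c)"
  by (cases c) (auto intro!: general_frame_kripke general_frame_CC)

text \<open>Moving up among the points \<open>B n\<close> lowers the index, so the least index
  present gives a maximal point; a set without such points lies inside the cluster of the points
  \<open>A i\<close>.\<close>

lemma CC_noetherian:
  assumes "X \<subseteq> CC_worlds k" "X \<noteq> {}"
  shows "\<exists>x\<in>X. \<forall>y\<in>X. (x, y) \<in> CC_acc k r \<longrightarrow> (y, x) \<in> CC_acc k r"
proof (cases "\<exists>n. B n \<in> X")
  case True
  define n where "n = (LEAST n. B n \<in> X)"
  have "B n \<in> X" "\<And>m. m < n \<Longrightarrow> B m \<notin> X"
    using LeastI_ex[OF True] not_less_Least by (auto simp: n_def)
  moreover have "(y, B n) \<in> CC_acc k r" if "(B n, y) \<in> CC_acc k r" "y \<in> X" for y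
    using that calculation by (cases y) auto
  ultimately show ?thesis by blast
next
  case False
  then have "\<forall>y\<in>X. \<exists>i<k. y = A i" using assms(1) unfolding CC_worlds_def by blast
  then have "(y, x) \<in> CC_acc k r" if "x \<in> X" "y \<in> X" for x y
    using that assms(1) by fastforce
  then show ?thesis using assms(2) by blast
qed

lemma atom_noetherian:
  assumes "basic_atom c" "X \<subseteq> worlds (atom_frame c)" "X \<noteq> {}"
  shows "\<exists>x\<in>X. \<forall>y\<in>X. (x, y) \<in> acc (atom_frame c) \<longrightarrow> (y, x) \<in> acc (atom_frame c)"
  using assms CC_noetherian by (cases c) auto

lemma CC_trans: "trans (CC_acc k r)"
proof (rule transI)
  fix x y z assume "(x, y) \<in> CC_acc k r" "(y, z) \<in> CC_acc k r"
  then show "(x, z) \<in> CC_acc k r" by (cases x; cases y; cases z) auto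
qed

lemma atom_trans: "basic_atom c \<Longrightarrow> trans (acc (atom_frame c))"
  using CC_trans by (cases c) (auto intro: transI)

lemma CC_conn: "x \<in> CC_worlds k \<Longrightarrow> y \<in> CC_worlds k \<Longrightarrow> x = y \<or> (x, y) \<in> CC_acc k r \<or> (y, x) \<in> CC_acc k r"
  by (cases x; cases y) auto

lemma atom_conn:
  "basic_atom c \<Longrightarrow> x \<in> worlds (atom_frame c) \<Longrightarrow> y \<in> worlds (atom_frame c) \<Longrightarrow>
   x = y \<or> (x, y) \<in> acc (atom_frame c) \<or> (y, x) \<in> acc (atom_frame c)"
  using CC_conn by (cases c) auto

lemma atom_cluster_finite:
  assumes "basic_atom c" "\<not> limit_point c x"
  shows "finite {y. (x, y) \<in> acc (atom_frame c) \<and> (y, x) \<in> acc (atom_frame c)}"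
proof -
  have sub: "{y. (B n, y) \<in> CC_acc k r \<and> (y, B n) \<in> CC_acc k r} \<subseteq> {B n}" for n k r
  proof
    fix y assume "y \<in> {y. (B n, y) \<in> CC_acc k r \<and> (y, B n) \<in> CC_acc k r}"
    then show "y \<in> {B n}" by (cases y) auto
  qed
  have "finite {y. (B n, y) \<in> CC_acc k r \<and> (y, B n) \<in> CC_acc k r}" for n k r
    by (rule finite_subset[OF sub]) simp
  moreover have "finite {y. (x, y) \<in> A ` I \<times> A ` I \<and> (y, x) \<in> A ` I \<times> A ` I}" if "finite I" for I
    by (rule finite_subset[of _ "A ` I"]) (use that in auto)
  ultimately show ?thesis using assms by (cases c; cases x) simp_all
qed

lemma atom_limit_point:
  assumes "basic_atom c" "limit_point c x" "x \<in> X" "X \<in> internal (atom_frame c)"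
    and "x \<in> worlds (atom_frame c)"
  shows "\<exists>y\<in>X. (x, y) \<in> acc (atom_frame c) \<and> (y, x) \<notin> acc (atom_frame c)"
proof -
  have "\<exists>y\<in>X. (A i, y) \<in> CC_acc k r \<and> (y, A i) \<notin> CC_acc k r"
    if "X \<in> internal (CC k r)" "A i \<in> X" "i < k" for i k r
    using CC_internal_limit[OF that] that(3) by force
  then show ?thesis using assms by (cases c; cases x) auto
qed

section \<open>Order structure of sums, and finite subreductions\<close>

abbreviation sum_frame :: "atom list \<Rightarrow> (nat \<times> point) gframe" where
  "sum_frame cs \<equiv> ordered_sum_frame (map atom_frame cs)"

lemma general_frame_sum: "\<forall>c\<in>set cs. basic_atom c \<Longrightarrow> cs \<noteq> [] \<Longrightarrow> general_frame (sum_frame cs)"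
  by (rule general_frame_ordered_sum) (auto intro: general_frame_atom)

lemma sum_frame_trans:
  assumes "\<forall>c\<in>set cs. basic_atom c"
  shows "trans (acc (sum_frame cs))"
proof (rule transI)
  fix x y z assume "(x, y) \<in> acc (sum_frame cs)" "(y, z) \<in> acc (sum_frame cs)"
  then show "(x, z) \<in> acc (sum_frame cs)"
    using assms atom_trans by (cases x; cases y; cases z) (auto dest: transD nth_mem)
qed

lemma sum_frame_conn:
  assumes "\<forall>c\<in>set cs. basic_atom c" "x \<in> worlds (sum_frame cs)" "y \<in> worlds (sum_frame cs)"
  shows "x = y \<or> (x, y) \<in> acc (sum_frame cs) \<or> (y, x) \<in> acc (sum_frame cs)"
  using assms atom_conn[of "cs ! fst x" "snd x" "snd y"] nth_mem[of "fst x" cs]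
  by (cases x; cases y) (auto simp: neq_iff)

lemma sum_frame_noetherian:
  assumes cs: "\<forall>c\<in>set cs. basic_atom c" and X: "X \<subseteq> worlds (sum_frame cs)" "X \<noteq> {}"
  shows "\<exists>x\<in>X. \<forall>y\<in>X. (x, y) \<in> acc (sum_frame cs) \<longrightarrow> (y, x) \<in> acc (sum_frame cs)"
proof -
  have "fst ` X \<subseteq> {..<length cs}" using X(1) by auto
  then have fin: "finite (fst ` X)" using finite_subset by blast
  \<comment> \<open>The last summand that \<open>X\<close> meets.\<close>
  define j where "j = Max (fst ` X)"
  have j: "j \<in> fst ` X" "\<And>x. x \<in> X \<Longrightarrow> fst x \<le> j" using fin X(2) by (auto simp: j_def)
  let ?Y = "{p. (j, p) \<in> X}"
  have jl: "j < length cs" using j(1) \<open>fst ` X \<subseteq> _\<close> by auto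
  have "?Y \<subseteq> worlds (atom_frame (cs ! j))" "?Y \<noteq> {}" using X(1) j(1) jl by auto
  then obtain p where p: "(j, p) \<in> X"
    "\<And>q. (j, q) \<in> X \<Longrightarrow> (p, q) \<in> acc (atom_frame (cs ! j)) \<Longrightarrow> (q, p) \<in> acc (atom_frame (cs ! j))"
    using atom_noetherian[of "cs ! j" ?Y] cs jl nth_mem by auto
  have "(y, (j, p)) \<in> acc (sum_frame cs)" if "y \<in> X" "((j, p), y) \<in> acc (sum_frame cs)" for y
    using that p j(2)[OF that(1)] jl by (cases y) auto
  then show ?thesis using p(1) by blast
qed

text \<open>From a refutation of a canonical formula only the maximal points of the preimages are kept.
  None of them is a limit point \<open>a\<^sub>i\<close>, because every internal set containing \<open>a\<^sub>i\<close> contains some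
  \<open>b\<^sub>n\<close>.\<close>

lemma sum_frame_finite_subreduction:
  assumes cs: "\<forall>c\<in>set cs. basic_atom c" and v: "\<And>p. v p \<in> internal (sum_frame cs)"
    and x: "x \<in> worlds (sum_frame cs)"
    and refuted: "\<not> sat (sum_frame cs, v) x (canonical_fm n G)"
  obtains D d0 t and f :: "nat \<times> point \<Rightarrow> nat" where "finite D" "D \<subseteq> worlds (sum_frame cs)"
    "\<And>j p. (j, p) \<in> D \<Longrightarrow> \<not> limit_point (cs ! j) p"
    "d0 \<in> D" "f d0 = 0" "\<And>d. d \<in> D \<Longrightarrow> d = d0 \<or> (d0, d) \<in> acc (sum_frame cs)"
    "\<And>d. d \<in> D \<Longrightarrow> f d \<le> n"
    "\<And>d d'. d \<in> D \<Longrightarrow> d' \<in> D \<Longrightarrow> (d, d') \<in> acc (sum_frame cs) \<Longrightarrow> (f d, f d') \<in> G"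
    "\<And>d j. d \<in> D \<Longrightarrow> j \<le> n \<Longrightarrow> (f d, j) \<in> G \<Longrightarrow> \<exists>d'\<in>D. (d, d') \<in> acc (sum_frame cs) \<and> f d' = j"
    "t \<in> D" "Suc (fst t) = length cs"
proof -
  let ?F = "sum_frame cs" let ?R = "acc ?F"
  have ne: "cs \<noteq> []" using x by (cases x) auto
  have basic: "basic_atom (cs ! j)" if "j < length cs" for j using cs that by simp
  note gf = general_frame_sum[OF cs ne]
  have RW: "y \<in> worlds ?F" "z \<in> worlds ?F" if "(y, z) \<in> ?R" for y z
    using gf that unfolding general_frame_def by blast+
  note tr = transD[OF sum_frame_trans[OF cs]]
  define U where "U = {y. y = x \<or> (x, y) \<in> ?R}"
  have UW: "y \<in> worlds ?F" if "y \<in> U" for y using that x RW(2)[of x y] unfolding U_def by blast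
  have U_up: "z \<in> U" if "y \<in> U" "(y, z) \<in> ?R" for y z using that tr unfolding U_def by blast
  have x0: "x \<notin> v 0" and sub: "subreduction n G ?R U v"
    using refuted unfolding sat_canonical_fm U_def by auto
  have ex: "\<exists>z. (y, z) \<in> ?R \<and> z \<notin> v j" if "i \<le> n" "j \<le> n" "(i, j) \<in> G" "y \<in> U" "y \<notin> v i" for i j y
    using sub that unfolding subreduction_def by blast
  have only: "z \<in> v j" if "i \<le> n" "j \<le> n" "(i, j) \<notin> G" "y \<in> U" "y \<notin> v i" "(y, z) \<in> ?R" for i j y z
    using sub that unfolding subreduction_def by blast
  have excl: "i = j" if "i \<le> n" "j \<le> n" "y \<in> U" "y \<notin> v i" "y \<notin> v j" for i j y
    using sub that unfolding subreduction_def by blast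
  have cof: "\<exists>i\<le>n. \<exists>z. (z = y \<or> (y, z) \<in> ?R) \<and> z \<notin> v i" if "y \<in> U" for y
    using sub that unfolding subreduction_def by blast
  define M where "M i = {y \<in> U. y \<notin> v i \<and> (\<forall>z. (y, z) \<in> ?R \<longrightarrow> z \<notin> v i \<longrightarrow> (z, y) \<in> ?R)}" for i
  have MU: "M i \<subseteq> U" and Mv: "d \<in> M i \<Longrightarrow> d \<notin> v i"
    and M_max: "d \<in> M i \<Longrightarrow> (d, z) \<in> ?R \<Longrightarrow> z \<notin> v i \<Longrightarrow> (z, d) \<in> ?R" for i d z
    unfolding M_def by blast+
  have M_above: "\<exists>z\<in>M i. z = y \<or> (y, z) \<in> ?R" if y: "y \<in> U" "y \<notin> v i" for i y
  proof -
    let ?X = "{z. (z = y \<or> (y, z) \<in> ?R) \<and> z \<notin> v i}"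
    have X: "?X \<subseteq> worlds ?F" "?X \<noteq> {}" using y UW[OF y(1)] RW(2)[of y] by blast+
    obtain z where z: "z \<in> ?X" "\<forall>z'\<in>?X. (z, z') \<in> ?R \<longrightarrow> (z', z) \<in> ?R"
      using sum_frame_noetherian[OF cs X] by blast
    have "z' \<in> ?X" if "(z, z') \<in> ?R" "z' \<notin> v i" for z' using z(1) that tr by blast
    then have "z \<in> M i" using z U_up[OF y(1), of z] y(1) unfolding M_def by blast
    then show ?thesis using z(1) by blast
  qed
  have no_limit: "\<not> limit_point (cs ! j) p" if jp: "(j, p) \<in> M i" for j p i
  proof
    assume lim: "limit_point (cs ! j) p"
    have jw0: "(j, p) \<in> worlds ?F" using jp MU UW by blast
    then have jw: "j < length cs" "p \<in> worlds (atom_frame (cs ! j))" by auto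
    have "worlds ?F - v i \<in> internal ?F" using gf v by (simp add: general_frame_def)
    then have "{q. (j, q) \<in> worlds ?F - v i} \<in> internal (map atom_frame cs ! j)"
      using jw(1) general_frame_atom cs by (subst (asm) ordered_sum_frame_internal) auto
    then obtain q where "(j, q) \<in> worlds ?F - v i"
      "(p, q) \<in> acc (atom_frame (cs ! j))" "(q, p) \<notin> acc (atom_frame (cs ! j))"
      using atom_limit_point[OF basic[OF jw(1)] lim, of "{q. (j, q) \<in> worlds ?F - v i}"] Mv[OF jp] jw0 jw
      by auto
    then show False using M_max[OF jp, of "(j, q)"] jw by auto
  qed
  \<comment> \<open>By linearity two points of \<open>M i\<close> are equal or in one cluster, and
    the cluster of a point that is not a limit point is finite.\<close>
  have "finite (M i)" for i
  proof (cases "M i = {}")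
    case False
    then obtain d where d: "d \<in> M i" by blast
    obtain j p where jp: "d = (j, p)" by (cases d)
    let ?C = "{q. (p, q) \<in> acc (atom_frame (cs ! j)) \<and> (q, p) \<in> acc (atom_frame (cs ! j))}"
    have "d \<in> worlds ?F" using d MU UW by blast
    then have jl: "j < length cs" using jp by simp
    have "M i \<subseteq> insert d (Pair j ` ?C)"
    proof
      fix y assume y: "y \<in> M i"
      have "y = d \<or> (y, d) \<in> ?R \<or> (d, y) \<in> ?R"
        using sum_frame_conn[OF cs UW UW, of y d] y d MU[of i] by blast
      then have "y = d \<or> (y, d) \<in> ?R \<and> (d, y) \<in> ?R" using y d Mv M_max by blast
      then show "y \<in> insert d (Pair j ` ?C)" using jp by (cases y) auto
    qed
    moreover have "finite ?C" using atom_cluster_finite[OF basic[OF jl]] no_limit d jp by blast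
    ultimately show ?thesis by (auto intro: finite_subset)
  qed simp
  then have fin: "finite (\<Union>i\<le>n. M i)" by blast
  obtain d0 where d0: "d0 \<in> M 0" using M_above[of x 0] x0 by (auto simp: U_def)
  have d0U: "d0 \<in> U" using d0 MU by blast
  define D where "D = {d \<in> \<Union>i\<le>n. M i. d = d0 \<or> (d0, d) \<in> ?R}"
  define f where "f d = (SOME i. i \<le> n \<and> d \<notin> v i)" for d
  have f_eq: "f d = i" if "d \<in> M i" "i \<le> n" for d i
    unfolding f_def
  proof (rule some_equality)
    show "i \<le> n \<and> d \<notin> v i" using that Mv by blast
    show "j = i" if "j \<le> n \<and> d \<notin> v j" for j
      using excl[of j i d] that Mv[OF \<open>d \<in> M i\<close>] MU[of i] \<open>d \<in> M i\<close> \<open>i \<le> n\<close> by blast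
  qed
  have D_M: "d \<in> M (f d)" "f d \<le> n" if "d \<in> D" for d
  proof -
    obtain i where "i \<le> n" "d \<in> M i" using \<open>d \<in> D\<close> unfolding D_def by blast
    then show "d \<in> M (f d)" "f d \<le> n" using f_eq by simp_all
  qed
  have D_above: "\<exists>d'\<in>D. (d' = y \<or> (y, d') \<in> ?R) \<and> f d' = i"
    if y: "y = d0 \<or> (d0, y) \<in> ?R" and yv: "y \<notin> v i" and "i \<le> n" for y i
  proof -
    have "y \<in> U" using y d0U U_up by blast
    then obtain z where "z \<in> M i" "z = y \<or> (y, z) \<in> ?R" using M_above yv by blast
    moreover from this have "z \<in> D" using y \<open>i \<le> n\<close> tr unfolding D_def by blast
    ultimately show ?thesis using f_eq \<open>i \<le> n\<close> by blast
  qed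
  \<comment> \<open>Cofinality is applied to a point of the last summand: the refuted variable it
    yields, and the maximal point chosen above, remain in that summand. This provides
    \<open>t\<close>.\<close>
  have last: "\<exists>p. (length cs - 1, p) = d0 \<or> (d0, (length cs - 1, p)) \<in> ?R"
  proof -
    obtain j p where jp: "d0 = (j, p)" by (cases d0)
    have "worlds (atom_frame (cs ! (length cs - 1))) \<noteq> {}"
      using general_frame_atom[OF basic[of "length cs - 1"]] ne by (auto simp: general_frame_def)
    then obtain q where q: "q \<in> worlds (atom_frame (cs ! (length cs - 1)))" by blast
    have "j < length cs" "p \<in> worlds (atom_frame (cs ! j))" using UW[OF d0U] jp by auto
    then show ?thesis using jp q ne by (cases "j = length cs - 1") auto
  qed
  then obtain p where p: "(length cs - 1, p) = d0 \<or> (d0, (length cs - 1, p)) \<in> ?R" ..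
  have "(length cs - 1, p) \<in> U" using p d0U U_up by blast
  then obtain i z where iz: "i \<le> n" "z = (length cs - 1, p) \<or> ((length cs - 1, p), z) \<in> ?R" "z \<notin> v i"
    using cof by blast
  have "z = d0 \<or> (d0, z) \<in> ?R" using iz(2) p tr by blast
  from D_above[OF this iz(3,1)] obtain t where t: "t \<in> D" "t = z \<or> (z, t) \<in> ?R" by blast
  have "Suc (fst t) = length cs" using t iz(2) UW MU ne
    by (cases t; cases z) (auto simp: D_def)
  show thesis
  proof (rule that[of D d0 f t])
    show "finite D" using fin by (simp add: D_def)
    show "D \<subseteq> worlds ?F" using MU UW unfolding D_def by blast
    show "\<not> limit_point (cs ! j) p" if "(j, p) \<in> D" for j p using D_M[OF that] no_limit by blast
    show "d0 \<in> D" "f d0 = 0" using d0 f_eq by (auto simp: D_def)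
    show "d = d0 \<or> (d0, d) \<in> ?R" if "d \<in> D" for d using that unfolding D_def by blast
    show "f d \<le> n" if "d \<in> D" for d using D_M[OF that] by simp
    show "(f d, f d') \<in> G" if "d \<in> D" "d' \<in> D" "(d, d') \<in> ?R" for d d'
      using only[of "f d" "f d'" d d'] D_M[OF that(1)] D_M[OF that(2)] that(3) MU Mv by blast
    show "\<exists>d'\<in>D. (d, d') \<in> ?R \<and> f d' = j" if d: "d \<in> D" "j \<le> n" "(f d, j) \<in> G" for d j
    proof -
      have "d \<in> U" "d \<notin> v (f d)" using D_M[OF d(1)] MU Mv by blast+
      then obtain z where z: "(d, z) \<in> ?R" "z \<notin> v j" using ex[OF D_M(2)[OF d(1)] d(2,3)] by blast
      have "z = d0 \<or> (d0, z) \<in> ?R" using z(1) d(1) tr unfolding D_def by blast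
      from D_above[OF this z(2) d(2)] z(1) show ?thesis using tr by blast
    qed
  qed fact+
qed

section \<open>Pieces\<close>

text \<open>A piece stands for a summand: \<open>p_pts\<close> lists the points of the canonical model that
  label the points \<open>a\<^sub>i\<close> of the frame \<open>p_atom\<close>, and \<open>p_lim\<close> says that these are not definable.\<close>

record piece =
  p_atom :: atom
  p_lim :: bool
  p_pts :: "fm set list"

text \<open>Labels depend on the residue of \<open>n\<close> just as the sets \<open>CC_X\<close>
  do, which makes every variable true on a union of these sets.\<close>

fun label :: "'a list \<Rightarrow> point \<Rightarrow> 'a" where
  "label xs (A i) = xs ! i"
| "label xs (B n) = xs ! (n mod length xs)"

definition piece_model :: "piece \<Rightarrow> point model" where
  "piece_model p = (atom_frame (p_atom p),
     \<lambda>v. {y \<in> worlds (atom_frame (p_atom p)). Var v \<in> label (p_pts p) y})"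

definition sum_model :: "piece list \<Rightarrow> (nat \<times> point) model" where
  "sum_model ps = ordered_sum (map piece_model ps)"

definition rho :: "piece list \<Rightarrow> nat \<times> point \<Rightarrow> fm set" where
  "rho ps u = label (p_pts (ps ! fst u)) (snd u)"

abbreviation pieces_frame :: "piece list \<Rightarrow> (nat \<times> point) gframe" where
  "pieces_frame ps \<equiv> sum_frame (map p_atom ps)"

lemma pieces_frame_simps [simp]:
  "(i, x) \<in> worlds (ordered_sum_frame (map (atom_frame \<circ> p_atom) ps)) \<longleftrightarrow>
     i < length ps \<and> x \<in> worlds (atom_frame (p_atom (ps ! i)))"
  "((i, x), (j, y)) \<in> acc (ordered_sum_frame (map (atom_frame \<circ> p_atom) ps)) \<longleftrightarrow>
     i < length ps \<and> j < length ps \<and>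
     x \<in> worlds (atom_frame (p_atom (ps ! i))) \<and> y \<in> worlds (atom_frame (p_atom (ps ! j))) \<and>
     (i < j \<or> i = j \<and> (x, y) \<in> acc (atom_frame (p_atom (ps ! i))))"
  by auto

lemma fst_sum_model [simp]: "fst (sum_model ps) = pieces_frame ps"
  by (simp add: sum_model_def ordered_sum_def piece_model_def comp_def)

lemma snd_sum_model: "u \<in> snd (sum_model ps) v \<longleftrightarrow> u \<in> worlds (pieces_frame ps) \<and> Var v \<in> rho ps u"
  by (cases u) (auto simp: sum_model_def ordered_sum_def piece_model_def rho_def intro!: bexI[of _ "fst u"])

definition is_CC :: "atom \<Rightarrow> bool" where
  "is_CC c \<longleftrightarrow> (\<exists>k. c = CIrr k \<or> c = CRefl k)"

text \<open>The first summand may consist of a single copy of a non-definable root; it is the only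
  piece with \<open>p_lim\<close> that is not based on a frame \<open>\<CC>(k, \<ast>)\<close>.\<close>

definition root_piece :: "piece \<Rightarrow> bool" where
  "root_piece p \<longleftrightarrow> p_lim p \<and> \<not> is_CC (p_atom p)"

section \<open>Well-formed sequences of pieces and their embedding\<close>

context K43_theory
begin

text \<open>The one-point alternative in the limit case takes its reflexivity from the approximating
  definable points and not from the labelling point, which is always reflexive: a refutation using
  this summand is carried to one of the approximating points.\<close>

definition ok_piece :: "piece \<Rightarrow> bool" where
  "ok_piece p \<longleftrightarrow> p_pts p \<noteq> [] \<and> distinct (p_pts p) \<and> (\<forall>x\<in>set (p_pts p). mcs x) \<and>
     (if p_lim p then
        (\<forall>x\<in>set (p_pts p). \<not> definable x) \<and>
        (\<forall>x\<in>set (p_pts p). \<forall>y\<in>set (p_pts p). x \<leadsto> y) \<and>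
        (\<exists>r. (\<forall>x\<in>set (p_pts p). approx r x) \<and>
             (p_atom p = (if r then CRefl else CIrr) (length (p_pts p)) \<or>
              length (p_pts p) = 1 \<and> p_atom p = (if r then Cluster 1 else Chain 1)))
      else
        (\<forall>x\<in>set (p_pts p). definable x) \<and>
        (p_atom p = Cluster (length (p_pts p)) \<and> (\<forall>x\<in>set (p_pts p). \<forall>y\<in>set (p_pts p). x \<leadsto> y) \<or>
         p_atom p = Chain 1 \<and> length (p_pts p) = 1 \<and> (\<forall>x\<in>set (p_pts p). \<not> x \<leadsto> x)))"

text \<open>Edges back are tolerated only from a limit piece to a root piece: a non-definable root
  may share its cluster with points chosen for \<open>\<sigma>\<close>-theories, and the cluster is
  then spread over two summands.\<close>

definition rel_piece :: "piece \<Rightarrow> piece \<Rightarrow> bool" where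
  "rel_piece q p \<longleftrightarrow>
     (\<forall>x\<in>set (p_pts q). \<forall>y\<in>set (p_pts p). x \<leadsto> y \<and> (y \<leadsto> x \<longrightarrow> p_lim p \<and> root_piece q))"

text \<open>The clauses about the last piece provide cofinality: it is embedded by its own labels,
  and these are final points.\<close>

definition ok_pieces :: "piece list \<Rightarrow> bool" where
  "ok_pieces ps \<longleftrightarrow> ps \<noteq> [] \<and> (\<forall>p\<in>set ps. ok_piece p) \<and> sorted_wrt rel_piece ps \<and>
     \<not> p_lim (last ps) \<and> (\<forall>x\<in>set (p_pts (last ps)). \<forall>y. x \<leadsto> y \<longrightarrow> y \<leadsto> x)"

lemma ok_piece_basic: "ok_piece p \<Longrightarrow> basic_atom (p_atom p)"
  by (auto simp: ok_piece_def split: if_splits)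

lemma ok_piece_label:
  assumes "ok_piece p" "y \<in> worlds (atom_frame (p_atom p))"
  shows "label (p_pts p) y \<in> set (p_pts p)"
proof -
  have "p_pts p \<noteq> []" using assms(1) by (simp add: ok_piece_def)
  then show ?thesis
    using assms by (cases y) (auto simp: ok_piece_def split: if_splits)
qed

lemma ok_piece_acc:
  assumes "ok_piece p" "(y, z) \<in> acc (atom_frame (p_atom p))"
  shows "\<forall>x\<in>set (p_pts p). \<forall>x'\<in>set (p_pts p). x \<leadsto> x'"
  using assms by (auto simp: ok_piece_def split: if_splits)

text \<open>Only this direction holds throughout: the label of \<open>B n\<close> sees the labels of
  the points \<open>A i\<close> of its piece, while \<open>B n\<close> does not see these
  points.\<close>

lemma rho_mono:
  assumes ps: "ok_pieces ps" and acc: "(u, w) \<in> acc (pieces_frame ps)"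
  shows "rho ps u \<leadsto> rho ps w"
proof -
  obtain i y j z where uw: "u = (i, y)" "w = (j, z)" by (cases u; cases w)
  have ok: "ok_piece (ps ! l)" if "l < length ps" for l using ps that by (simp add: ok_pieces_def)
  have *: "i < length ps" "j < length ps" "y \<in> worlds (atom_frame (p_atom (ps ! i)))"
    "z \<in> worlds (atom_frame (p_atom (ps ! j)))" "i < j \<or> i = j \<and> (y, z) \<in> acc (atom_frame (p_atom (ps ! i)))"
    using acc uw by auto
  have r: "rho ps u \<in> set (p_pts (ps ! i))" "rho ps w \<in> set (p_pts (ps ! j))"
    using * ok_piece_label ok uw by (auto simp: rho_def)
  show ?thesis
  proof (cases "i < j")
    case True
    then have "rel_piece (ps ! i) (ps ! j)"
      using ps *(2) sorted_wrt_nth_less unfolding ok_pieces_def by blast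
    then show ?thesis using r by (auto simp: rel_piece_def)
  next
    case False
    then show ?thesis using r * ok_piece_acc[OF ok] by auto
  qed
qed

text \<open>\<open>V\<close> is to hold the images of the later pieces. Without \<open>p_lim\<close>
  the labels themselves are an embedding; with it, the points of \<open>D\<close> go to a descending
  chain strictly between the cluster and \<open>V\<close>.\<close>

lemma embed_piece:
  assumes p: "ok_piece p" and D: "finite D" "D \<subseteq> worlds (atom_frame (p_atom p))"
    and nolim: "\<And>y. y \<in> D \<Longrightarrow> \<not> limit_point (p_atom p) y"
    and V: "finite V" "\<And>x v. x \<in> set (p_pts p) \<Longrightarrow> v \<in> V \<Longrightarrow> x \<prec> v"
  shows "\<exists>e. (\<forall>y\<in>D. definable (e y)) \<and> inj_on e D \<and>
    (\<forall>y\<in>D. \<forall>z\<in>D. (y, z) \<in> acc (atom_frame (p_atom p)) \<longleftrightarrow> e y \<leadsto> e z) \<and>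
    (\<forall>y\<in>D. \<forall>v\<in>V. e y \<prec> v) \<and>
    (\<forall>y\<in>D. if p_lim p then \<forall>x\<in>set (p_pts p). x \<prec> e y else e y = label (p_pts p) y)"
proof (cases "p_lim p")
  case False
  let ?xs = "p_pts p"
  have pD: "\<And>x. x \<in> set ?xs \<Longrightarrow> definable x" "distinct ?xs"
    using p False by (auto simp: ok_piece_def)
  have "p_atom p = Cluster (length ?xs) \<and> (\<forall>x\<in>set ?xs. \<forall>y\<in>set ?xs. x \<leadsto> y) \<or>
         p_atom p = Chain 1 \<and> length ?xs = 1 \<and> (\<forall>x\<in>set ?xs. \<not> x \<leadsto> x)"
    using p False by (simp add: ok_piece_def)
  then have *: "D \<subseteq> A ` {..<length ?xs} \<and>
    (\<forall>y\<in>D. \<forall>z\<in>D. (y, z) \<in> acc (atom_frame (p_atom p)) \<longleftrightarrow> label ?xs y \<leadsto> label ?xs z)"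
  proof
    assume c: "p_atom p = Cluster (length ?xs) \<and> (\<forall>x\<in>set ?xs. \<forall>y\<in>set ?xs. x \<leadsto> y)"
    then have 1: "D \<subseteq> A ` {..<length ?xs}" using D by simp
    have "(y, z) \<in> acc (atom_frame (p_atom p)) \<longleftrightarrow> label ?xs y \<leadsto> label ?xs z" if yz: "y \<in> D" "z \<in> D" for y z
    proof -
      obtain i j where "y = A i" "z = A j" "i < length ?xs" "j < length ?xs" using 1 yz by blast
      then show ?thesis using c by simp
    qed
    then show ?thesis using 1 by blast
  next
    assume c: "p_atom p = Chain 1 \<and> length ?xs = 1 \<and> (\<forall>x\<in>set ?xs. \<not> x \<leadsto> x)"
    then have 1: "D \<subseteq> {A 0}" using D by auto
    have nr: "\<not> ?xs ! 0 \<leadsto> ?xs ! 0" using c by (metis less_one nth_mem)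
    have "(y, z) \<in> acc (atom_frame (p_atom p)) \<longleftrightarrow> label ?xs y \<leadsto> label ?xs z" if yz: "y \<in> D" "z \<in> D" for y z
    proof -
      have "y = A 0" "z = A 0" using 1 yz by blast+
      then show ?thesis using c nr by simp
    qed
    then show ?thesis using 1 c by auto
  qed
  have "inj_on (label ?xs) D"
  proof (rule inj_onI)
    fix y z assume yz: "y \<in> D" "z \<in> D" "label ?xs y = label ?xs z"
    then obtain i j where "y = A i" "z = A j" "i < length ?xs" "j < length ?xs" using * by blast
    then show "y = z" using yz(3) pD(2) by (simp add: nth_eq_iff_index_eq)
  qed
  moreover have "label ?xs y \<in> set ?xs" if "y \<in> D" for y using that * by auto
  ultimately show ?thesis using False * pD V by (intro exI[of _ "label ?xs"]) simp
next
  case True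
  let ?xs = "p_pts p"
  obtain r where r: "\<forall>x\<in>set ?xs. approx r x" and at: "p_atom p = (if r then CRefl else CIrr) (length ?xs) \<or>
              length ?xs = 1 \<and> p_atom p = (if r then Cluster 1 else Chain 1)"
    using p True by (auto simp: ok_piece_def)
  have x: "hd ?xs \<in> set ?xs" "\<And>x. x \<in> set ?xs \<Longrightarrow> x \<leadsto> hd ?xs"
    using p True by (auto simp: ok_piece_def)
  define idx where "idx y = (case y of A i \<Rightarrow> i | B n \<Rightarrow> n)" for y
  \<comment> \<open>The inserted 0 covers the case of empty \<open>D\<close>.\<close>
  define N where "N = Suc (Max (insert 0 (idx ` D)))"
  have N: "idx y < N" if "y \<in> D" for y using D(1) that by (auto simp: N_def le_imp_less_Suc)
  obtain z :: "nat \<Rightarrow> fm set" where z: "\<And>n. n < N \<Longrightarrow> hd ?xs \<prec> z n" "\<And>n. n < N \<Longrightarrow> definable (z n)"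
    "\<And>n. n < N \<Longrightarrow> z n \<leadsto> z n \<longleftrightarrow> r" "\<And>n v. n < N \<Longrightarrow> v \<in> V \<Longrightarrow> z n \<prec> v"
    "\<And>n m. n < N \<Longrightarrow> m < n \<Longrightarrow> z n \<prec> z m"
    using approx_descending[of r "hd ?xs" V N] r x(1) V by blast
  have zz: "z n \<leadsto> z m \<longleftrightarrow> m < n \<or> r \<and> m = n" if "n < N" "m < N" for n m
    using z(3)[OF that(1)] z(5)[OF that(1), of m] z(5)[OF that(2), of n]
    by (cases n m rule: linorder_cases) (auto simp: strict_def)
  have inj: "n = m" if "n < N" "m < N" "z n = z m" for n m
    using z(5)[OF that(1), of m] z(5)[OF that(2), of n] that(3)
    by (cases n m rule: linorder_cases) (auto simp: strict_def)
  \<comment> \<open>Since \<open>D\<close> avoids limit points, it consists of points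
    \<open>B n\<close>, or else the piece is a root piece and its only point is
    \<open>A 0\<close>.\<close>
  have form: "(\<forall>y\<in>D. \<exists>n. y = B n \<and> p_atom p = (if r then CRefl else CIrr) (length ?xs)) \<or>
      (\<forall>y\<in>D. y = A 0 \<and> p_atom p = (if r then Cluster 1 else Chain 1))"
  proof (cases "p_atom p = (if r then CRefl else CIrr) (length ?xs)")
    case True
    have "\<exists>n. y = B n" if "y \<in> D" for y
      using nolim[OF that] True by (cases y) (auto split: if_splits)
    then show ?thesis using True by blast
  next
    case False
    then show ?thesis using at D(2) by (auto split: if_splits)
  qed
  have acc: "(y, y') \<in> acc (atom_frame (p_atom p)) \<longleftrightarrow> z (idx y) \<leadsto> z (idx y')" if "y \<in> D" "y' \<in> D" for y y'
    using form
  proof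
    assume "\<forall>y\<in>D. \<exists>n. y = B n \<and> p_atom p = (if r then CRefl else CIrr) (length ?xs)"
    then obtain n m where "y = B n" "y' = B m" "p_atom p = (if r then CRefl else CIrr) (length ?xs)"
      using \<open>y \<in> D\<close> \<open>y' \<in> D\<close> by blast
    then show ?thesis using zz N[OF \<open>y \<in> D\<close>] N[OF \<open>y' \<in> D\<close>] by (auto simp: idx_def)
  next
    assume "\<forall>y\<in>D. y = A 0 \<and> p_atom p = (if r then Cluster 1 else Chain 1)"
    then have "y = A 0" "y' = A 0" "p_atom p = (if r then Cluster 1 else Chain 1)" using that by blast+
    then show ?thesis using zz[of 0 0] N[OF \<open>y \<in> D\<close>] by (auto simp: idx_def)
  qed
  have "inj_on (\<lambda>y. z (idx y)) D"
  proof (rule inj_onI)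
    fix y y' assume y: "y \<in> D" "y' \<in> D" "z (idx y) = z (idx y')"
    then have i: "idx y = idx y'" using inj N by blast
    show "y = y'" using form
    proof
      assume "\<forall>y\<in>D. \<exists>n. y = B n \<and> p_atom p = (if r then CRefl else CIrr) (length ?xs)"
      then obtain n m where "y = B n" "y' = B m" using y by blast
      then show ?thesis using i by (simp add: idx_def)
    next
      assume *: "\<forall>y\<in>D. y = A 0 \<and> p_atom p = (if r then Cluster 1 else Chain 1)"
      have "y = A 0" "y' = A 0" using bspec[OF * y(1)] bspec[OF * y(2)] by simp_all
      then show ?thesis by simp
    qed
  qed
  moreover have "x \<prec> z (idx y)" if "x \<in> set ?xs" "y \<in> D" for x y
    using rel_strict_trans[OF x(2)[OF that(1)] z(1)[OF N[OF that(2)]]] .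
  ultimately show ?thesis
    using True acc z(2,4) N by (intro exI[of _ "\<lambda>y. z (idx y)"]) simp
qed

text \<open>By induction from the last piece to the first: the points \<open>b\<^sub>n\<close> of a limit piece are sent to a
  descending chain of definable points, squeezed between its cluster and the images of the later
  pieces.\<close>

lemma embed_pieces:
  assumes "\<forall>p\<in>set ps. ok_piece p" "sorted_wrt rel_piece ps"
    and "finite D" "D \<subseteq> worlds (pieces_frame ps)"
    and "\<And>j y. (j, y) \<in> D \<Longrightarrow> \<not> limit_point (p_atom (ps ! j)) y"
  shows "\<exists>e. (\<forall>u\<in>D. definable (e u)) \<and> inj_on e D \<and>
    (\<forall>u\<in>D. \<forall>w\<in>D. (u, w) \<in> acc (pieces_frame ps) \<longleftrightarrow> e u \<leadsto> e w) \<and>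
    (\<forall>x. (\<forall>p\<in>set ps. \<forall>y\<in>set (p_pts p). x \<leadsto> y \<and> (\<not> p_lim p \<longrightarrow> \<not> y \<leadsto> x)) \<longrightarrow> (\<forall>u\<in>D. x \<prec> e u)) \<and>
    (\<forall>(j, y)\<in>D. \<not> p_lim (ps ! j) \<longrightarrow> e (j, y) = label (p_pts (ps ! j)) y)"
  using assms
proof (induction ps arbitrary: D)
  case Nil
  then have "D = {}" by (auto simp: ordered_sum_frame_def)
  then show ?case by auto
next
  case (Cons p ps)
  define D' where "D' = {(j, y). (Suc j, y) \<in> D}"
  define D0 where "D0 = {y. (0, y) \<in> D}"
  have p: "ok_piece p" and rel: "\<And>q. q \<in> set ps \<Longrightarrow> rel_piece p q" using Cons.prems(1,2) by auto
  have "finite ((\<lambda>(j, y). (j - 1, y)) ` D)" "finite (snd ` D)" using Cons.prems(3) by auto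
  moreover have "D' \<subseteq> (\<lambda>(j, y). (j - 1, y)) ` D" "D0 \<subseteq> snd ` D"
    by (force simp: D'_def D0_def image_iff)+
  ultimately have fin: "finite D'" "finite D0" using finite_subset by blast+
  have sub: "D' \<subseteq> worlds (pieces_frame ps)" "D0 \<subseteq> worlds (atom_frame (p_atom p))"
  proof -
    show "D' \<subseteq> worlds (pieces_frame ps)"
    proof
      fix u assume "u \<in> D'"
      then obtain j y where u: "u = (j, y)" "(Suc j, y) \<in> D" by (auto simp: D'_def)
      then have "(Suc j, y) \<in> worlds (pieces_frame (p # ps))" using Cons.prems(4) by blast
      then show "u \<in> worlds (pieces_frame ps)" using u(1) by auto
    qed
    show "D0 \<subseteq> worlds (atom_frame (p_atom p))"
    proof
      fix y assume "y \<in> D0"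
      then have "(0, y) \<in> worlds (pieces_frame (p # ps))" using Cons.prems(4) by (auto simp: D0_def)
      then show "y \<in> worlds (atom_frame (p_atom p))" by simp
    qed
  qed
  have D'_w: "j < length ps" "y \<in> worlds (atom_frame (p_atom (ps ! j)))" if "(j, y) \<in> D'" for j y
    using subsetD[OF sub(1) that] by auto
  have nl: "\<And>j y. (j, y) \<in> D' \<Longrightarrow> \<not> limit_point (p_atom (ps ! j)) y" "\<And>y. y \<in> D0 \<Longrightarrow> \<not> limit_point (p_atom p) y"
    using Cons.prems(5) by (force simp: D'_def D0_def)+
  have "\<forall>q\<in>set ps. ok_piece q" "sorted_wrt rel_piece ps" using Cons.prems(1,2) by auto
  from Cons.IH[OF this fin(1) sub(1) nl(1)]
  obtain e' where e': "\<And>u. u \<in> D' \<Longrightarrow> definable (e' u)" "inj_on e' D'"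
    "\<And>u w. u \<in> D' \<Longrightarrow> w \<in> D' \<Longrightarrow> (u, w) \<in> acc (pieces_frame ps) \<longleftrightarrow> e' u \<leadsto> e' w"
    "\<And>x u. \<forall>p\<in>set ps. \<forall>y\<in>set (p_pts p). x \<leadsto> y \<and> (\<not> p_lim p \<longrightarrow> \<not> y \<leadsto> x) \<Longrightarrow> u \<in> D' \<Longrightarrow> x \<prec> e' u"
    "\<And>j y. (j, y) \<in> D' \<Longrightarrow> \<not> p_lim (ps ! j) \<Longrightarrow> e' (j, y) = label (p_pts (ps ! j)) y"
    by (smt (verit, best) case_prodD)
  \<comment> \<open>A root piece may share its cluster with a later limit piece, but the images of
    that limit piece lie strictly above the cluster. The clause about \<open>x\<close> in the
    induction hypothesis is made for this.\<close>
  have after: "x \<prec> e' u" if "x \<in> set (p_pts p)" "u \<in> D'" for x u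
    using rel that by (intro e'(4)) (auto simp: rel_piece_def)
  have "finite (e' ` D')" using fin(1) by simp
  from embed_piece[OF p fin(2) sub(2) nl(2) this] after
  obtain e0 where e0: "\<And>y. y \<in> D0 \<Longrightarrow> definable (e0 y)" "inj_on e0 D0"
    "\<And>y z. y \<in> D0 \<Longrightarrow> z \<in> D0 \<Longrightarrow> (y, z) \<in> acc (atom_frame (p_atom p)) \<longleftrightarrow> e0 y \<leadsto> e0 z"
    "\<And>y u. y \<in> D0 \<Longrightarrow> u \<in> D' \<Longrightarrow> e0 y \<prec> e' u"
    "\<And>y. y \<in> D0 \<Longrightarrow> if p_lim p then \<forall>x\<in>set (p_pts p). x \<prec> e0 y else e0 y = label (p_pts p) y"
    by (smt (verit, best) imageE imageI)
  define e where "e u = (case u of (0, y) \<Rightarrow> e0 y | (Suc j, y) \<Rightarrow> e' (j, y))" for u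
  have e_simps [simp]: "e (0, y) = e0 y" "e (Suc j, y) = e' (j, y)" for j y by (simp_all add: e_def)
  have D_cases: "(\<exists>y. u = (0, y) \<and> y \<in> D0) \<or> (\<exists>j y. u = (Suc j, y) \<and> (j, y) \<in> D')" if "u \<in> D" for u
    using that by (cases u; cases "fst u") (auto simp: D0_def D'_def)
  have acc: "(u, w) \<in> acc (pieces_frame (p # ps)) \<longleftrightarrow> e u \<leadsto> e w" if "u \<in> D" "w \<in> D" for u w
    using D_cases[OF that(1)] D_cases[OF that(2)]
  proof (elim disjE exE conjE)
    fix y z assume "u = (0, y)" "y \<in> D0" "w = (0, z)" "z \<in> D0"
    then show ?thesis using e0(3) sub(2) by auto
  next
    fix y j z assume *: "u = (0, y)" "y \<in> D0" "w = (Suc j, z)" "(j, z) \<in> D'"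
    then have "e u \<leadsto> e w" using e0(4) by (auto simp: strict_def)
    then show ?thesis using * sub(2) D'_w[OF *(4)] by auto
  next
    fix j y z assume *: "u = (Suc j, y)" "(j, y) \<in> D'" "w = (0, z)" "z \<in> D0"
    then have "\<not> e u \<leadsto> e w" using e0(4) by (auto simp: strict_def)
    then show ?thesis using * by auto
  next
    fix i y j z assume *: "u = (Suc i, y)" "(i, y) \<in> D'" "w = (Suc j, z)" "(j, z) \<in> D'"
    then show ?thesis using e'(3)[OF *(2,4)] D'_w[OF *(2)] D'_w[OF *(4)] by auto
  qed
  have inj: "inj_on e D"
  proof (rule inj_onI)
    fix u w assume uw: "u \<in> D" "w \<in> D" "e u = e w"
    have ne: "e0 y \<noteq> e' v" if "y \<in> D0" "v \<in> D'" for y v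
      using e0(4)[OF that] by (auto simp: strict_def)
    show "u = w" using D_cases[OF uw(1)] D_cases[OF uw(2)]
    proof (elim disjE exE conjE)
      fix y z assume "u = (0, y)" "y \<in> D0" "w = (0, z)" "z \<in> D0"
      then show ?thesis using uw(3) inj_onD[OF e0(2)] by simp
    next
      fix y j z assume "u = (0, y)" "y \<in> D0" "w = (Suc j, z)" "(j, z) \<in> D'"
      then show ?thesis using uw(3) ne by simp
    next
      fix j y z assume "u = (Suc j, y)" "(j, y) \<in> D'" "w = (0, z)" "z \<in> D0"
      then show ?thesis using uw(3) ne[of z "(j, y)"] by simp
    next
      fix i y j z assume "u = (Suc i, y)" "(i, y) \<in> D'" "w = (Suc j, z)" "(j, z) \<in> D'"
      then show ?thesis using uw(3) inj_onD[OF e'(2), of "(i, y)" "(j, z)"] by simp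
    qed
  qed
  have low: "x \<prec> e u" if x: "\<forall>q\<in>set (p # ps). \<forall>y\<in>set (p_pts q). x \<leadsto> y \<and> (\<not> p_lim q \<longrightarrow> \<not> y \<leadsto> x)"
    and u: "u \<in> D" for x u
    using D_cases[OF u]
  proof (elim disjE exE conjE)
    fix y assume y: "u = (0, y)" "y \<in> D0"
    have l: "label (p_pts p) y \<in> set (p_pts p)" using ok_piece_label[OF p] y sub by blast
    show ?thesis
    proof (cases "p_lim p")
      case True
      then have "label (p_pts p) y \<prec> e0 y" using e0(5)[OF y(2)] l by simp
      then show ?thesis using x l rel_strict_trans[of x] y(1) by auto
    next
      case False
      then show ?thesis using e0(5)[OF y(2)] l x y(1) by (auto simp: strict_def)
    qed
  next
    fix j y assume "u = (Suc j, y)" "(j, y) \<in> D'"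
    then show ?thesis using e'(4)[of x "(j, y)"] x by simp
  qed
  have lab: "e (j, y) = label (p_pts ((p # ps) ! j)) y" if "(j, y) \<in> D" "\<not> p_lim ((p # ps) ! j)" for j y
    using that e0(5)[of y] e'(5) by (cases j) (auto simp: D0_def D'_def)
  have "definable (e u)" if "u \<in> D" for u using D_cases[OF that] e0(1) e'(1) by auto
  then show ?case using acc inj low lab by (intro exI[of _ e]) blast
qed

section \<open>Validity of the canonical formulas and the truth lemma\<close>

lemma general_frame_pieces: "ok_pieces ps \<Longrightarrow> general_frame (pieces_frame ps)"
  by (rule general_frame_sum) (auto simp: ok_pieces_def ok_piece_basic)

lemma valid_canonical_pieces:
  assumes ps: "ok_pieces ps" and nG: "(n, G) \<in> \<G>"
  shows "valid_in (pieces_frame ps) (canonical_fm n G)"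
proof (rule ccontr)
  assume "\<not> ?thesis"
  then obtain v x where v: "\<And>p. v p \<in> internal (pieces_frame ps)" and x: "x \<in> worlds (pieces_frame ps)"
    and refuted: "\<not> sat (pieces_frame ps, v) x (canonical_fm n G)"
    by (auto simp: valid_in_def)
  have basic: "\<forall>c\<in>set (map p_atom ps). basic_atom c"
    using ps by (auto simp: ok_pieces_def ok_piece_basic)
  obtain D d0 t and f :: "nat \<times> point \<Rightarrow> nat" where fin: "finite D" and DW: "D \<subseteq> worlds (pieces_frame ps)"
    and nolim: "\<And>j p. (j, p) \<in> D \<Longrightarrow> \<not> limit_point (map p_atom ps ! j) p"
    and d0: "d0 \<in> D" "f d0 = 0" and above: "\<And>d. d \<in> D \<Longrightarrow> d = d0 \<or> (d0, d) \<in> acc (pieces_frame ps)"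
    and range: "\<And>d. d \<in> D \<Longrightarrow> f d \<le> n"
    and G: "\<And>d d'. d \<in> D \<Longrightarrow> d' \<in> D \<Longrightarrow> (d, d') \<in> acc (pieces_frame ps) \<Longrightarrow> (f d, f d') \<in> G"
      "\<And>d j. d \<in> D \<Longrightarrow> j \<le> n \<Longrightarrow> (f d, j) \<in> G \<Longrightarrow> \<exists>d'\<in>D. (d, d') \<in> acc (pieces_frame ps) \<and> f d' = j"
    and t: "t \<in> D" "Suc (fst t) = length (map p_atom ps)"
    by (rule sum_frame_finite_subreduction[OF basic v x refuted]; rule that)
  have "\<not> limit_point (p_atom (ps ! j)) y" if "(j, y) \<in> D" for j y
    using nolim[OF that] that DW by auto
  then obtain e where e: "\<And>u. u \<in> D \<Longrightarrow> definable (e u)" "inj_on e D"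
    "\<And>u w. u \<in> D \<Longrightarrow> w \<in> D \<Longrightarrow> (u, w) \<in> acc (pieces_frame ps) \<longleftrightarrow> e u \<leadsto> e w"
    "\<And>j y. (j, y) \<in> D \<Longrightarrow> \<not> p_lim (ps ! j) \<Longrightarrow> e (j, y) = label (p_pts (ps ! j)) y"
    using embed_pieces[of ps D] ps fin DW unfolding ok_pieces_def by (smt (verit, best) case_prodD)
  define g where "g x = f (inv_into D e x)" for x
  have g: "g (e u) = f u" if "u \<in> D" for u using that e(2) by (simp add: g_def)
  \<comment> \<open>The last piece is not a limit piece, so \<open>e\<close> keeps its labels, and
    the image of \<open>t\<close> is final in the canonical model.\<close>
  have "e t \<in> set (p_pts (last ps))"
  proof -
    have "ps ! fst t = last ps" using t(2) ps by (cases ps rule: rev_cases) (auto simp: ok_pieces_def)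
    moreover have "snd t \<in> worlds (atom_frame (p_atom (ps ! fst t)))"
      using subsetD[OF DW t(1)] by (cases t) auto
    moreover have "ok_piece (last ps)" "\<not> p_lim (last ps)" using ps by (auto simp: ok_pieces_def)
    ultimately show ?thesis
      using e(4)[of "fst t" "snd t"] t(1) ok_piece_label[of "last ps" "snd t"] by simp
  qed
  then have et: "y \<leadsto> e t" if "e t \<leadsto> y" for y using ps that by (auto simp: ok_pieces_def)
  show False
  proof (rule no_definable_finite_subreduction[OF nG, of "e ` D" "e d0" g "e t"])
    show "\<exists>d'\<in>e ` D. d \<leadsto> d' \<and> g d' = j" if d: "d \<in> e ` D" "j \<le> n" "(g d, j) \<in> G" for d j
    proof -
      obtain u where u: "u \<in> D" "d = e u" using d(1) by blast
      then obtain w where "w \<in> D" "(u, w) \<in> acc (pieces_frame ps)" "f w = j"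
        using G(2)[OF u(1) d(2)] d(3) g by auto
      then show ?thesis using e(3)[OF u(1)] u(2) g by blast
    qed
  qed (use fin e(1) d0 above range G(1) t(1) et e(3) g in auto)
qed

text \<open>Diamonds true in the sum are in the labels by \<open>rho_mono\<close>. The converse is
  \<open>wit\<close>, asked only for diamonds inside \<open>\<phi>\<close>, since only for these
  have witnesses been chosen.\<close>

lemma truth:
  assumes ps: "ok_pieces ps"
    and wit: "\<And>\<psi> u. Dia \<psi> \<in> subfms \<phi> \<Longrightarrow> u \<in> worlds (pieces_frame ps) \<Longrightarrow> Dia \<psi> \<in> rho ps u \<Longrightarrow>
                \<exists>w. (u, w) \<in> acc (pieces_frame ps) \<and> \<psi> \<in> rho ps w"
    and "u \<in> worlds (pieces_frame ps)"
  shows "sat (sum_model ps) u \<phi> \<longleftrightarrow> \<phi> \<in> rho ps u"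
proof -
  have mcs_rho: "mcs (rho ps u)" if "u \<in> worlds (pieces_frame ps)" for u
  proof -
    obtain i y where u: "u = (i, y)" by (cases u)
    then have "i < length ps" "ok_piece (ps ! i)" "y \<in> worlds (atom_frame (p_atom (ps ! i)))"
      using that ps by (auto simp: ok_pieces_def)
    then show ?thesis using ok_piece_label[of "ps ! i" y] u by (auto simp: rho_def ok_piece_def)
  qed
  have W: "w \<in> worlds (pieces_frame ps)" if "(u, w) \<in> acc (pieces_frame ps)" for u w
    using general_frame_pieces[OF ps] that unfolding general_frame_def by blast
  show ?thesis
    using wit assms(3)
  proof (induction \<phi> arbitrary: u)
    case Top
    then show ?case using mcs_BigAnd[OF mcs_rho, of u "[]"] by (simp add: BigAnd_def)
  next
    case Bot
    have "Neg Bot \<in> K" by (rule taut) (simp add: tautology_def)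
    then show ?case using mcs_K[OF mcs_rho[OF Bot(2)]] mcs_Neg[OF mcs_rho[OF Bot(2)]] by auto
  next
    case (Var p)
    then show ?case by (simp add: snd_sum_model)
  next
    case (Neg \<phi>)
    then show ?case using mcs_Neg[OF mcs_rho[OF Neg.prems(2)]] by simp
  next
    case (And \<phi> \<psi>)
    then show ?case using mcs_And[OF mcs_rho[OF And.prems(2)]] by simp
  next
    case (Dia \<phi>)
    have IH: "sat (sum_model ps) w \<phi> \<longleftrightarrow> \<phi> \<in> rho ps w" if "w \<in> worlds (pieces_frame ps)" for w
      using Dia that by simp
    show ?case
    proof
      assume "sat (sum_model ps) u (Dia \<phi>)"
      then obtain w where w: "(u, w) \<in> acc (pieces_frame ps)" "sat (sum_model ps) w \<phi>" by auto
      then show "Dia \<phi> \<in> rho ps u" using IH[OF W[OF w(1)]] rho_mono[OF ps w(1)] rel_Dia by blast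
    next
      assume "Dia \<phi> \<in> rho ps u"
      then obtain w where w: "(u, w) \<in> acc (pieces_frame ps)" "\<phi> \<in> rho ps w"
        using Dia.prems(1)[of \<phi> u] Dia.prems(2) by auto
      then show "sat (sum_model ps) u (Dia \<phi>)"
        using IH[OF W[OF w(1)]] unfolding sat.simps fst_sum_model by blast
    qed
  qed
qed

section \<open>Bisimulation\<close>

lemma rho_in_pts:
  assumes "ok_pieces ps" "(j, y) \<in> worlds (pieces_frame ps)"
  shows "j < length ps" "ok_piece (ps ! j)" "y \<in> worlds (atom_frame (p_atom (ps ! j)))"
    "rho ps (j, y) \<in> set (p_pts (ps ! j))"
proof -
  show *: "j < length ps" "y \<in> worlds (atom_frame (p_atom (ps ! j)))" using assms(2) by auto
  then show "ok_piece (ps ! j)" using assms(1) by (simp add: ok_pieces_def)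
  then show "rho ps (j, y) \<in> set (p_pts (ps ! j))"
    using ok_piece_label * by (simp add: rho_def)
qed

lemma rho_mcs: "ok_pieces ps \<Longrightarrow> u \<in> worlds (pieces_frame ps) \<Longrightarrow> mcs (rho ps u)"
  using rho_in_pts[of ps "fst u" "snd u"] by (cases u) (auto simp: ok_piece_def)

lemma nth_rel_piece: "ok_pieces ps \<Longrightarrow> i < j \<Longrightarrow> j < length ps \<Longrightarrow> rel_piece (ps ! i) (ps ! j)"
  using sorted_wrt_nth_less unfolding ok_pieces_def by blast

lemma ok_piece_B:
  assumes "ok_piece p" "B n \<in> worlds (atom_frame (p_atom p))"
  shows "is_CC (p_atom p)" "p_lim p" "\<not> root_piece p"
  using assms by (auto simp: ok_piece_def is_CC_def root_piece_def split: if_splits)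

lemma ok_piece_lim_iff: "ok_piece p \<Longrightarrow> x \<in> set (p_pts p) \<Longrightarrow> p_lim p \<longleftrightarrow> \<not> definable x"
  by (auto simp: ok_piece_def split: if_splits)

text \<open>A partial converse of \<open>rho_mono\<close>. It has to avoid two situations:
  \<open>t\<close> in a root piece that shares its cluster with a later piece, and \<open>u\<close>
  a point \<open>B n\<close>, which sees too little of its own piece.\<close>

lemma rel_acc:
  assumes ps: "ok_pieces ps" and u: "u \<in> worlds (pieces_frame ps)" and t: "t \<in> worlds (pieces_frame ps)"
    and rel: "rho ps u \<leadsto> rho ps t"
    and t_root: "\<not> root_piece (ps ! fst t)"
    and A: "(\<exists>i. snd u = A i) \<or> \<not> p_lim (ps ! fst t)"
  shows "(u, t) \<in> acc (pieces_frame ps)"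
proof -
  obtain i y j z where ut: "u = (i, y)" "t = (j, z)" by (cases u; cases t)
  note iy = rho_in_pts[OF ps u[unfolded ut(1)]] and jz = rho_in_pts[OF ps t[unfolded ut(2)]]
  have "\<not> j < i"
  proof
    assume "j < i"
    then have "rel_piece (ps ! j) (ps ! i)" using nth_rel_piece[OF ps] iy(1) by blast
    then show False using rel iy(4) jz(4) t_root ut by (auto simp: rel_piece_def)
  qed
  then consider "i < j" | "i = j" by linarith
  then show ?thesis
  proof cases
    case 1
    then show ?thesis using iy jz ut by simp
  next
    case 2
    let ?p = "ps ! j"
    have "(y, z) \<in> acc (atom_frame (p_atom ?p))"
    proof (cases "p_lim ?p")
      case True
      then obtain l where "y = A l" using A ut by auto
      moreover obtain k where "p_atom ?p = CIrr k \<or> p_atom ?p = CRefl k"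
        using True t_root ut by (auto simp: root_piece_def is_CC_def)
      ultimately show ?thesis using iy(3) jz(3) 2 by auto
    next
      case False
      then consider "p_atom ?p = Cluster (length (p_pts ?p))"
        | "length (p_pts ?p) = 1" "\<forall>x\<in>set (p_pts ?p). \<not> x \<leadsto> x"
        using jz(2) by (auto simp: ok_piece_def)
      then show ?thesis
      proof cases
        case 1
        then show ?thesis using iy(3) jz(3) 2 by auto
      next
        case 2
        then obtain x where "set (p_pts ?p) = {x}" by (auto simp: length_Suc_conv)
        then show ?thesis using rel iy(4) jz(4) 2 \<open>i = j\<close> ut by auto
      qed
    qed
    then show ?thesis using 2 iy jz ut by simp
  qed
qed

definition same_cluster :: "fm set \<Rightarrow> fm set \<Rightarrow> bool" where
  "same_cluster x y \<longleftrightarrow> x \<leadsto> y \<and> y \<leadsto> x"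

text \<open>The last clause fixes the order of the points of a limit piece, so that corresponding limit
  pieces of two models are based on the same frame and carry matching labels.\<close>

definition realizes :: "nat set \<Rightarrow> fm set list \<Rightarrow> (fm set \<Rightarrow> fm set) \<Rightarrow> piece list \<Rightarrow> bool" where
  "realizes \<sigma> T xm ps \<longleftrightarrow> ok_pieces ps \<and>
     (\<forall>t\<in>set T. th \<sigma> (xm t) = t \<and> maximal t (xm t)) \<and>
     (\<forall>t\<in>set T. \<exists>j i. (j, A i) \<in> worlds (pieces_frame ps) \<and> \<not> root_piece (ps ! j) \<and>
        rho ps (j, A i) = xm t) \<and>
     (\<forall>u\<in>worlds (pieces_frame ps). th \<sigma> (rho ps u) \<in> set T) \<and>
     (\<forall>u\<in>worlds (pieces_frame ps). \<forall>z. rho ps u \<leadsto> z \<and> th \<sigma> z \<in> set T \<longrightarrow> rho ps u \<leadsto> xm (th \<sigma> z)) \<and>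
     (\<forall>p\<in>set ps. p_lim p \<and> \<not> root_piece p \<longrightarrow>
        (\<exists>ts. ts \<noteq> [] \<and> ts = filter (\<lambda>t. same_cluster (xm t) (xm (hd ts))) T \<and>
              p_pts p = map xm ts \<and>
              p_atom p = (if irr_limit \<sigma> (hd ts) then CIrr else CRefl) (length ts)))"

text \<open>A point \<open>b\<^sub>n\<close> sees only few points of its piece. It may therefore be related only to the
  point with the same index in the corresponding piece.\<close>

definition link :: "nat set \<Rightarrow> fm set list \<Rightarrow> (fm set \<Rightarrow> fm set) \<Rightarrow> (fm set \<Rightarrow> fm set) \<Rightarrow>
    piece list \<Rightarrow> piece list \<Rightarrow> nat \<times> point \<Rightarrow> nat \<times> point \<Rightarrow> bool" where
  "link \<sigma> T xm1 xm2 ps1 ps2 u u' \<longleftrightarrow>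
     u \<in> worlds (pieces_frame ps1) \<and> u' \<in> worlds (pieces_frame ps2) \<and>
     th \<sigma> (rho ps1 u) = th \<sigma> (rho ps2 u') \<and>
     ((\<exists>i. snd u = A i) \<and> (\<exists>i. snd u' = A i) \<or>
      (\<exists>n ts. snd u = B n \<and> snd u' = B n \<and> p_atom (ps1 ! fst u) = p_atom (ps2 ! fst u') \<and>
        set ts \<subseteq> set T \<and> p_pts (ps1 ! fst u) = map xm1 ts \<and> p_pts (ps2 ! fst u') = map xm2 ts))"

lemma link_sym: "link \<sigma> T xm1 xm2 ps1 ps2 u u' \<Longrightarrow> link \<sigma> T xm2 xm1 ps2 ps1 u' u"
  unfolding link_def by metis

text \<open>Let \<open>\<alpha>\<close> in \<open>t\<close> define \<open>x\<close>. If
  \<open>z\<close> above \<open>y\<close> satisfies \<open>\<alpha>\<close>, a point above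
  \<open>x\<close> with the same theory as \<open>z\<close> does too, so it sees \<open>x\<close>.
  Hence \<open>z\<close> sees a point with theory \<open>t\<close>, and that point sees
  \<open>y\<close> by maximality.\<close>

lemma definable_th:
  assumes "maximal t x" "th \<sigma> x = t" "maximal t y" "th \<sigma> y = t" "definable x"
  shows "definable y"
proof -
  have m: "mcs x" "mcs y" using assms by (auto simp: maximal_def)
  obtain \<alpha> where \<alpha>: "\<alpha> \<in> t" "\<And>z. x \<leadsto> z \<Longrightarrow> \<alpha> \<in> z \<Longrightarrow> z \<leadsto> x"
    using maximal_definable_in[OF assms(1) _ assms(5)] conj_closed_th[OF m(1)] assms(2) by metis
  have "z \<leadsto> y" if z: "y \<leadsto> z" "\<alpha> \<in> z" for z
  proof -
    obtain z' where z': "x \<leadsto> z'" "th \<sigma> z' = th \<sigma> z" using th_forth[OF m(1) _ z(1)] assms by metis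
    have "\<alpha> \<in> th \<sigma> z" using z(2) \<alpha>(1) assms(2) by (auto simp: th_def)
    then have "\<alpha> \<in> z'" using z'(2) by (auto simp: th_def)
    then have "z' \<leadsto> x" using \<alpha>(2) z'(1) by blast
    then obtain w where w: "z \<leadsto> w" "th \<sigma> w = t"
      using th_forth[of z \<sigma> z' x] z'(2) rel_mcs(2)[OF z(1)] assms(2) by metis
    have "y \<leadsto> w" using z(1) w(1) by (rule trans)
    moreover have "t \<subseteq> w" using w(2) by (auto simp: th_def)
    ultimately have "w \<leadsto> y" using assms(3) by (auto simp: maximal_def)
    with w(1) show ?thesis by (rule trans)
  qed
  moreover have "\<alpha> \<in> y" using \<alpha>(1) assms(4) by (auto simp: th_def)
  ultimately show ?thesis using m(2) by (auto simp: definable_def)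
qed

text \<open>The order among the chosen points can be read off their theories:
  \<open>th_forth\<close> yields some successor with theory \<open>t'\<close>, and
  \<open>realizes\<close> replaces it by the chosen one.\<close>

lemma xm_rel:
  assumes r1: "realizes \<sigma> T xm1 ps1" and r2: "realizes \<sigma> T xm2 ps2"
    and t: "t \<in> set T" "t' \<in> set T" "xm1 t \<leadsto> xm1 t'"
  shows "xm2 t \<leadsto> xm2 t'"
proof -
  have th: "th \<sigma> (xm1 t) = t" "th \<sigma> (xm2 t) = t" "th \<sigma> (xm1 t') = t'" "mcs (xm2 t)"
    using r1 r2 t by (auto simp: realizes_def maximal_def)
  obtain y where y: "xm2 t \<leadsto> y" "th \<sigma> y = t'" using th_forth[OF th(4) _ t(3)] th by metis
  obtain j i where "(j, A i) \<in> worlds (pieces_frame ps2)" "rho ps2 (j, A i) = xm2 t"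
    using r2 t(1) unfolding realizes_def by blast
  then show ?thesis using r2 y t(2) unfolding realizes_def by metis
qed

lemma realizes_loc:
  assumes "realizes \<sigma> T xm ps" "t \<in> set T"
  obtains j i where "(j, A i) \<in> worlds (pieces_frame ps)" "\<not> root_piece (ps ! j)" "rho ps (j, A i) = xm t"
  using assms unfolding realizes_def by blast

text \<open>Definability and lying in one cluster depend only on the theories, and both pieces
  filter the same list \<open>T\<close>. So they arise from the same list of theories in the same
  order, and equal indices carry equal theories.\<close>

lemma limit_piece_transfer:
  assumes r1: "realizes \<sigma> T xm1 ps1" and r2: "realizes \<sigma> T xm2 ps2"
    and jn: "(j, B n) \<in> worlds (pieces_frame ps1)"
    and t: "t = th \<sigma> (rho ps1 (j, B n))"
    and j': "(j', A i) \<in> worlds (pieces_frame ps2)" "\<not> root_piece (ps2 ! j')" "rho ps2 (j', A i) = xm2 t"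
  shows "link \<sigma> T xm1 xm2 ps1 ps2 (j, B n) (j', B n) \<and> rho ps1 (j, B n) = xm1 t \<and> is_CC (p_atom (ps2 ! j'))"
proof -
  have ok: "ok_pieces ps1" "ok_pieces ps2" using r1 r2 by (auto simp: realizes_def)
  note p1 = rho_in_pts[OF ok(1) jn] and p2 = rho_in_pts[OF ok(2) j'(1)]
  have tT: "t \<in> set T" using r1 jn t by (auto simp: realizes_def)
  have "p_lim (ps1 ! j)" "\<not> root_piece (ps1 ! j)" using ok_piece_B[OF p1(2,3)] by blast+
  then obtain ts where ts: "ts \<noteq> []" "ts = filter (\<lambda>t. same_cluster (xm1 t) (xm1 (hd ts))) T"
    "p_pts (ps1 ! j) = map xm1 ts" "p_atom (ps1 ! j) = (if irr_limit \<sigma> (hd ts) then CIrr else CRefl) (length ts)"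
    using r1 nth_mem[OF p1(1)] unfolding realizes_def by blast
  have tsT: "set ts \<subseteq> set T" using ts(2) by (metis filter_is_subset)
  have th1: "th \<sigma> (xm1 s) = s" "maximal s (xm1 s)" "th \<sigma> (xm2 s) = s" "maximal s (xm2 s)" if "s \<in> set T" for s
    using r1 r2 that by (auto simp: realizes_def)
  have rho1: "rho ps1 (j, B n) = xm1 (ts ! (n mod length ts))" using ts by (simp add: rho_def)
  have nts: "ts ! (n mod length ts) \<in> set ts" using ts(1) by simp
  then have t_ts: "t = ts ! (n mod length ts)" using t rho1 th1(1) tsT by auto
  have "\<not> definable (xm1 t)" using p1(2,4) \<open>p_lim (ps1 ! j)\<close> rho1 t_ts by (auto simp: ok_piece_def)
  then have "\<not> definable (xm2 t)" using definable_th[OF th1(4,3,2,1)] tT by blast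
  then have lim2: "p_lim (ps2 ! j')" using ok_piece_lim_iff[OF p2(2,4)] j'(3) by simp
  then obtain ts' where ts': "ts' \<noteq> []" "ts' = filter (\<lambda>t. same_cluster (xm2 t) (xm2 (hd ts'))) T"
    "p_pts (ps2 ! j') = map xm2 ts'" "p_atom (ps2 ! j') = (if irr_limit \<sigma> (hd ts') then CIrr else CRefl) (length ts')"
    using r2 nth_mem[OF p2(1)] j'(2) unfolding realizes_def by blast
  have ts'T: "set ts' \<subseteq> set T" using ts'(2) by (metis filter_is_subset)
  have "xm2 t \<in> xm2 ` set ts'" using p2(4) j'(3) ts'(3) by simp
  then have t_ts': "t \<in> set ts'" using th1(3) tT ts'T by (metis imageE subsetD)
  have same: "same_cluster (xm1 s) (xm1 s') \<longleftrightarrow> same_cluster (xm2 s) (xm2 s')" if "s \<in> set T" "s' \<in> set T" for s s'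
    using that xm_rel[OF r1 r2] xm_rel[OF r2 r1] by (auto simp: same_cluster_def)
  have sc_trans: "same_cluster x y \<Longrightarrow> same_cluster y z \<Longrightarrow> same_cluster x z"
    and sc_sym: "same_cluster x y \<Longrightarrow> same_cluster y x" for x y z
    using trans by (auto simp: same_cluster_def)
  have hd: "hd ts \<in> set T" "hd ts' \<in> set T" using tsT ts'T ts(1) ts'(1) by auto
  have "same_cluster (xm1 t) (xm1 (hd ts))" 
  proof -
    have "t \<in> set (filter (\<lambda>t. same_cluster (xm1 t) (xm1 (hd ts))) T)"
      unfolding ts(2)[symmetric] using nts t_ts by simp
    then show ?thesis by simp
  qed
  then have 1: "same_cluster (xm2 t) (xm2 (hd ts))" using same tT hd by blast
  have 2: "same_cluster (xm2 t) (xm2 (hd ts'))" 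
  proof -
    have "t \<in> set (filter (\<lambda>t. same_cluster (xm2 t) (xm2 (hd ts'))) T)"
      unfolding ts'(2)[symmetric] using t_ts' .
    then show ?thesis by simp
  qed
  have 3: "same_cluster (xm1 s) (xm1 (hd ts)) \<longleftrightarrow> same_cluster (xm2 s) (xm2 (hd ts'))" if "s \<in> set T" for s
    using same[OF that hd(1)] 1 2 sc_trans sc_sym by metis
  have "filter (\<lambda>t. same_cluster (xm1 t) (xm1 (hd ts))) T = filter (\<lambda>t. same_cluster (xm2 t) (xm2 (hd ts'))) T"
    using 3 by (intro filter_cong) auto
  then have eq: "ts = ts'" using ts(2) ts'(2) by simp
  have at: "p_atom (ps1 ! j) = p_atom (ps2 ! j')" using eq ts(4) ts'(4) by simp
  have cc: "is_CC (p_atom (ps2 ! j'))" using ts'(4) by (auto simp: is_CC_def)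
  have W: "(j', B n) \<in> worlds (pieces_frame ps2)" using p2(1) ts'(4) by auto
  have "rho ps2 (j', B n) = xm2 t" using ts'(3) eq t_ts ts(1) by (simp add: rho_def)
  then have "th \<sigma> (rho ps1 (j, B n)) = th \<sigma> (rho ps2 (j', B n))" using th1(3) tT t by simp
  then have "link \<sigma> T xm1 xm2 ps1 ps2 (j, B n) (j', B n)"
    unfolding link_def using jn W at tsT ts(3) ts'(3) eq by auto
  then show ?thesis using rho1 t_ts cc by simp
qed

text \<open>A point \<open>A i\<close> of a limit piece sees that whole piece, so it suffices to
  find the chosen point for the theory of \<open>w\<close>. For a point \<open>B n\<close>, a step
  inside its piece is copied with the same index, and a step out of it must be shown to leave the
  other piece too.\<close>

lemma link_forth:
  assumes r1: "realizes \<sigma> T xm1 ps1" and r2: "realizes \<sigma> T xm2 ps2"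
    and link: "link \<sigma> T xm1 xm2 ps1 ps2 u u'" and acc: "(u, w) \<in> acc (pieces_frame ps1)"
  shows "\<exists>w'. (u', w') \<in> acc (pieces_frame ps2) \<and> link \<sigma> T xm1 xm2 ps1 ps2 w w'"
proof -
  have ok: "ok_pieces ps1" "ok_pieces ps2" using r1 r2 by (auto simp: realizes_def)
  have wW: "w \<in> worlds (pieces_frame ps1)"
    using general_frame_pieces[OF ok(1)] acc unfolding general_frame_def by blast
  have uW: "u \<in> worlds (pieces_frame ps1)" "u' \<in> worlds (pieces_frame ps2)"
    and th_u: "th \<sigma> (rho ps1 u) = th \<sigma> (rho ps2 u')" using link by (auto simp: link_def)
  define t where "t = th \<sigma> (rho ps1 w)"
  have tT: "t \<in> set T" using r1 wW by (auto simp: realizes_def t_def)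
  obtain j' i' where j': "(j', A i') \<in> worlds (pieces_frame ps2)" "\<not> root_piece (ps2 ! j')"
    "rho ps2 (j', A i') = xm2 t" using realizes_loc[OF r2 tT] .
  have xm2t: "th \<sigma> (xm2 t) = t" using r2 tT by (auto simp: realizes_def)
  \<comment> \<open>A point that sees an \<open>A\<close>-point of a limit piece also sees all the
    points \<open>B n\<close> there, so it can match either kind of \<open>w\<close>.\<close>
  have partner: "\<exists>w'. (u', w') \<in> acc (pieces_frame ps2) \<and> link \<sigma> T xm1 xm2 ps1 ps2 w w'"
    if acc': "(u', (j', A i')) \<in> acc (pieces_frame ps2)"
  proof (cases "snd w")
    case (A l)
    then have "link \<sigma> T xm1 xm2 ps1 ps2 w (j', A i')"
      using wW j' xm2t by (auto simp: link_def t_def)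
    then show ?thesis using acc' by blast
  next
    case (B n)
    then have w: "w = (fst w, B n)" by (cases w) auto
    have l: "link \<sigma> T xm1 xm2 ps1 ps2 w (j', B n)" "is_CC (p_atom (ps2 ! j'))"
      using limit_piece_transfer[OF r1 r2, of "fst w" n t j' i'] j' w wW t_def by metis+
    obtain l z where u': "u' = (l, z)" by (cases u')
    have "(u', (j', B n)) \<in> acc (pieces_frame ps2)"
      using acc' l(2) u' by (cases z) (auto simp: is_CC_def)
    then show ?thesis using l by blast
  qed
  have rel_uw: "rho ps1 u \<leadsto> rho ps1 w" using rho_mono[OF ok(1) acc] .
  have "mcs (rho ps2 u')" using rho_mcs[OF ok(2) uW(2)] .
  then obtain y where y: "rho ps2 u' \<leadsto> y" "th \<sigma> y = t" using th_forth[OF _ th_u rel_uw] t_def by metis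
  then have rel_u't: "rho ps2 u' \<leadsto> xm2 t" using r2 uW(2) tT unfolding realizes_def by metis
  from link consider (A) i where "snd u' = A i"
    | (B) n ts where "snd u = B n" "snd u' = B n" "p_atom (ps1 ! fst u) = p_atom (ps2 ! fst u')"
        "set ts \<subseteq> set T" "p_pts (ps1 ! fst u) = map xm1 ts" "p_pts (ps2 ! fst u') = map xm2 ts"
    unfolding link_def by blast
  then show ?thesis
  proof cases
    case A
    show ?thesis
      by (intro partner rel_acc[OF ok(2) uW(2) j'(1)]) (use A rel_u't j' in auto)
  next
    case B
    obtain j l where u: "u = (j, B n)" "u' = (l, B n)" using B by (cases u; cases u') auto
    obtain j2 y2 where w: "w = (j2, y2)" by (cases w)
    note p = rho_in_pts[OF ok(1) uW(1)[unfolded u(1)]] and p' = rho_in_pts[OF ok(2) uW(2)[unfolded u(2)]]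
    note pw = rho_in_pts[OF ok(1) wW[unfolded w]]
    consider "j2 = j" | "j < j2" using acc u w by auto
    then show ?thesis
    proof cases
      case 1
      obtain k where k: "p_atom (ps1 ! j) = CIrr k \<or> p_atom (ps1 ! j) = CRefl k"
        using ok_piece_B[OF p(2,3)] by (auto simp: is_CC_def)
      then obtain m where m: "y2 = B m" using acc u w 1 by (cases y2) auto
      have acc2: "(u', (l, B m)) \<in> acc (pieces_frame ps2)"
        using acc u w 1 m k B(3) p'(1,3) by auto
      have ne: "ts \<noteq> []" using p(2) B(5) u by (auto simp: ok_piece_def)
      have "th \<sigma> (rho ps1 w) = th \<sigma> (rho ps2 (l, B m))"
      proof -
        let ?s = "ts ! (m mod length ts)"
        have "?s \<in> set T" using ne B(4) by (metis length_greater_0_conv mod_less_divisor nth_mem subsetD)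
        then have "th \<sigma> (xm1 ?s) = th \<sigma> (xm2 ?s)" using r1 r2 by (simp add: realizes_def)
        then show ?thesis using w m 1 B(5,6) u ne by (simp add: rho_def)
      qed
      moreover have "(l, B m) \<in> worlds (pieces_frame ps2)"
        using general_frame_pieces[OF ok(2)] acc2 unfolding general_frame_def by blast
      ultimately have "link \<sigma> T xm1 xm2 ps1 ps2 w (l, B m)"
        unfolding link_def using wW w m 1 B u by auto
      then show ?thesis using acc2 by blast
    next
      case 2
      \<comment> \<open>As \<open>u'\<close> sees no \<open>A\<close>-point of its own piece, the
        piece of \<open>xm2 t\<close> has to come strictly after it. Otherwise \<open>xm2 t\<close>
        would see \<open>xm2 t0\<close>; by \<open>xm_rel\<close> the same would hold for
        \<open>xm1\<close>, and then \<open>w\<close> would see back into the cluster of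
        \<open>u\<close>.\<close>
      define t0 where "t0 = th \<sigma> (rho ps1 u)"
      have t0T: "t0 \<in> set T" using r1 uW by (auto simp: realizes_def t0_def)
      obtain j0 i0 where j0: "(j0, A i0) \<in> worlds (pieces_frame ps1)" "\<not> root_piece (ps1 ! j0)"
        "rho ps1 (j0, A i0) = xm1 t0" using realizes_loc[OF r1 t0T] .
      obtain j0' i0' where j0': "(j0', A i0') \<in> worlds (pieces_frame ps2)" "\<not> root_piece (ps2 ! j0')"
        "rho ps2 (j0', A i0') = xm2 t0" using realizes_loc[OF r2 t0T] .
      have x1: "rho ps1 u = xm1 t0"
        using limit_piece_transfer[OF r1 r2 uW(1)[unfolded u(1)] _ j0'] u(1) t0_def by blast
      have x2: "rho ps2 u' = xm2 t0"
        using limit_piece_transfer[OF r2 r1 uW(2)[unfolded u(2)] _ j0] u(2) th_u t0_def by simp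
      have rw: "\<not> rho ps1 w \<leadsto> rho ps1 u"
        using nth_rel_piece[OF ok(1) 2 pw(1)] p(4) pw(4) u(1) w ok_piece_B(3)[OF p(2,3)]
        by (auto simp: rel_piece_def)
      have wt: "rho ps1 u \<leadsto> xm1 t"
        using r1 uW(1) rel_uw tT unfolding realizes_def t_def by blast
      have nback: "\<not> xm1 t \<leadsto> xm1 t0"
      proof
        assume rl: "xm1 t \<leadsto> xm1 t0"
        have "\<exists>z. rho ps1 w \<leadsto> z \<and> th \<sigma> z = t0"
          using th_forth[OF rho_mcs[OF ok(1) wW] _ rl, of \<sigma>] r1 tT t0T t_def
          by (auto simp: realizes_def)
        then have "rho ps1 w \<leadsto> xm1 t0" using r1 wW t0T unfolding realizes_def by metis
        then show False using rw x1 by simp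
      qed
      have not2: "\<not> xm2 t \<leadsto> xm2 t0" using xm_rel[OF r2 r1 tT t0T] nback by blast
      note pt = rho_in_pts[OF ok(2) j'(1)]
      have "l < j'"
      proof (rule ccontr)
        assume "\<not> l < j'"
        then consider "j' < l" | "j' = l" by linarith
        then show False
        proof cases
          case 1
          then have "rel_piece (ps2 ! j') (ps2 ! l)" using nth_rel_piece[OF ok(2)] p'(1) by blast
          then have "xm2 t \<leadsto> xm2 t0" using pt(4) p'(4) j'(3) x2 u(2) by (auto simp: rel_piece_def)
          then show False using not2 by blast
        next
          case 2
          have "xm2 t \<in> set (p_pts (ps2 ! l))" "xm2 t0 \<in> set (p_pts (ps2 ! l))"
            using 2 pt(4) p'(4) j'(3) x2 u(2) by auto
          then have "xm2 t \<leadsto> xm2 t0" using p'(2) ok_piece_B[OF p'(2,3)] by (auto simp: ok_piece_def)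
          then show False using not2 by blast
        qed
      qed
      then show ?thesis using partner p' pt u by simp
    qed
  qed
qed

lemma realizes_bisimilar:
  assumes r1: "realizes \<sigma> T xm1 ps1" and r2: "realizes \<sigma> T xm2 ps2"
    and W: "(i, A k) \<in> worlds (pieces_frame ps1)" "(j, A l) \<in> worlds (pieces_frame ps2)"
    and th: "th \<sigma> (rho ps1 (i, A k)) = th \<sigma> (rho ps2 (j, A l))"
  shows "bisimilar \<sigma> (sum_model ps1) (i, A k) (sum_model ps2) (j, A l)"
proof -
  let ?\<beta> = "{(u, u'). link \<sigma> T xm1 xm2 ps1 ps2 u u'}"
  have "bisimulation \<sigma> (sum_model ps1) (sum_model ps2) ?\<beta>"
    unfolding bisimulation_def
  proof (intro conjI ballI)
    show "?\<beta> \<subseteq> worlds (fst (sum_model ps1)) \<times> worlds (fst (sum_model ps2))" by (auto simp: link_def)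
    fix uu assume "uu \<in> ?\<beta>"
    then obtain u u' where uu: "uu = (u, u')" and l: "link \<sigma> T xm1 xm2 ps1 ps2 u u'" by blast
    have "u \<in> snd (sum_model ps1) p \<longleftrightarrow> u' \<in> snd (sum_model ps2) p" if "p \<in> \<sigma>" for p
    proof -
      have "Var p \<in> th \<sigma> (rho ps1 u) \<longleftrightarrow> Var p \<in> th \<sigma> (rho ps2 u')" using l by (simp add: link_def)
      then show ?thesis using that l by (simp add: snd_sum_model th_def link_def)
    qed
    moreover have "\<exists>w'. (u', w') \<in> acc (pieces_frame ps2) \<and> (w, w') \<in> ?\<beta>"
      if "(u, w) \<in> acc (pieces_frame ps1)" for w
      using link_forth[OF r1 r2 l that] by blast
    moreover have "\<exists>w. (u, w) \<in> acc (pieces_frame ps1) \<and> (w, w') \<in> ?\<beta>"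
      if "(u', w') \<in> acc (pieces_frame ps2)" for w'
      using link_forth[OF r2 r1 link_sym[OF l] that] link_sym by blast
    ultimately show "case uu of (u, u') \<Rightarrow>
        (\<forall>p\<in>\<sigma>. u \<in> snd (sum_model ps1) p \<longleftrightarrow> u' \<in> snd (sum_model ps2) p) \<and>
        (\<forall>w. (u, w) \<in> acc (fst (sum_model ps1)) \<longrightarrow>
          (\<exists>w'. (u', w') \<in> acc (fst (sum_model ps2)) \<and> (w, w') \<in> ?\<beta>)) \<and>
        (\<forall>w'. (u', w') \<in> acc (fst (sum_model ps2)) \<longrightarrow>
          (\<exists>w. (u, w) \<in> acc (fst (sum_model ps1)) \<and> (w, w') \<in> ?\<beta>))"
      unfolding uu fst_sum_model by blast
  qed
  moreover have "((i, A k), (j, A l)) \<in> ?\<beta>" using W th by (auto simp: link_def)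
  ultimately show ?thesis unfolding bisimilar_def by blast
qed

end

section \<open>Building the models\<close>

lemma finite_sorted_list:
  assumes "finite C" "\<And>x y. x \<in> C \<Longrightarrow> y \<in> C \<Longrightarrow> x \<noteq> y \<Longrightarrow> r x y \<or> r y x"
    and tr: "\<And>x y z. r x y \<Longrightarrow> r y z \<Longrightarrow> r x z"
  shows "\<exists>l. set l = C \<and> distinct l \<and> sorted_wrt r l"
  using assms(1,2)
proof (induction C)
  case (insert a C)
  then obtain l where l: "set l = C" "distinct l" "sorted_wrt r l" by blast
  let ?l = "filter (\<lambda>x. r x a) l @ a # filter (\<lambda>x. \<not> r x a) l"
  have "r a x" if "x \<in> C" "\<not> r x a" for x using insert.prems[of x a] insert.hyps that by auto
  then have "sorted_wrt r ?l"
    using l by (auto simp: sorted_wrt_append sorted_wrt_filter intro: tr)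
  moreover have "distinct ?l" "set ?l = insert a C" using l insert.hyps by auto
  ultimately show ?case by blast
qed simp

context K43_theory
begin

lemma same_cluster_sym: "same_cluster x y \<Longrightarrow> same_cluster y x"
  and same_cluster_trans: "same_cluster x y \<Longrightarrow> same_cluster y z \<Longrightarrow> same_cluster x z"
  using trans by (auto simp: same_cluster_def)

lemma same_cluster_strict: "same_cluster x y \<Longrightarrow> x \<prec> w \<longleftrightarrow> y \<prec> w"
  using rel_strict_trans by (auto simp: same_cluster_def)

lemma same_cluster_strict': "same_cluster x y \<Longrightarrow> w \<prec> x \<longleftrightarrow> w \<prec> y"
  using strict_rel_trans by (auto simp: same_cluster_def)

lemma same_cluster_approx: "same_cluster x y \<Longrightarrow> approx r x \<longleftrightarrow> approx r y"
  unfolding approx_def using same_cluster_strict by blast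

lemma same_cluster_definable: "same_cluster x y \<Longrightarrow> definable x \<longleftrightarrow> definable y"
  using definable_cluster by (auto simp: same_cluster_def)

lemma ok_piece_A: "ok_piece p \<Longrightarrow> A i \<in> worlds (atom_frame (p_atom p)) \<longleftrightarrow> i < length (p_pts p)"
  by (auto simp: ok_piece_def split: if_splits)

lemma ok_piece_size: "ok_piece p \<Longrightarrow> atom_size (p_atom p) = length (p_pts p)"
  by (auto simp: ok_piece_def split: if_splits)

lemma ok_pieces_root:
  assumes ps: "ok_pieces ps" and u: "(0, A i) \<in> worlds (pieces_frame ps)"
  shows "is_root (pieces_frame ps) (0, A i)"
proof -
  have "(0, A i) = w \<or> ((0, A i), w) \<in> acc (pieces_frame ps)" if w: "w \<in> worlds (pieces_frame ps)" for w
  proof -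
    obtain j y where wj: "w = (j, y)" by (cases w)
    note p = rho_in_pts[OF ps u] and q = rho_in_pts[OF ps w[unfolded wj]]
    show ?thesis
    proof (cases "j = 0")
      case True
      then have "A i = y \<or> (A i, y) \<in> acc (atom_frame (p_atom (ps ! 0)))"
        using p(2,3) q(3) ok_piece_basic[OF p(2)] by (cases "p_atom (ps ! 0)") auto
      then show ?thesis using True wj p q by auto
    qed (use wj p q in auto)
  qed
  then show ?thesis using u unfolding is_root_def by blast
qed

definition mk_piece :: "nat set \<Rightarrow> fm set list \<Rightarrow> piece" where
  "mk_piece \<sigma> l =
     (if definable (hd l)
      then \<lparr>p_atom = (if hd l \<leadsto> hd l then Cluster (length l) else Chain 1), p_lim = False, p_pts = l\<rparr>
      else \<lparr>p_atom = (if irr_limit \<sigma> (th \<sigma> (hd l)) then CIrr else CRefl) (length l), p_lim = True, p_pts = l\<rparr>)"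

lemma mk_piece_simps [simp]:
  "p_pts (mk_piece \<sigma> l) = l" "p_lim (mk_piece \<sigma> l) \<longleftrightarrow> \<not> definable (hd l)" "\<not> root_piece (mk_piece \<sigma> l)"
  by (auto simp: mk_piece_def root_piece_def is_CC_def)

lemma ok_mk_piece:
  assumes "l \<noteq> []" "distinct l" "\<And>x. x \<in> set l \<Longrightarrow> mcs x"
    and cl: "\<And>x. x \<in> set l \<Longrightarrow> x = hd l \<or> same_cluster x (hd l)"
    and max: "\<not> definable (hd l) \<Longrightarrow> maximal (th \<sigma> (hd l)) (hd l)"
  shows "ok_piece (mk_piece \<sigma> l)"
proof -
  have hd: "hd l \<in> set l" using assms(1) by simp
  have rel: "x \<leadsto> y" if "hd l \<leadsto> hd l" "x \<in> set l" "y \<in> set l" for x y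
  proof -
    have "x \<leadsto> hd l" "hd l \<leadsto> y" using cl[OF that(2)] cl[OF that(3)] that(1) by (auto simp: same_cluster_def)
    then show ?thesis by (rule trans)
  qed
  have def: "definable x \<longleftrightarrow> definable (hd l)" if "x \<in> set l" for x
    using cl[OF that] same_cluster_definable by blast
  show ?thesis
  proof (cases "definable (hd l)")
    case True
    then have D: "definable x" if "x \<in> set l" for x using def that by blast
    show ?thesis
    proof (cases "hd l \<leadsto> hd l")
      case refl: True
      then show ?thesis using True assms(1-3) rel[OF refl] D by (simp add: ok_piece_def mk_piece_def)
    next
      case False
      have "x = hd l" if "x \<in> set l" for x
        using cl[OF that] False trans by (auto simp: same_cluster_def)
      then have s: "set l = {hd l}" using hd by blast
      then have "length l = 1" using distinct_card[OF assms(2)] by simp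
      then show ?thesis using True False assms(1-3) s by (simp add: ok_piece_def mk_piece_def)
    qed
  next
    case False
    then have D: "\<not> definable x" if "x \<in> set l" for x using def that by blast
    have refl: "hd l \<leadsto> hd l" using not_definable_reflexive assms(3)[OF hd] False by blast
    have "approx (\<not> irr_limit \<sigma> (th \<sigma> (hd l))) x" if "x \<in> set l" for x
      using approx_irr_limit[OF max[OF False] False] cl[OF that] same_cluster_approx by metis
    then show ?thesis
      using False assms(1-3) rel[OF refl] D
      by (auto simp: ok_piece_def mk_piece_def intro!: exI[of _ "\<not> irr_limit \<sigma> (th \<sigma> (hd l))"])
  qed
qed

text \<open>One maximal point for each theory in \<open>T\<close> and the points of \<open>S\<close>
  are grouped by cluster and sorted. \<open>Suc\<close> in the size accounts for a root
  piece.\<close>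

lemma build:
  assumes x0: "mcs x0" and T: "distinct T" "th \<sigma> x0 \<in> set T"
    and T_real: "\<And>t. t \<in> set T \<Longrightarrow> \<exists>y. (y = x0 \<or> x0 \<leadsto> y) \<and> th \<sigma> y = t"
    and S: "finite S" "\<And>s. s \<in> S \<Longrightarrow> s = x0 \<or> x0 \<leadsto> s" "\<And>s. s \<in> S \<Longrightarrow> definable s"
      "\<And>s. s \<in> S \<Longrightarrow> th \<sigma> s \<in> set T"
    and f: "f \<in> S" "\<And>y. f \<leadsto> y \<Longrightarrow> y \<leadsto> f" and x0S: "definable x0 \<Longrightarrow> x0 \<in> S"
  obtains ps xm i where "realizes \<sigma> T xm ps" "(0, A i) \<in> worlds (pieces_frame ps)" "rho ps (0, A i) = x0"
    "\<And>s. s \<in> S \<Longrightarrow> \<exists>j l. (j, A l) \<in> worlds (pieces_frame ps) \<and> \<not> p_lim (ps ! j) \<and> rho ps (j, A l) = s"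
    "\<And>u. u \<in> worlds (pieces_frame ps) \<Longrightarrow> rho ps u = x0 \<or> x0 \<leadsto> rho ps u"
    "sum_list (map (\<lambda>p. length (p_pts p)) ps) \<le> Suc (length T + card S)"
proof -
  define above where "above y \<longleftrightarrow> y = x0 \<or> x0 \<leadsto> y" for y
  have ab_mcs: "mcs y" if "above y" for y using that x0 rel_mcs by (auto simp: above_def)
  have ab_up: "above z" if "above y" "y \<leadsto> z" for y z using that trans unfolding above_def by blast
  have ab_conn: "y = z \<or> y \<leadsto> z \<or> z \<leadsto> y" if "above y" "above z" for y z
    using that conn unfolding above_def by blast
  have "\<exists>y. above y \<and> maximal t y \<and> th \<sigma> y = t" if t: "t \<in> set T" for t
  proof -
    obtain y where y: "above y" "th \<sigma> y = t" using T_real[OF t] by (auto simp: above_def)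
    have "t \<subseteq> y" using y(2) by (auto simp: th_def)
    then obtain y' where y': "y' = y \<or> y \<leadsto> y'" "maximal t y'" using maximal_exists[OF ab_mcs[OF y(1)]] by blast
    then have "above y'" using y(1) ab_up by blast
    moreover from this have "th \<sigma> y' = t"
      using th_subset[OF ab_mcs[OF y(1)], of y' \<sigma>] ab_mcs y(2) y'(2) by (auto simp: maximal_def)
    ultimately show ?thesis using y'(2) by blast
  qed
  then obtain xm where xm: "\<And>t. t \<in> set T \<Longrightarrow> above (xm t)" "\<And>t. t \<in> set T \<Longrightarrow> maximal t (xm t)"
    "\<And>t. t \<in> set T \<Longrightarrow> th \<sigma> (xm t) = t"
    by metis
  have "finite (S - xm ` set T)" using S(1) by simp
  from finite_distinct_list[OF this] obtain rest where rest: "set rest = S - xm ` set T" "distinct rest" by blast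
  \<comment> \<open>The points for the theories come first, in the order of \<open>T\<close>. All of
    \<open>rest\<close> is definable, so filtering out a limit cluster gives a list in the order of
    \<open>T\<close>, as \<open>realizes\<close> demands.\<close>
  define ql where "ql = map xm T @ rest"
  have "inj_on xm (set T)" using xm(3) by (metis inj_onI)
  then have ql: "distinct ql" "set ql = xm ` set T \<union> S"
    using rest T(1) by (auto simp: ql_def distinct_map)
  have "card (set rest) \<le> card S" using rest(1) S(1) by (simp add: card_mono)
  then have ql_len: "length ql \<le> length T + card S"
    using distinct_card[OF rest(2)] by (simp add: ql_def)
  have Q_ab: "above x" and Q_th: "th \<sigma> x \<in> set T" and Q_lim: "\<not> definable x \<Longrightarrow> maximal (th \<sigma> x) x"
    if "x \<in> set ql" for x
  proof -
    have "(\<exists>t\<in>set T. x = xm t) \<or> x \<in> S" using that ql(2) by blast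
    moreover have "above x" "th \<sigma> x \<in> set T" "maximal (th \<sigma> x) x" if "t \<in> set T" "x = xm t" for t
      using xm[OF that(1)] that by simp_all
    moreover have "above x" if "x \<in> S" using S(2)[OF that] by (simp add: above_def)
    ultimately show "above x" "th \<sigma> x \<in> set T" "\<not> definable x \<Longrightarrow> maximal (th \<sigma> x) x"
      using S(3,4) by blast+
  qed
  \<comment> \<open>The disjunct \<open>y = x\<close> is for irreflexive points, which are not in
    \<open>same_cluster\<close> with themselves.\<close>
  define pl where "pl x = filter (\<lambda>y. y = x \<or> same_cluster y x) ql" for x
  have pl_self: "x \<in> set (pl x)" if "x \<in> set ql" for x using that by (simp add: pl_def)
  have pl_eq: "pl x = pl y" if "x = y \<or> same_cluster x y" for x y
    unfolding pl_def
  proof (rule filter_cong[OF refl])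
    fix z
    show "(z = x \<or> same_cluster z x) = (z = y \<or> same_cluster z y)"
      using that same_cluster_trans same_cluster_sym by blast
  qed
  define Ls where "Ls = pl ` set ql"
  have Ls_hd: "hd l \<in> set l" "l = pl (hd l)" "l \<noteq> []" "hd l \<in> set ql" if l: "l \<in> Ls" for l
  proof -
    obtain x where x: "x \<in> set ql" "l = pl x" using l by (auto simp: Ls_def)
    then show ne: "l \<noteq> []" using pl_self[OF x(1)] by auto
    then show 1: "hd l \<in> set l" by simp
    then show "l = pl (hd l)" using pl_eq[of "hd l" x] x(2) by (auto simp: pl_def)
    show "hd l \<in> set ql" using 1 x(2) by (auto simp: pl_def)
  qed
  have Ls_mem: "x \<in> set ql \<and> (x = hd l \<or> same_cluster x (hd l)) \<and> l = pl x" if "l \<in> Ls" "x \<in> set l" for l x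
  proof -
    have "x \<in> set (pl (hd l))" using Ls_hd(2)[OF that(1)] that(2) by simp
    then have "x \<in> set ql \<and> (x = hd l \<or> same_cluster x (hd l))" by (simp add: pl_def)
    then show ?thesis using pl_eq[of x "hd l"] Ls_hd(2)[OF that(1)] by metis
  qed
  have total: "hd l \<prec> hd l' \<or> hd l' \<prec> hd l" if "l \<in> Ls" "l' \<in> Ls" "l \<noteq> l'" for l l'
  proof -
    have "\<not> (hd l = hd l' \<or> same_cluster (hd l) (hd l'))"
      using pl_eq Ls_hd(2)[OF that(1)] Ls_hd(2)[OF that(2)] that(3) by metis
    then show ?thesis
      using ab_conn[OF Q_ab[OF Ls_hd(4)[OF that(1)]] Q_ab[OF Ls_hd(4)[OF that(2)]]]
      by (auto simp: strict_def same_cluster_def)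
  qed
  have "finite Ls" by (simp add: Ls_def)
  then obtain ls where ls: "set ls = Ls" "distinct ls" "sorted_wrt (\<lambda>l l'. hd l \<prec> hd l') ls"
    using finite_sorted_list[of Ls "\<lambda>l l'. hd l \<prec> hd l'"] total strict_trans by blast
  have strict_mem: "x \<prec> y" if "l \<in> Ls" "l' \<in> Ls" "hd l \<prec> hd l'" "x \<in> set l" "y \<in> set l'" for l l' x y
    using Ls_mem[OF that(1,4)] Ls_mem[OF that(2,5)] that(3) same_cluster_strict same_cluster_strict' by metis
  have ok_mk: "ok_piece (mk_piece \<sigma> l)" if l: "l \<in> Ls" for l
  proof (rule ok_mk_piece)
    show "distinct l" using Ls_hd(2)[OF l] ql(1) by (metis distinct_filter pl_def)
    show "maximal (th \<sigma> (hd l)) (hd l)" if "\<not> definable (hd l)" using Q_lim Ls_hd(4)[OF l] that by blast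
    show "mcs x" if "x \<in> set l" for x using Ls_mem[OF l that] Q_ab ab_mcs by blast
  qed (use Ls_hd[OF l] Ls_mem[OF l] in auto)
  have rel_mk: "rel_piece (mk_piece \<sigma> l) (mk_piece \<sigma> l')" if "l \<in> Ls" "l' \<in> Ls" "hd l \<prec> hd l'" for l l'
    using strict_mem[OF that] by (auto simp: rel_piece_def strict_def)
  let ?ms = "map (mk_piece \<sigma>) ls"
  have fQ: "pl f \<in> Ls" "f \<in> set (pl f)" using f(1) ql(2) pl_self by (auto simp: Ls_def)
  have ls_ne: "ls \<noteq> []" using fQ ls(1) by auto
  \<comment> \<open>Any other last piece would lie strictly above the final point
    \<open>f\<close>.\<close>
  have last: "last ls = pl f"
  proof (rule ccontr)
    assume ne: "last ls \<noteq> pl f"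
    have lL: "last ls \<in> Ls" using ls(1) ls_ne last_in_set by blast
    obtain ks k where ks: "ls = ks @ [k]" using ls_ne by (metis append_butlast_last_id)
    then have "pl f \<in> set ks" using fQ(1) ls(1) ne by auto
    then have "hd (pl f) \<prec> hd (last ls)" using ls(3) ks by (auto simp: sorted_wrt_append)
    then have "f \<prec> hd (last ls)" using strict_mem[OF fQ(1) lL _ fQ(2) Ls_hd(1)[OF lL]] by blast
    then show False using f(2) by (auto simp: strict_def)
  qed
  have last_final: "y \<leadsto> x" if "x \<in> set (last ls)" "x \<leadsto> y" for x y
  proof -
    have x: "x = f \<or> same_cluster x f" using that(1) last by (auto simp: pl_def)
    then have "f \<leadsto> y" using that(2) trans by (auto simp: same_cluster_def)
    then show ?thesis using f(2) x trans by (auto simp: same_cluster_def)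
  qed
  have last_def: "definable (hd (last ls))"
    using Ls_mem[OF fQ] S(3)[OF f(1)] same_cluster_definable last by metis
  have ok_ms: "ok_pieces ?ms"
    unfolding ok_pieces_def
  proof (intro conjI)
    show "sorted_wrt rel_piece ?ms"
      unfolding sorted_wrt_map using ls(3) by (rule sorted_wrt_mono_rel[rotated]) (use rel_mk ls(1) in blast)
    show "\<forall>x\<in>set (p_pts (last ?ms)). \<forall>y. x \<leadsto> y \<longrightarrow> y \<leadsto> x"
      using last_final ls_ne by (simp add: last_map)
  qed (use ls_ne ok_mk ls(1) last_def in \<open>auto simp: last_map\<close>)
  obtain rt where rt: "rt = [] \<and> definable x0 \<or>
      (\<exists>p. rt = [p] \<and> \<not> definable x0 \<and> ok_piece p \<and> root_piece p \<and> p_pts p = [x0] \<and> A 0 \<in> worlds (atom_frame (p_atom p)))"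
  proof (cases "definable x0")
    case False
    obtain r where r: "approx r x0" using approx_exists[OF x0 False] by blast
    \<comment> \<open>The canonical root is reflexive here; the summand may nevertheless be
      irreflexive, because it follows \<open>r\<close>.\<close>
    let ?p = "\<lparr>p_atom = if r then Cluster 1 else Chain 1, p_lim = True, p_pts = [x0]\<rparr>"
    have "x0 \<leadsto> x0" using not_definable_reflexive[OF x0 False] .
    then have "ok_piece ?p" using r x0 False by (cases r) (auto simp: ok_piece_def)
    moreover have "root_piece ?p" "A 0 \<in> worlds (atom_frame (p_atom ?p))"
      by (simp_all add: root_piece_def is_CC_def)
    ultimately show ?thesis using False by (intro that[of "[?p]"]) simp
  qed (use that in blast)
  define ps where "ps = rt @ ?ms"
  have rt_p: "ok_piece p" "root_piece p" "p_pts p = [x0]" "\<not> definable x0" if "p \<in> set rt" for p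
    using rt that by auto
  have rel_rt: "rel_piece p (mk_piece \<sigma> l)" if "p \<in> set rt" "l \<in> Ls" for p l
    unfolding rel_piece_def
  proof (intro ballI)
    fix x y assume "x \<in> set (p_pts p)" and y: "y \<in> set (p_pts (mk_piece \<sigma> l))"
    then have x: "x = x0" using rt_p[OF that(1)] by simp
    have y': "y \<in> set ql" "y = hd l \<or> same_cluster y (hd l)" using Ls_mem[OF that(2)] y by auto
    have x0y: "x0 \<leadsto> y" using Q_ab[OF y'(1)] not_definable_reflexive[OF x0 rt_p(4)[OF that(1)]]
      by (auto simp: above_def)
    have "\<not> definable (hd l)" if "y \<leadsto> x0"
    proof -
      have "same_cluster y x0" using x0y that by (simp add: same_cluster_def)
      then show ?thesis using y'(2) same_cluster_definable rt_p(4)[OF \<open>p \<in> set rt\<close>] by metis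
    qed
    then show "x \<leadsto> y \<and> (y \<leadsto> x \<longrightarrow> p_lim (mk_piece \<sigma> l) \<and> root_piece p)"
      using x x0y rt_p(2)[OF that(1)] by simp
  qed
  have ok: "ok_pieces ps"
  proof -
    have "sorted_wrt rel_piece rt" using rt by auto
    then show ?thesis
      using ok_ms rt_p(1) rel_rt ls(1) ls_ne by (auto simp: ok_pieces_def ps_def sorted_wrt_append)
  qed
  have ps_in: "p \<in> set rt \<or> (\<exists>l\<in>Ls. p = mk_piece \<sigma> l)" if "p \<in> set ps" for p
    using that ls(1) by (auto simp: ps_def)
  have rho_Q: "rho ps u = x0 \<or> rho ps u \<in> set ql" if u: "u \<in> worlds (pieces_frame ps)" for u
  proof -
    obtain j y where uj: "u = (j, y)" by (cases u)
    note p = rho_in_pts[OF ok u[unfolded uj]]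
    show ?thesis using ps_in[OF nth_mem[OF p(1)]]
    proof
      assume "ps ! j \<in> set rt"
      then show ?thesis using p(4) rt_p(3) uj by auto
    next
      assume "\<exists>l\<in>Ls. ps ! j = mk_piece \<sigma> l"
      then show ?thesis using p(4) Ls_mem uj by auto
    qed
  qed
  have loc: "\<exists>j i. (j, A i) \<in> worlds (pieces_frame ps) \<and> ps ! j = mk_piece \<sigma> (pl x) \<and> rho ps (j, A i) = x"
    if x: "x \<in> set ql" for x
  proof -
    have "mk_piece \<sigma> (pl x) \<in> set ps" using x ls(1) by (auto simp: ps_def Ls_def)
    then obtain j where j: "j < length ps" "ps ! j = mk_piece \<sigma> (pl x)" by (auto simp: in_set_conv_nth)
    obtain i where i: "i < length (pl x)" "pl x ! i = x" using pl_self[OF x] by (auto simp: in_set_conv_nth)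
    have "ok_piece (ps ! j)" using ok j(1) by (simp add: ok_pieces_def)
    then have "A i \<in> worlds (atom_frame (p_atom (ps ! j)))" using ok_piece_A j(2) i(1) by simp
    then show ?thesis using j i by (intro exI[of _ j] exI[of _ i]) (simp add: rho_def)
  qed
  have pl_lim: "p_lim (mk_piece \<sigma> (pl x)) \<longleftrightarrow> \<not> definable x" if "x \<in> set ql" for x
  proof -
    have "pl x \<in> Ls" using that by (simp add: Ls_def)
    then show ?thesis using Ls_mem[OF _ pl_self[OF that]] same_cluster_definable by auto
  qed
  have real: "realizes \<sigma> T xm ps"
    unfolding realizes_def
  proof (intro conjI ballI allI impI)
    show "\<exists>j i. (j, A i) \<in> worlds (pieces_frame ps) \<and> \<not> root_piece (ps ! j) \<and> rho ps (j, A i) = xm t"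
      if "t \<in> set T" for t
      using loc[of "xm t"] that ql(2) by (metis UnI1 imageI mk_piece_simps(3))
    show "th \<sigma> (rho ps u) \<in> set T" if "u \<in> worlds (pieces_frame ps)" for u
      using rho_Q[OF that] Q_th T(2) by auto
  next
    fix u z assume u: "u \<in> worlds (pieces_frame ps)" and z: "rho ps u \<leadsto> z \<and> th \<sigma> z \<in> set T"
    let ?t = "th \<sigma> z"
    have "above (rho ps u)" using rho_Q[OF u] Q_ab by (auto simp: above_def)
    then have "above z" using ab_up z by blast
    define y where "y = xm ?t"
    have y: "above y" "maximal ?t y" using xm z by (auto simp: y_def)
    have "?t \<subseteq> z" by (auto simp: th_def)
    \<comment> \<open>\<open>z\<close> contains its own theory, and \<open>y\<close> is maximal for
      that theory; being comparable, \<open>z\<close> is \<open>y\<close> or sees it.\<close>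
    then have "z = y \<or> z \<leadsto> y" using ab_conn[OF \<open>above z\<close> y(1)] y(2) by (auto simp: maximal_def)
    then have "rho ps u \<leadsto> y" using z trans by blast
    then show "rho ps u \<leadsto> xm ?t" by (simp only: y_def)
  next
    fix p assume p: "p \<in> set ps" "p_lim p \<and> \<not> root_piece p"
    then obtain l where l: "l \<in> Ls" "p = mk_piece \<sigma> l" using ps_in rt_p(2) by blast
    have nd: "\<not> definable (hd l)" using p(2) l(2) by simp
    let ?P = "\<lambda>y. y = hd l \<or> same_cluster y (hd l)"
    define ts where "ts = filter (\<lambda>t. ?P (xm t)) T"
    have "\<not> ?P x" if "x \<in> set rest" for x
      using rest(1) S(3)[of x] nd same_cluster_definable[of x "hd l"] that by blast
    then have "filter ?P rest = []" by (simp add: filter_empty_conv)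
    moreover have "l = filter ?P ql" using Ls_hd(2)[OF l(1)] by (simp add: pl_def)
    ultimately have l_ts: "l = map xm ts" by (simp add: ql_def ts_def filter_map comp_def)
    then have ts_ne: "ts \<noteq> []" and hd_l: "hd l = xm (hd ts)" using Ls_hd(3)[OF l(1)] by (auto simp: hd_map)
    have "same_cluster (hd l) (hd l)"
      using not_definable_reflexive[OF _ nd] ab_mcs Q_ab Ls_hd(4)[OF l(1)] by (auto simp: same_cluster_def)
    then have "ts = filter (\<lambda>t. same_cluster (xm t) (xm (hd ts))) T"
      unfolding hd_l[symmetric] by (subst ts_def) (rule filter_cong, auto)
    moreover have "hd ts \<in> set T" using hd_in_set[OF ts_ne] by (auto simp: ts_def)
    then have "th \<sigma> (hd l) = hd ts" using hd_l xm(3) by simp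
    then have "p_atom p = (if irr_limit \<sigma> (hd ts) then CIrr else CRefl) (length ts)"
      using l(2) nd l_ts by (simp add: mk_piece_def)
    ultimately show "\<exists>ts. ts \<noteq> [] \<and> ts = filter (\<lambda>t. same_cluster (xm t) (xm (hd ts))) T \<and>
              p_pts p = map xm ts \<and> p_atom p = (if irr_limit \<sigma> (hd ts) then CIrr else CRefl) (length ts)"
      using ts_ne l l_ts by (intro exI[of _ ts]) simp
  qed (use ok xm in auto)
  have "\<exists>i. (0, A i) \<in> worlds (pieces_frame ps) \<and> rho ps (0, A i) = x0"
    using rt
  proof
    assume r: "rt = [] \<and> definable x0"
    then have x0Q: "x0 \<in> set ql" using x0S ql(2) by blast
    then obtain j i where ji: "(j, A i) \<in> worlds (pieces_frame ps)" "rho ps (j, A i) = x0" using loc by blast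
    note p = rho_in_pts[OF ok ji(1)]
    \<comment> \<open>If an earlier piece existed, its points would lie strictly below
      \<open>x0\<close>, although all chosen points are \<open>x0\<close> or above it.\<close>
    have "j = 0"
    proof (rule ccontr)
      assume "j \<noteq> 0"
      then have rel: "rel_piece (ps ! 0) (ps ! j)" using nth_rel_piece[OF ok] p(1) by blast
      have ps0: "ps ! 0 = mk_piece \<sigma> (ls ! 0)" "ls ! 0 \<in> Ls" using r ls_ne ls(1) by (auto simp: ps_def)
      let ?y = "hd (ls ! 0)"
      have "?y \<in> set (p_pts (ps ! 0))" using ps0 Ls_hd(1) by simp
      then have "?y \<leadsto> x0 \<and> \<not> x0 \<leadsto> ?y" using rel p(4) ji(2) ps0(1) by (auto simp: rel_piece_def)
      moreover have "above ?y" using Q_ab Ls_hd(4)[OF ps0(2)] by blast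
      ultimately show False by (auto simp: above_def)
    qed
    then show ?thesis using ji by blast
  next
    assume "\<exists>p. rt = [p] \<and> \<not> definable x0 \<and> ok_piece p \<and> root_piece p \<and> p_pts p = [x0] \<and> A 0 \<in> worlds (atom_frame (p_atom p))"
    then obtain p where "rt = [p]" "p_pts p = [x0]" "A 0 \<in> worlds (atom_frame (p_atom p))" by blast
    then show ?thesis by (intro exI[of _ 0]) (auto simp: ps_def rho_def)
  qed
  then obtain i where i: "(0, A i) \<in> worlds (pieces_frame ps)" "rho ps (0, A i) = x0" by blast
  \<comment> \<open>The groups are disjoint and without repetitions, so their total length is
    bounded by that of \<open>ql\<close>.\<close>
  have "distinct (concat ls)"
  proof (rule distinct_concat[OF ls(2)])
    show "distinct l" if "l \<in> set ls" for l
      using Ls_hd(2)[of l] that ls(1) ql(1) by (metis distinct_filter pl_def)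
    show "set l \<inter> set l' = {}" if "l \<in> set ls" "l' \<in> set ls" "l \<noteq> l'" for l l'
    proof (rule ccontr)
      assume "\<not> ?thesis"
      then obtain x where "x \<in> set l" "x \<in> set l'" by blast
      then have "l = pl x" "l' = pl x" using Ls_mem that(1,2) ls(1) by blast+
      then show False using that(3) by simp
    qed
  qed
  then have "length (concat ls) = card (set (concat ls))" by (simp only: distinct_card)
  also have "\<dots> \<le> card (set ql)" using Ls_mem ls(1) by (intro card_mono) auto
  also have "\<dots> \<le> length T + card S" using ql_len card_length[of ql] by linarith
  finally have len: "sum_list (map length ls) \<le> length T + card S" by (simp add: length_concat)
  show thesis
  proof (rule that[OF real i])
    show "\<exists>j l. (j, A l) \<in> worlds (pieces_frame ps) \<and> \<not> p_lim (ps ! j) \<and> rho ps (j, A l) = s" if "s \<in> S" for s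
      using loc[of s] pl_lim[of s] that ql(2) S(3) by (metis UnI2)
    show "rho ps u = x0 \<or> x0 \<leadsto> rho ps u" if "u \<in> worlds (pieces_frame ps)" for u
      using rho_Q[OF that] Q_ab by (auto simp: above_def)
    have "sum_list (map (\<lambda>p. length (p_pts p)) rt) \<le> 1" using rt by auto
    then show "sum_list (map (\<lambda>p. length (p_pts p)) ps) \<le> Suc (length T + card S)"
      using len by (simp add: ps_def comp_def)
  qed
qed

end

section \<open>Substitutions, the theory attached to the logic, and formula size\<close>

lemma subst_abbrevs [simp]:
  "subst s (Imp \<phi> \<psi>) = Imp (subst s \<phi>) (subst s \<psi>)" "subst s (Or \<phi> \<psi>) = Or (subst s \<phi>) (subst s \<psi>)"
  "subst s (Iff \<phi> \<psi>) = Iff (subst s \<phi>) (subst s \<psi>)" "subst s (Box \<phi>) = Box (subst s \<phi>)"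
  "subst s (Boxp \<phi>) = Boxp (subst s \<phi>)"
  by (simp_all add: Imp_def Or_def Iff_def Box_def Boxp_def)

lemma subst_subst: "subst s (subst t \<phi>) = subst (\<lambda>p. subst s (t p)) \<phi>"
  by (induction \<phi>) auto

lemma subst_id_on: "(\<And>p. p \<in> sig \<phi> \<Longrightarrow> s p = Var p) \<Longrightarrow> subst s \<phi> = \<phi>"
  by (induction \<phi>) auto

text \<open>Variables outside \<open>\<delta>\<close> are made true everywhere, so that points of the canonical model that
  agree on \<open>\<delta>\<close> and lie in one cluster are equal.\<close>

lemma K43_theory_cofinal_subframe_logic:
  assumes L: "L = logic_K43 \<oplus> {canonical_fm n R |n R. (n, R) \<in> \<G>}" and "finite \<delta>"
  shows "K43_theory {\<phi>. subst (\<lambda>p. if p \<in> \<delta> then Var p else Top) \<phi> \<in> L} \<delta> \<G>"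
proof -
  let ?s = "\<lambda>p. if p \<in> \<delta> then Var p else Top"
  have K43: "\<phi> \<in> L" if "\<phi> \<in> logic_K43" for \<phi> using that L by (auto simp: oplus_def intro: normal_cl.Ax)
  have L_taut: "\<phi> \<in> L" if "tautology \<phi>" for \<phi> using that L by (simp add: oplus_def normal_cl.Taut)
  have L_mp: "\<psi> \<in> L" if "Imp \<phi> \<psi> \<in> L" "\<phi> \<in> L" for \<phi> \<psi>
    using that unfolding L oplus_def by (rule normal_cl.MP)
  have L_nec: "Box \<phi> \<in> L" if "\<phi> \<in> L" for \<phi> using that unfolding L oplus_def by (rule normal_cl.Nec)
  have L_subst: "subst s \<phi> \<in> L" if "\<phi> \<in> L" for s \<phi> using that unfolding L oplus_def by (rule normal_cl.Subst)
  have L_K: "Imp (Box (Imp (Var 0) (Var 1))) (Imp (Box (Var 0)) (Box (Var 1))) \<in> L"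
    unfolding L oplus_def by (rule normal_cl.K)
  have L_dual: "Iff (Dia (Var 0)) (Neg (Box (Neg (Var 0)))) \<in> L"
    unfolding L oplus_def by (rule normal_cl.Dual)
  have L_4: "Imp (Box (Var 0)) (Box (Box (Var 0))) \<in> L"
    by (rule K43) (auto simp: logic_K43_def oplus_def intro!: normal_cl.Ax)
  have L_3: "Or (Box (Imp (Boxp (Var 0)) (Var 1))) (Box (Imp (Boxp (Var 1)) (Var 0))) \<in> L"
    by (rule K43) (auto simp: logic_K43_def oplus_def intro!: normal_cl.Ax)
  let ?K = "{\<phi>. subst ?s \<phi> \<in> L}"
  show ?thesis
  proof unfold_locales
    fix \<phi> \<psi> n G s p
    let ?t1 = "\<lambda>_ :: nat. subst ?s \<phi>" and ?t2 = "\<lambda>p :: nat. if p = 0 then subst ?s \<phi> else subst ?s \<psi>"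
    show "tautology \<phi> \<Longrightarrow> \<phi> \<in> ?K" using L_subst L_taut by blast
    show "Imp \<phi> \<psi> \<in> ?K \<Longrightarrow> \<phi> \<in> ?K \<Longrightarrow> \<psi> \<in> ?K"
      using L_mp by auto
    show "\<phi> \<in> ?K \<Longrightarrow> Box \<phi> \<in> ?K" using L_nec by auto
    show "Imp (Box (Imp \<phi> \<psi>)) (Imp (Box \<phi>) (Box \<psi>)) \<in> ?K"
      using L_subst[OF L_K, of ?t2] by simp
    show "Iff (Dia \<phi>) (Neg (Box (Neg \<phi>))) \<in> ?K"
      using L_subst[OF L_dual, of ?t1] by simp
    show "Imp (Box \<phi>) (Box (Box \<phi>)) \<in> ?K"
      using L_subst[OF L_4, of ?t1] by simp
    show "Or (Box (Imp (Boxp \<phi>) \<psi>)) (Box (Imp (Boxp \<psi>) \<phi>)) \<in> ?K"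
      using L_subst[OF L_3, of ?t2] by simp
    show "(n, G) \<in> \<G> \<Longrightarrow> subst s (canonical_fm n G) \<in> ?K"
    proof -
      assume "(n, G) \<in> \<G>"
      then have "canonical_fm n G \<in> L" using L by (auto simp: oplus_def intro: normal_cl.Ax)
      then show ?thesis using L_subst by (simp add: subst_subst)
    qed
    show "p \<notin> \<delta> \<Longrightarrow> Var p \<in> ?K"
      using L_taut[of Top] by (simp add: tautology_def)
    show "finite \<delta>" by fact
  qed
qed

lemma finite_sig [simp]: "finite (sig \<phi>)"
  by (induction \<phi>) auto

lemma finite_subfms [simp]: "finite (subfms \<phi>)"
  by (induction \<phi>) auto

lemma leaf_subfm: "\<exists>\<psi>\<in>subfms \<phi>. \<psi> = Top \<or> \<psi> = Bot \<or> (\<exists>p. \<psi> = Var p)"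
  by (induction \<phi>) auto

text \<open>Each diamond subformula is counted together with its negation, and a leaf of the formula
  with its negation adds the 2.\<close>

lemma Dia_subfms_card: "2 * card {\<psi>. Dia \<psi> \<in> subfms \<phi>} + 2 \<le> fm_size \<phi>"
proof -
  let ?D = "{\<psi>. Dia \<psi> \<in> subfms \<phi>}"
  obtain l where l: "l \<in> subfms \<phi>" "l = Top \<or> l = Bot \<or> (\<exists>p. l = Var p)" using leaf_subfm by blast
  have "inj_on Dia ?D" by (simp add: inj_on_def)
  moreover have "Dia ` ?D \<subseteq> subfms \<phi>" by auto
  ultimately have fin: "finite ?D" using finite_subset finite_subfms finite_image_iff by metis
  let ?X = "Dia ` ?D" and ?Y = "(Neg \<circ> Dia) ` ?D"
  have "card (?X \<union> ?Y \<union> {l, Neg l}) = card (?X \<union> ?Y) + card {l, Neg l}"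
    using fin l(2) by (intro card_Un_disjoint) auto
  also have "card (?X \<union> ?Y) = card ?X + card ?Y" using fin by (intro card_Un_disjoint) auto
  also have "card ?X = card ?D" by (simp add: card_image inj_on_def)
  also have "card ?Y = card ?D" by (simp add: card_image inj_on_def)
  also have "card {l, Neg l} = 2" using l(2) by auto
  finally have "2 * card ?D + 2 = card (?X \<union> ?Y \<union> {l, Neg l})" by simp
  also have "\<dots> \<le> fm_size \<phi>"
    unfolding fm_size_def using l(1) by (intro card_mono) auto
  finally show ?thesis .
qed

section \<open>Choosing the points and assembling the two models\<close>

context K43_theory
begin

text \<open>The summand 2 is for the final point and for \<open>x\<close>, which joins
  \<open>S\<close> only when it is definable.\<close>

lemma maximal_points:
  assumes x: "mcs x"
  obtains S f where "finite S" "\<And>s. s \<in> S \<Longrightarrow> s = x \<or> x \<leadsto> s" "\<And>s. s \<in> S \<Longrightarrow> definable s"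
    "f \<in> S" "\<And>y. f \<leadsto> y \<Longrightarrow> y \<leadsto> f" "definable x \<Longrightarrow> x \<in> S"
    "\<And>\<psi>. Dia \<psi> \<in> subfms \<phi> \<Longrightarrow> Dia \<psi> \<in> x \<Longrightarrow> \<exists>m\<in>S. x \<leadsto> m \<and> maximal {\<psi>} m"
    "card S \<le> card {\<psi>. Dia \<psi> \<in> subfms \<phi>} + 2"
proof -
  let ?D = "{\<psi>. Dia \<psi> \<in> subfms \<phi>}"
  have "Dia ` ?D \<subseteq> subfms \<phi>" by auto
  then have "finite (Dia ` ?D)" using finite_subset finite_subfms by blast
  then have fin: "finite ?D" by (rule finite_imageD) (simp add: inj_on_def)
  have "\<exists>m. x \<leadsto> m \<and> maximal {\<psi>} m" if dia: "Dia \<psi> \<in> x" for \<psi>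
  proof -
    obtain y where y: "x \<leadsto> y" "\<psi> \<in> y" using dia canon_rel_Dia[OF x] by blast
    then obtain m where "m = y \<or> y \<leadsto> m" "maximal {\<psi>} m"
      using maximal_exists[OF rel_mcs(2)[OF y(1)], of "{\<psi>}"] by blast
    then show ?thesis using y(1) trans by blast
  qed
  then obtain m where m: "\<And>\<psi>. Dia \<psi> \<in> x \<Longrightarrow> x \<leadsto> m \<psi>" "\<And>\<psi>. Dia \<psi> \<in> x \<Longrightarrow> maximal {\<psi>} (m \<psi>)" by metis
  have top: "BigAnd [] \<in> y" if "mcs y" for y using mcs_BigAnd[OF that, of "[]"] by simp
  \<comment> \<open>The empty conjunction holds everywhere, so a point maximal for it is final, and
    definable as well.\<close>
  obtain f where f: "f = x \<or> x \<leadsto> f" "maximal {BigAnd []} f"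
    using maximal_exists[OF x, of "{BigAnd []}"] top[OF x] by blast
  define M where "M = m ` {\<psi>. Dia \<psi> \<in> subfms \<phi> \<and> Dia \<psi> \<in> x}"
  define S where "S = insert f (M \<union> (if definable x then {x} else {}))"
  have finM: "finite M" unfolding M_def by (intro finite_imageI finite_subset[OF _ fin]) auto
  have "card M \<le> card {\<psi>. Dia \<psi> \<in> subfms \<phi> \<and> Dia \<psi> \<in> x}"
    unfolding M_def by (intro card_image_le finite_subset[OF _ fin]) auto
  also have "\<dots> \<le> card ?D" using fin by (intro card_mono) auto
  finally have cM: "card M \<le> card ?D" .
  have M: "x \<leadsto> s" "definable s" if "s \<in> M" for s
    using that m maximal_definable by (auto simp: M_def)
  show thesis
  proof (rule that[of S f])
    show "finite S" using finM by (simp add: S_def)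
    show "s = x \<or> x \<leadsto> s" if "s \<in> S" for s using that f(1) M by (auto simp: S_def split: if_splits)
    show "definable s" if "s \<in> S" for s
      using that maximal_definable[OF f(2)] M by (auto simp: S_def split: if_splits)
    show "f \<in> S" "definable x \<Longrightarrow> x \<in> S" by (simp_all add: S_def)
    show "y \<leadsto> f" if "f \<leadsto> y" for y using f(2) that top[OF rel_mcs(2)[OF that]] by (simp add: maximal_def)
    show "\<exists>m\<in>S. x \<leadsto> m \<and> maximal {\<psi>} m" if "Dia \<psi> \<in> subfms \<phi>" "Dia \<psi> \<in> x" for \<psi>
      using m that by (intro bexI[of _ "m \<psi>"]) (auto simp: S_def M_def)
    have "card S \<le> Suc (card (M \<union> (if definable x then {x} else {})))"
      unfolding S_def using finM by (intro card_insert_le_m1) auto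
    also have "card (M \<union> (if definable x then {x} else {})) \<le> card M + card (if definable x then {x} else {})"
      by (rule card_Un_le)
    also have "card (if definable x then {x} else {}) \<le> 1" by simp
    finally show "card S \<le> card ?D + 2" using cM by simp
  qed
qed

lemma simple_piece_model:
  assumes p: "ok_piece p" and "\<delta>' \<subseteq> \<delta>"
  shows "simple_model \<delta>' (piece_model p)" "atom_in_range \<delta> (p_atom p)"
proof -
  let ?xs = "p_pts p" let ?k = "length ?xs"
  have ne: "?k > 0" and dist: "distinct ?xs" using p by (auto simp: ok_piece_def)
  have gf: "general_frame (atom_frame (p_atom p))" using general_frame_atom ok_piece_basic[OF p] by blast
  have k: "?k \<le> 2 ^ card \<delta>" if "\<And>x y. x \<in> set ?xs \<Longrightarrow> y \<in> set ?xs \<Longrightarrow> x \<leadsto> y"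
    using cluster_card[of "set ?xs"] that distinct_card[OF dist] by simp
  show "atom_in_range \<delta> (p_atom p)"
    using p k ne by (auto simp: ok_piece_def split: if_splits)
  show "simple_model \<delta>' (piece_model p)"
  proof (cases "is_CC (p_atom p)")
    case True
    then obtain r where r: "p_atom p = (if r then CRefl else CIrr) ?k"
      using p by (auto simp: ok_piece_def is_CC_def split: if_splits)
    then have fr: "atom_frame (p_atom p) = CC ?k r" by simp
    have v: "snd (piece_model p) q = (\<Union>i\<in>{i. i < ?k \<and> Var q \<in> ?xs ! i}. CC_X ?k i)" for q
    proof (intro set_eqI)
      fix y
      show "y \<in> snd (piece_model p) q \<longleftrightarrow> y \<in> (\<Union>i\<in>{i. i < ?k \<and> Var q \<in> ?xs ! i}. CC_X ?k i)"
        using ne by (cases y) (auto simp: piece_model_def fr CC_X_def)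
    qed
    have sub: "{i. i < ?k \<and> Var q \<in> ?xs ! i} \<subseteq> {..<?k}" for q by auto
    have "snd (piece_model p) q \<in> internal (CC ?k r)" for q
      unfolding v by (rule CC_internal_UN[OF sub])
    then have "delta_model \<delta>' (piece_model p)"
      using gf by (simp add: delta_model_def piece_model_def fr)
    moreover have "\<exists>k>0. \<exists>r. fst (piece_model p) = CC k r \<and>
         (\<forall>q\<in>\<delta>'. \<exists>I\<subseteq>{..<k}. snd (piece_model p) q = (\<Union>i\<in>I. CC_X k i))"
    proof (intro exI[of _ ?k] conjI exI[of _ r] ballI)
      show "fst (piece_model p) = CC ?k r" by (simp add: piece_model_def fr)
      show "\<exists>I\<subseteq>{..<?k}. snd (piece_model p) q = (\<Union>i\<in>I. CC_X ?k i)" for q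
        unfolding v by (rule exI, rule conjI[OF sub refl])
    qed (rule ne)
    ultimately show ?thesis unfolding simple_model_def by blast
  next
    case False
    then have "\<exists>W R. finite W \<and> atom_frame (p_atom p) = kripke_frame W R"
      using ok_piece_basic[OF p] by (cases "p_atom p") (auto simp: is_CC_def)
    then obtain W R where WR: "finite W" "atom_frame (p_atom p) = kripke_frame W R" by blast
    then have "delta_model \<delta>' (piece_model p)" using gf by (auto simp: delta_model_def piece_model_def)
    then show ?thesis using WR unfolding simple_model_def by (auto simp: piece_model_def)
  qed
qed

lemma atomic_sum_pieces:
  assumes "ok_pieces ps"
  shows "atomic_sum \<delta> (map p_atom ps) (sum_model ps)" "delta_model \<delta> (sum_model ps)"
    "sum_size (map p_atom ps) = sum_list (map (\<lambda>p. length (p_pts p)) ps)"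
proof -
  have ok: "ok_piece p" if "p \<in> set ps" for p using assms that by (simp add: ok_pieces_def)
  have ne: "ps \<noteq> []" using assms by (simp add: ok_pieces_def)
  have fst_piece: "fst (piece_model p) = atom_frame (p_atom p)" for p by (simp add: piece_model_def)
  have "list_all2 (\<lambda>c M. fst M = atom_frame c \<and> simple_model \<delta> M) (map p_atom ps) (map piece_model ps)"
    using simple_piece_model(1)[OF ok] by (auto simp: list_all2_conv_all_nth fst_piece)
  then show "atomic_sum \<delta> (map p_atom ps) (sum_model ps)"
    using ne simple_piece_model(2)[OF ok] by (auto simp: atomic_sum_def sum_model_def)
  show "delta_model \<delta> (sum_model ps)"
    unfolding sum_model_def
    by (rule delta_model_ordered_sum) (use simple_piece_model(1)[OF ok] ne in \<open>auto simp: simple_model_def\<close>)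
  show "sum_size (map p_atom ps) = sum_list (map (\<lambda>p. length (p_pts p)) ps)"
    unfolding sum_size_def map_map comp_def
    by (intro arg_cong[of _ _ sum_list] map_cong refl) (simp add: ok_piece_size ok)
qed

lemma frame_for_pieces:
  assumes "ok_pieces ps"
  shows "frame_for (logic_K43 \<oplus> {canonical_fm n R |n R. (n, R) \<in> \<G>}) (pieces_frame ps)"
proof -
  have basic: "\<forall>c\<in>set (map p_atom ps). basic_atom c"
    using assms by (auto simp: ok_pieces_def ok_piece_basic)
  note gf = general_frame_pieces[OF assms]
  show ?thesis
  proof (rule frame_for_cofinal_subframe_logic[OF gf sum_frame_trans[OF basic]])
    show "y = z \<or> (y, z) \<in> acc (pieces_frame ps) \<or> (z, y) \<in> acc (pieces_frame ps)"
      if "(x, y) \<in> acc (pieces_frame ps)" "(x, z) \<in> acc (pieces_frame ps)" for x y z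
      using sum_frame_conn[OF basic] gf that unfolding general_frame_def by blast
  qed (rule valid_canonical_pieces[OF assms])
qed

lemma build_model:
  assumes x: "mcs x" and T: "distinct T" "th \<sigma> x \<in> set T"
    and T_real: "\<And>t. t \<in> set T \<Longrightarrow> \<exists>y. (y = x \<or> x \<leadsto> y) \<and> th \<sigma> y = t"
    and S: "finite S" "\<And>s. s \<in> S \<Longrightarrow> s = x \<or> x \<leadsto> s" "\<And>s. s \<in> S \<Longrightarrow> definable s"
      "\<And>s. s \<in> S \<Longrightarrow> th \<sigma> s \<in> set T"
    and f: "f \<in> S" "\<And>y. f \<leadsto> y \<Longrightarrow> y \<leadsto> f" "definable x \<Longrightarrow> x \<in> S"
    and dia: "\<And>\<psi>. Dia \<psi> \<in> subfms \<phi> \<Longrightarrow> Dia \<psi> \<in> x \<Longrightarrow> \<exists>m\<in>S. x \<leadsto> m \<and> maximal {\<psi>} m"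
    and \<phi>: "\<phi> \<in> x"
  obtains ps xm i where "realizes \<sigma> T xm ps" "(0, A i) \<in> worlds (pieces_frame ps)" "rho ps (0, A i) = x"
    "sat (sum_model ps) (0, A i) \<phi>"
    "sum_list (map (\<lambda>p. length (p_pts p)) ps) \<le> Suc (length T + card S)"
proof (rule build[OF x T T_real S f])
  fix ps xm i
  assume real: "realizes \<sigma> T xm ps" and i: "(0, A i) \<in> worlds (pieces_frame ps)" "rho ps (0, A i) = x"
    and loc: "\<And>s. s \<in> S \<Longrightarrow> \<exists>j l. (j, A l) \<in> worlds (pieces_frame ps) \<and> \<not> p_lim (ps ! j) \<and> rho ps (j, A l) = s"
    and above: "\<And>u. u \<in> worlds (pieces_frame ps) \<Longrightarrow> rho ps u = x \<or> x \<leadsto> rho ps u"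
    and size: "sum_list (map (\<lambda>p. length (p_pts p)) ps) \<le> Suc (length T + card S)"
  have ok: "ok_pieces ps" using real by (simp add: realizes_def)
  have wit: "\<exists>w. (u, w) \<in> acc (pieces_frame ps) \<and> \<psi> \<in> rho ps w"
    if \<psi>: "Dia \<psi> \<in> subfms \<phi>" and u: "u \<in> worlds (pieces_frame ps)" and d: "Dia \<psi> \<in> rho ps u" for \<psi> u
  proof -
    obtain z where z: "rho ps u \<leadsto> z" "\<psi> \<in> z" using d canon_rel_Dia[OF rho_mcs[OF ok u]] by blast
    have xz: "x \<leadsto> z" using above[OF u] z(1) trans by metis
    then have "Dia \<psi> \<in> x" using z(2) rel_Dia by blast
    then obtain m where m: "m \<in> S" "x \<leadsto> m" "maximal {\<psi>} m" using dia \<psi> by blast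
    \<comment> \<open>The chosen witness lies at or above every point with \<open>\<psi>\<close>
      that \<open>x\<close> sees. It sits outside the limit pieces, so even a point
      \<open>B n\<close> below it sees it.\<close>
    have "z = m \<or> z \<leadsto> m" using conn[OF xz m(2)] m(3) z(2) by (auto simp: maximal_def)
    then have rel: "rho ps u \<leadsto> m" using z(1) trans by metis
    obtain j l where jl: "(j, A l) \<in> worlds (pieces_frame ps)" "\<not> p_lim (ps ! j)" "rho ps (j, A l) = m"
      using loc[OF m(1)] by blast
    have "(u, (j, A l)) \<in> acc (pieces_frame ps)"
      by (rule rel_acc[OF ok u jl(1)]) (use jl rel in \<open>simp_all add: root_piece_def\<close>)
    then show ?thesis using jl(3) m(3) by (auto simp: maximal_def)
  qed
  have "sat (sum_model ps) (0, A i) \<phi>" using truth[OF ok wit i(1)] i(2) \<phi> by simp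
  with real i size show thesis using that by blast
qed

text \<open>Two Lindenbaum extensions: \<open>x2\<close> takes all
  \<open>\<sigma>\<close>-consequences of \<open>\<phi>\<^sub>1\<close>, consistent with
  \<open>Neg \<phi>\<^sub>2\<close> because their conjunctions are no interpolants. Then
  \<open>\<phi>\<^sub>1\<close> is consistent with the \<open>\<sigma>\<close>-theory of
  \<open>x2\<close>, for a refuting conjunction would make its own negation such a
  consequence.\<close>

lemma separating_points:
  assumes no: "\<And>\<iota>. sig \<iota> \<subseteq> \<sigma> \<Longrightarrow> Imp \<phi>\<^sub>1 \<iota> \<in> K \<Longrightarrow> Imp \<iota> \<phi>\<^sub>2 \<notin> K"
  obtains x1 x2 where "mcs x1" "mcs x2" "\<phi>\<^sub>1 \<in> x1" "Neg \<phi>\<^sub>2 \<in> x2" "th \<sigma> x1 = th \<sigma> x2"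
proof -
  let ?C = "{\<iota>. sig \<iota> \<subseteq> \<sigma> \<and> Imp \<phi>\<^sub>1 \<iota> \<in> K}"
  have BigAnd_C: "BigAnd \<phi>s \<in> ?C" if "set \<phi>s \<subseteq> ?C" for \<phi>s
    using that
  proof (induction \<phi>s)
    case Nil
    then show ?case by (auto simp: sig_BigAnd tautology_def intro!: taut)
  next
    case (Cons \<phi> \<phi>s)
    have "Imp \<phi>\<^sub>1 (BigAnd (\<phi> # \<phi>s)) \<in> K"
      by (rule taut_mp2[of "Imp \<phi>\<^sub>1 \<phi>" "Imp \<phi>\<^sub>1 (BigAnd \<phi>s)"]) (use Cons in \<open>auto simp: tautology_def\<close>)
    then show ?case using Cons.prems by (auto simp: sig_BigAnd)
  qed
  have "con (insert (Neg \<phi>\<^sub>2) ?C)"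
    unfolding con_def
  proof (intro allI impI notI)
    fix \<phi>s assume \<phi>s: "set \<phi>s \<subseteq> insert (Neg \<phi>\<^sub>2) ?C" and K: "Neg (BigAnd \<phi>s) \<in> K"
    let ?l = "filter (\<lambda>\<phi>. \<phi> \<noteq> Neg \<phi>\<^sub>2) \<phi>s"
    have "BigAnd ?l \<in> ?C" using \<phi>s by (intro BigAnd_C) auto
    moreover have "Imp (BigAnd ?l) \<phi>\<^sub>2 \<in> K" by (rule taut_mp[OF K]) (auto simp: tautology_def)
    ultimately show False using no by blast
  qed
  then obtain x2 where x2: "mcs x2" "insert (Neg \<phi>\<^sub>2) ?C \<subseteq> x2" using lindenbaum by blast
  have "con (insert \<phi>\<^sub>1 (th \<sigma> x2))"
    unfolding con_def
  proof (intro allI impI notI)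
    fix \<phi>s assume \<phi>s: "set \<phi>s \<subseteq> insert \<phi>\<^sub>1 (th \<sigma> x2)" and K: "Neg (BigAnd \<phi>s) \<in> K"
    let ?l = "filter (\<lambda>\<phi>. \<phi> \<in> th \<sigma> x2) \<phi>s"
    have "set ?l \<subseteq> th \<sigma> x2" by auto
    then have l: "BigAnd ?l \<in> th \<sigma> x2" using conj_closed_th[OF x2(1)] unfolding conj_closed_def by blast
    have "Imp \<phi>\<^sub>1 (Neg (BigAnd ?l)) \<in> K"
      by (rule taut_mp[OF K]) (use \<phi>s in \<open>auto simp: tautology_def\<close>)
    then have "Neg (BigAnd ?l) \<in> ?C" using l by (simp add: th_def)
    then have "Neg (BigAnd ?l) \<in> x2" using x2(2) by blast
    then show False using l mcs_Neg[OF x2(1)] by (simp add: th_def)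
  qed
  then obtain x1 where x1: "mcs x1" "insert \<phi>\<^sub>1 (th \<sigma> x2) \<subseteq> x1" using lindenbaum by blast
  show thesis
    by (rule that[of x1 x2]) (use x1 x2 th_subset[OF x2(1) x1(1)] in auto)
qed

lemma common_theories:
  assumes "mcs x1" "mcs x2" "th \<sigma> x1 = th \<sigma> x2" "y = x1 \<or> x1 \<leadsto> y"
  shows "\<exists>z. (z = x2 \<or> x2 \<leadsto> z) \<and> th \<sigma> z = th \<sigma> y"
  using assms th_forth by metis

end

theorem theorem4p25:
  fixes L :: "fm set" and \<phi>\<^sub>1 \<phi>\<^sub>2 :: fm
  assumes "cofinal_subframe_logic L"
    and "\<not> (\<exists>\<iota>. craig_interpolant L \<phi>\<^sub>1 \<phi>\<^sub>2 \<iota>)"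
  shows "\<exists>cs\<^sub>1 cs\<^sub>2 (N\<^sub>1 :: (nat \<times> point) model) (N\<^sub>2 :: (nat \<times> point) model) x\<^sub>1 x\<^sub>2.
    delta_model (sig \<phi>\<^sub>1 \<union> sig \<phi>\<^sub>2) N\<^sub>1 \<and> is_root (fst N\<^sub>1) x\<^sub>1 \<and>
    delta_model (sig \<phi>\<^sub>1 \<union> sig \<phi>\<^sub>2) N\<^sub>2 \<and> is_root (fst N\<^sub>2) x\<^sub>2 \<and>
    atomic_sum (sig \<phi>\<^sub>1 \<union> sig \<phi>\<^sub>2) cs\<^sub>1 N\<^sub>1 \<and>
    atomic_sum (sig \<phi>\<^sub>1 \<union> sig \<phi>\<^sub>2) cs\<^sub>2 N\<^sub>2 \<and>
    sat N\<^sub>1 x\<^sub>1 \<phi>\<^sub>1 \<and> sat N\<^sub>2 x\<^sub>2 (Neg \<phi>\<^sub>2) \<and>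
    frame_for L (fst N\<^sub>1) \<and> frame_for L (fst N\<^sub>2) \<and>
    bisimilar (sig \<phi>\<^sub>1 \<inter> sig \<phi>\<^sub>2) N\<^sub>1 x\<^sub>1 N\<^sub>2 x\<^sub>2 \<and>
    sum_size cs\<^sub>1 \<le> kbound \<phi>\<^sub>1 \<phi>\<^sub>2 \<and> sum_size cs\<^sub>2 \<le> kbound \<phi>\<^sub>1 \<phi>\<^sub>2"
proof -
  define \<delta> where "\<delta> = sig \<phi>\<^sub>1 \<union> sig \<phi>\<^sub>2"
  define \<sigma> where "\<sigma> = sig \<phi>\<^sub>1 \<inter> sig \<phi>\<^sub>2"
  obtain \<G> where L: "L = logic_K43 \<oplus> {canonical_fm n R |n R. (n, R) \<in> \<G>}"
    using assms(1) by (auto simp: cofinal_subframe_logic_def)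
  define s where "s p = (if p \<in> \<delta> then Var p else Top)" for p
  interpret K43_theory "{\<phi>. subst s \<phi> \<in> L}" \<delta> \<G>
    unfolding s_def by (rule K43_theory_cofinal_subframe_logic[OF L]) (simp add: \<delta>_def)
  have sub: "subst s \<phi> = \<phi>" if "sig \<phi> \<subseteq> \<delta>" for \<phi> using that by (intro subst_id_on) (auto simp: s_def)
  have "Imp \<iota> \<phi>\<^sub>2 \<notin> {\<phi>. subst s \<phi> \<in> L}" if "sig \<iota> \<subseteq> \<sigma>" "Imp \<phi>\<^sub>1 \<iota> \<in> {\<phi>. subst s \<phi> \<in> L}" for \<iota>
  proof -
    have "sig \<iota> \<subseteq> \<delta>" using that(1) by (auto simp: \<sigma>_def \<delta>_def)
    then have "subst s \<iota> = \<iota>" "subst s \<phi>\<^sub>1 = \<phi>\<^sub>1" "subst s \<phi>\<^sub>2 = \<phi>\<^sub>2" using sub by (auto simp: \<delta>_def)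
    then show ?thesis using assms(2) that by (auto simp: craig_interpolant_def \<sigma>_def)
  qed
  from separating_points[OF this] obtain x1 x2 where x: "mcs x1" "mcs x2" "\<phi>\<^sub>1 \<in> x1" "Neg \<phi>\<^sub>2 \<in> x2"
    "th \<sigma> x1 = th \<sigma> x2" by metis
  obtain S1 f1 where S1: "finite S1" "\<And>s. s \<in> S1 \<Longrightarrow> s = x1 \<or> canon_rel x1 s" "\<And>s. s \<in> S1 \<Longrightarrow> definable s"
    "f1 \<in> S1" "\<And>y. canon_rel f1 y \<Longrightarrow> canon_rel y f1" "definable x1 \<Longrightarrow> x1 \<in> S1"
    "\<And>\<psi>. Dia \<psi> \<in> subfms \<phi>\<^sub>1 \<Longrightarrow> Dia \<psi> \<in> x1 \<Longrightarrow> \<exists>m\<in>S1. canon_rel x1 m \<and> maximal {\<psi>} m"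
    "card S1 \<le> card {\<psi>. Dia \<psi> \<in> subfms \<phi>\<^sub>1} + 2"
    by (rule maximal_points[OF x(1), of \<phi>\<^sub>1]; rule that)
  obtain S2 f2 where S2: "finite S2" "\<And>s. s \<in> S2 \<Longrightarrow> s = x2 \<or> canon_rel x2 s" "\<And>s. s \<in> S2 \<Longrightarrow> definable s"
    "f2 \<in> S2" "\<And>y. canon_rel f2 y \<Longrightarrow> canon_rel y f2" "definable x2 \<Longrightarrow> x2 \<in> S2"
    "\<And>\<psi>. Dia \<psi> \<in> subfms (Neg \<phi>\<^sub>2) \<Longrightarrow> Dia \<psi> \<in> x2 \<Longrightarrow> \<exists>m\<in>S2. canon_rel x2 m \<and> maximal {\<psi>} m"
    "card S2 \<le> card {\<psi>. Dia \<psi> \<in> subfms (Neg \<phi>\<^sub>2)} + 2"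
    by (rule maximal_points[OF x(2), of "Neg \<phi>\<^sub>2"]; rule that)
  \<comment> \<open>The theory of the roots is inserted because a non-definable root is in neither
    \<open>S1\<close> nor \<open>S2\<close>, and every label needs its theory in
    \<open>T\<close>.\<close>
  let ?T = "insert (th \<sigma> x1) (th \<sigma> ` (S1 \<union> S2))"
  have "finite ?T" using S1(1) S2(1) by simp
  from finite_distinct_list[OF this] obtain T where T: "set T = ?T" "distinct T" by blast
  have T_len: "length T \<le> Suc (card S1 + card S2)"
  proof -
    have "length T = card ?T" using distinct_card[OF T(2)] T(1) by simp
    also have "\<dots> \<le> Suc (card (th \<sigma> ` (S1 \<union> S2)))" by (rule card_insert_le_m1[OF zero_less_Suc]) simp
    also have "card (th \<sigma> ` (S1 \<union> S2)) \<le> card (S1 \<union> S2)" using S1(1) S2(1) by (intro card_image_le) simp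
    also have "card (S1 \<union> S2) \<le> card S1 + card S2" by (rule card_Un_le)
    finally show ?thesis by simp
  qed
  have T1: "\<exists>y. (y = x1 \<or> canon_rel x1 y) \<and> th \<sigma> y = t" if "t \<in> set T" for t
  proof -
    consider "t = th \<sigma> x1" | s where "s \<in> S1" "t = th \<sigma> s" | s where "s \<in> S2" "t = th \<sigma> s"
      using \<open>t \<in> set T\<close> unfolding T(1) by blast
    then show ?thesis
    proof cases
      case (2 s)
      then show ?thesis using S1(2)[of s] by auto
    next
      case (3 s)
      then show ?thesis using common_theories[OF x(2,1) x(5)[symmetric] S2(2)] by simp
    qed auto
  qed
  have T2: "\<exists>y. (y = x2 \<or> canon_rel x2 y) \<and> th \<sigma> y = t" if "t \<in> set T" for t
  proof -
    obtain y where y: "y = x1 \<or> canon_rel x1 y" "th \<sigma> y = t" using T1[OF \<open>t \<in> set T\<close>] by blast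
    then show ?thesis using common_theories[OF x(1,2,5) y(1)] by simp
  qed
  have S_T: "th \<sigma> y \<in> set T" if "y \<in> S1 \<union> S2" for y using that T(1) by blast
  obtain ps1 xm1 i where 1: "realizes \<sigma> T xm1 ps1" "(0, A i) \<in> worlds (pieces_frame ps1)"
    "rho ps1 (0, A i) = x1" "sat (sum_model ps1) (0, A i) \<phi>\<^sub>1"
    "sum_list (map (\<lambda>p. length (p_pts p)) ps1) \<le> Suc (length T + card S1)"
    by (rule build_model[OF x(1) T(2) _ T1 S1(1-3) _ S1(4-7) x(3)]; (rule that)?)
      (use T(1) S_T in auto)
  obtain ps2 xm2 j where 2: "realizes \<sigma> T xm2 ps2" "(0, A j) \<in> worlds (pieces_frame ps2)"
    "rho ps2 (0, A j) = x2" "sat (sum_model ps2) (0, A j) (Neg \<phi>\<^sub>2)"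
    "sum_list (map (\<lambda>p. length (p_pts p)) ps2) \<le> Suc (length T + card S2)"
    by (rule build_model[OF x(2) T(2) _ T2 S2(1-3) _ S2(4-7) x(4)]; (rule that)?)
      (use T(1) S_T x(5) in auto)
  have ok: "ok_pieces ps1" "ok_pieces ps2" using 1(1) 2(1) by (simp_all add: realizes_def)
  have bis: "bisimilar \<sigma> (sum_model ps1) (0, A i) (sum_model ps2) (0, A j)"
    by (rule realizes_bisimilar[OF 1(1) 2(1) 1(2) 2(2)]) (simp only: 1(3) 2(3) x(5))
  let ?d1 = "card {\<psi>. Dia \<psi> \<in> subfms \<phi>\<^sub>1}" and ?d2 = "card {\<psi>. Dia \<psi> \<in> subfms \<phi>\<^sub>2}"
  \<comment> \<open>With \<open>d\<close> the larger of \<open>?d1\<close> and \<open>?d2\<close>,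
    model \<open>i\<close> has size at most \<open>1 + length T + card Si\<close>, hence at most
    \<open>2 + 3 * (d + 2) = 3 * d + 8\<close>. The bound is at least
    \<open>3 + 3 * (2 * d + 2) = 6 * d + 9\<close>.\<close>
  have "2 * ?d1 + 2 \<le> max (fm_size \<phi>\<^sub>1) (fm_size \<phi>\<^sub>2)" "2 * ?d2 + 2 \<le> max (fm_size \<phi>\<^sub>1) (fm_size \<phi>\<^sub>2)"
    using Dia_subfms_card[of \<phi>\<^sub>1] Dia_subfms_card[of \<phi>\<^sub>2] by linarith+
  moreover have "card S1 \<le> ?d1 + 2" "card S2 \<le> ?d2 + 2" using S1(8) S2(8) by simp_all
  ultimately have "sum_size (map p_atom ps1) \<le> kbound \<phi>\<^sub>1 \<phi>\<^sub>2" "sum_size (map p_atom ps2) \<le> kbound \<phi>\<^sub>1 \<phi>\<^sub>2"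
    using 1(5) 2(5) T_len unfolding kbound_def atomic_sum_pieces(3)[OF ok(1)] atomic_sum_pieces(3)[OF ok(2)]
    by linarith+
  then show ?thesis
    unfolding \<delta>_def[symmetric] \<sigma>_def[symmetric]
    using atomic_sum_pieces(1,2)[OF ok(1)] atomic_sum_pieces(1,2)[OF ok(2)] 1(4) 2(4) bis
      frame_for_pieces[OF ok(1)] frame_for_pieces[OF ok(2)]
      ok_pieces_root[OF ok(1) 1(2)] ok_pieces_root[OF ok(2) 2(2)]
    unfolding L[symmetric] fst_sum_model[symmetric] by blast
qed

end
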